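(* Let $n\ge2$, let $\mathbf F_n$ be the free group with generators $g_1,\dots,g_n$, let $\lambda$ be its left regular representation, and let $E_n^\lambda=\mathrm{span}\{\lambda(g_i)\mid i=1,\dots,n\}\subset C^*_\lambda(\mathbf F_n)$. Then $$d_{SK}\big((E_n^\lambda)^*\big)\ \ge\ \frac{n}{2\sqrt{n-1}}.$$
   Context: An operator space is a closed subspace $E\subset B(H)$, $H$ a complex Hilbert space, with the norms on $M_n(E)$ induced by $B(\ell_2^n(H))$. For linear $u:E\to F$, $\|u\|_{cb}=\sup_{n\ge1}\|I_{M_n}\otimes u\|_{M_n(E)\to M_n(F)}$. For operator spaces $E,F$, $d_{cb}(E,F)=\inf\{\|u\|_{cb}\|u^{-1}\|_{cb}\}$ over all isomorphisms $u:E\to F$ ($=\infty$ if there is no complete isomorphism). Let $K=K(\ell_2)$ be the space of compact operators on $\ell_2$, and $$d_{SK}(E)=\inf\{d_{cb}(E,F)\mid F\subset K\text{ a closed subspace}\};$$ for finite dimensional $E$ this equals $\inf\{d_{cb}(E,F)\mid F\subset M_k,\ k\ge1\}$. $C^*_\lambda(\mathbf F_n)$ is the reduced $C^*$-algebra of $\mathbf F_n$ (generated by the left regular representation $\lambda$ on $\ell_2(\mathbf F_n)$). The dual $E^*$ of an operator space $E$ carries the dual operator space structure $M_n(E^* )=cb(E,M_n)$ (isometrically). *)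

theory Defs
  imports "HOL-Analysis.Analysis"
begin

section \<open>The free group on a type of generators\<close>

text \<open>A letter \<open>(a, True)\<close> stands for the generator \<open>a\<close> and \<open>(a, False)\<close> for its inverse.\<close>

definition inv_letter :: "'a \<times> bool \<Rightarrow> 'a \<times> bool" where
  "inv_letter l = (fst l, \<not> snd l)"

definition reduced :: "('a \<times> bool) list \<Rightarrow> bool" where
  "reduced w \<longleftrightarrow> successively (\<lambda>k l. l \<noteq> inv_letter k) w"

definition red_cons :: "'a \<times> bool \<Rightarrow> ('a \<times> bool) list \<Rightarrow> ('a \<times> bool) list" where
  "red_cons l w = (if w \<noteq> [] \<and> hd w = inv_letter l then tl w else l # w)"

lemma inv_letter_inv_letter [simp]: "inv_letter (inv_letter l) = l"
  by (simp add: inv_letter_def)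

lemma inv_letter_neq [simp]: "inv_letter l \<noteq> l" "l \<noteq> inv_letter l"
  by (auto simp: inv_letter_def prod_eq_iff)

lemma inv_letter_inject [simp]: "inv_letter k = inv_letter l \<longleftrightarrow> k = l"
  by (auto simp: inv_letter_def prod_eq_iff)

lemma reduced_Nil [simp]: "reduced []"
  by (simp add: reduced_def)

lemma reduced_Cons: "reduced (l # w) \<longleftrightarrow> reduced w \<and> (w \<noteq> [] \<longrightarrow> hd w \<noteq> inv_letter l)"
  by (auto simp: reduced_def successively_Cons)

lemma reduced_red_cons: "reduced w \<Longrightarrow> reduced (red_cons l w)"
  by (cases w) (auto simp: red_cons_def reduced_Cons)

lemma red_cons_inv: "reduced w \<Longrightarrow> red_cons l (red_cons (inv_letter l) w) = w"
  by (cases w) (auto simp: red_cons_def reduced_Cons neq_Nil_conv)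

lemma reduced_foldr_red_cons: "reduced v \<Longrightarrow> reduced (foldr red_cons u v)"
  by (induction u) (auto simp: reduced_red_cons)

lemma foldr_red_cons_Nil: "reduced u \<Longrightarrow> foldr red_cons u [] = u"
  by (induction u) (auto simp: reduced_Cons red_cons_def)

lemma foldr_red_cons_red_cons:
  assumes "reduced w"
  shows "foldr red_cons (red_cons l u) w = red_cons l (foldr red_cons u w)"
proof (cases "u \<noteq> [] \<and> hd u = inv_letter l")
  case True
  then obtain u' where u: "u = inv_letter l # u'"
    by (cases u) auto
  have "reduced (foldr red_cons u' w)"
    using assms by (rule reduced_foldr_red_cons)
  then show ?thesis
    by (simp add: u red_cons_def[of l "inv_letter l # u'"] red_cons_inv)
next
  case False
  then show ?thesis
    by (auto simp: red_cons_def[of l u])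
qed

lemma foldr_red_cons_assoc:
  "reduced w \<Longrightarrow> foldr red_cons (foldr red_cons u v) w = foldr red_cons u (foldr red_cons v w)"
  by (induction u) (auto simp: foldr_red_cons_red_cons)

lemma reduced_inverse: "reduced w \<Longrightarrow> reduced (rev (map inv_letter w))"
  by (auto simp: reduced_def successively_rev successively_map elim!: successively_mono)

lemma foldr_red_cons_inverse:
  "reduced v \<Longrightarrow> foldr red_cons (rev (map inv_letter u)) (foldr red_cons u v) = v"
proof (induction u)
  case (Cons l u)
  then show ?case
    using red_cons_inv[of "foldr red_cons u v" "inv_letter l"]
    by (simp add: reduced_foldr_red_cons)
qed simp

typedef 'a free_group = "{w :: ('a \<times> bool) list. reduced w}"
  by (rule exI[of _ "[]"]) simp

setup_lifting type_definition_free_group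

text \<open>The class \<open>group_add\<close> does not assume commutativity, so the group law is written
  additively.\<close>

instantiation free_group :: (type) group_add
begin

lift_definition zero_free_group :: "'a free_group" is "[]"
  by simp

lift_definition plus_free_group :: "'a free_group \<Rightarrow> 'a free_group \<Rightarrow> 'a free_group"
  is "foldr red_cons"
  by (rule reduced_foldr_red_cons)

lift_definition uminus_free_group :: "'a free_group \<Rightarrow> 'a free_group"
  is "\<lambda>w. rev (map inv_letter w)"
  by (rule reduced_inverse)

definition minus_free_group :: "'a free_group \<Rightarrow> 'a free_group \<Rightarrow> 'a free_group" where
  "minus_free_group x y = x + - y"

instance
proof
  fix a b c :: "'a free_group"
  show "a + b + c = a + (b + c)"
    by transfer (simp add: foldr_red_cons_assoc)
  show "0 + a = a"
    by transfer simp
  show "a + 0 = a"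
    by transfer (simp add: foldr_red_cons_Nil)
  show "- a + a = 0"
  proof transfer
    fix a :: "('a \<times> bool) list"
    assume "reduced a"
    then show "foldr red_cons (rev (map inv_letter a)) a = []"
      using foldr_red_cons_inverse[of "[]" a] by (simp add: foldr_red_cons_Nil)
  qed
  show "a + - b = a - b"
    by (simp add: minus_free_group_def)
qed

end

lift_definition free_gen :: "'a \<Rightarrow> 'a free_group" is "\<lambda>a. [(a, True)]"
  by (simp add: reduced_Cons)


section \<open>The complex Hilbert space of square summable families\<close>

typedef 'i ell2 = "{f :: 'i \<Rightarrow> complex. (\<lambda>i. (cmod (f i))\<^sup>2) summable_on UNIV}"
  morphisms ell2_coord Abs_ell2
  by (rule exI[of _ "\<lambda>_. 0"]) simp

setup_lifting type_definition_ell2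

lemma ell2_inner_summable:
  assumes "(\<lambda>i. (cmod (f i))\<^sup>2) summable_on UNIV" "(\<lambda>i. (cmod (g i))\<^sup>2) summable_on UNIV"
  shows "(\<lambda>i. inner (f i) (g i)) summable_on UNIV"
proof (rule abs_summable_summable, rule summable_on_comparison_test)
  show "(\<lambda>i. (cmod (f i))\<^sup>2 + (cmod (g i))\<^sup>2) summable_on UNIV"
    using assms by (rule summable_on_add)
  fix i
  have "norm (inner (f i) (g i)) \<le> cmod (f i) * cmod (g i)"
    using Cauchy_Schwarz_ineq2[of "f i" "g i"] by simp
  also have "\<dots> \<le> (cmod (f i))\<^sup>2 + (cmod (g i))\<^sup>2"
  proof -
    have "2 * (cmod (f i) * cmod (g i)) \<le> (cmod (f i))\<^sup>2 + (cmod (g i))\<^sup>2"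
      using sum_squares_bound[of "cmod (f i)" "cmod (g i)"] by (simp add: mult.assoc)
    moreover have "0 \<le> cmod (f i) * cmod (g i)"
      by simp
    ultimately show ?thesis
      by linarith
  qed
  finally show "norm (inner (f i) (g i)) \<le> (cmod (f i))\<^sup>2 + (cmod (g i))\<^sup>2" .
qed auto

lemma ell2_summable_add:
  assumes "(\<lambda>i. (cmod (f i))\<^sup>2) summable_on UNIV" "(\<lambda>i. (cmod (g i))\<^sup>2) summable_on UNIV"
  shows "(\<lambda>i. (cmod (f i + g i))\<^sup>2) summable_on UNIV"
proof (rule summable_on_comparison_test)
  show "(\<lambda>i. 2 * (cmod (f i))\<^sup>2 + 2 * (cmod (g i))\<^sup>2) summable_on UNIV"
    using assms by (intro summable_on_add summable_on_cmult_right)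
  fix i
  have "(cmod (f i + g i))\<^sup>2 \<le> (cmod (f i) + cmod (g i))\<^sup>2"
    by (simp add: norm_triangle_ineq power_mono)
  also have "\<dots> \<le> 2 * (cmod (f i))\<^sup>2 + 2 * (cmod (g i))\<^sup>2"
    using sum_squares_bound[of "cmod (f i)" "cmod (g i)"] by (simp add: power2_sum)
  finally show "(cmod (f i + g i))\<^sup>2 \<le> 2 * (cmod (f i))\<^sup>2 + 2 * (cmod (g i))\<^sup>2" .
qed auto

lemma ell2_summable_mult:
  "(\<lambda>i. (cmod (f i))\<^sup>2) summable_on UNIV \<Longrightarrow> (\<lambda>i. (cmod (c * f i))\<^sup>2) summable_on UNIV"
  by (simp add: norm_mult power_mult_distrib summable_on_cmult_right)

instantiation ell2 :: (type) real_inner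
begin

lift_definition zero_ell2 :: "'a ell2" is "\<lambda>_. 0"
  by simp

lift_definition plus_ell2 :: "'a ell2 \<Rightarrow> 'a ell2 \<Rightarrow> 'a ell2" is "\<lambda>f g i. f i + g i"
  by (rule ell2_summable_add)

lift_definition uminus_ell2 :: "'a ell2 \<Rightarrow> 'a ell2" is "\<lambda>f i. - f i"
  by simp

definition minus_ell2 :: "'a ell2 \<Rightarrow> 'a ell2 \<Rightarrow> 'a ell2" where
  "minus_ell2 x y = x + - y"

lift_definition scaleR_ell2 :: "real \<Rightarrow> 'a ell2 \<Rightarrow> 'a ell2" is "\<lambda>r f i. complex_of_real r * f i"
  by (rule ell2_summable_mult)

lift_definition inner_ell2 :: "'a ell2 \<Rightarrow> 'a ell2 \<Rightarrow> real"
  is "\<lambda>f g. \<Sum>\<^sub>\<infinity>i. inner (f i) (g i)" .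

lift_definition norm_ell2 :: "'a ell2 \<Rightarrow> real" is "\<lambda>f. sqrt (\<Sum>\<^sub>\<infinity>i. (cmod (f i))\<^sup>2)" .

definition sgn_ell2 :: "'a ell2 \<Rightarrow> 'a ell2" where
  "sgn_ell2 x = scaleR (inverse (norm x)) x"

definition dist_ell2 :: "'a ell2 \<Rightarrow> 'a ell2 \<Rightarrow> real" where
  "dist_ell2 x y = norm (x - y)"

definition uniformity_ell2 :: "('a ell2 \<times> 'a ell2) filter" where
  "uniformity_ell2 = (INF e\<in>{0<..}. principal {(x, y). dist x y < e})"

definition open_ell2 :: "'a ell2 set \<Rightarrow> bool" where
  "open_ell2 U \<longleftrightarrow> (\<forall>x\<in>U. eventually (\<lambda>(x', y). x' = x \<longrightarrow> y \<in> U) uniformity)"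

instance
proof
  fix x y z :: "'a ell2" and r s :: real
  show "x + y + z = x + (y + z)"
    by transfer (simp add: add.assoc)
  show "x + y = y + x"
    by transfer (simp add: add.commute)
  show "0 + x = x"
    by transfer simp
  show "- x + x = 0"
    by transfer simp
  show "x - y = x + - y"
    by (rule minus_ell2_def)
  show "r *\<^sub>R (x + y) = r *\<^sub>R x + r *\<^sub>R y"
    by transfer (simp add: algebra_simps)
  show "(r + s) *\<^sub>R x = r *\<^sub>R x + s *\<^sub>R x"
    by transfer (simp add: algebra_simps)
  show "r *\<^sub>R s *\<^sub>R x = (r * s) *\<^sub>R x"
    by transfer (simp add: algebra_simps)
  show "1 *\<^sub>R x = x"
    by transfer simp
  show "sgn x = scaleR (inverse (norm x)) x"
    by (rule sgn_ell2_def)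
  show "dist x y = norm (x - y)"
    by (rule dist_ell2_def)
  show "(uniformity :: ('a ell2 \<times> 'a ell2) filter) = (INF e\<in>{0<..}. principal {(x, y). dist x y < e})"
    by (rule uniformity_ell2_def)
  show "open U \<longleftrightarrow> (\<forall>x\<in>U. eventually (\<lambda>(x', y). x' = x \<longrightarrow> y \<in> U) uniformity)"
    for U :: "'a ell2 set"
    by (rule open_ell2_def)
  show "inner x y = inner y x"
    by transfer (simp add: inner_commute)
  show "inner (x + y) z = inner x z + inner y z"
    by transfer (simp add: inner_add_left infsum_add ell2_inner_summable)
  show "inner (r *\<^sub>R x) y = r * inner x y"
    by transfer (simp flip: scaleR_conv_of_real add: infsum_cmult_right')
  show "0 \<le> inner x x"
    by transfer (simp add: infsum_nonneg)
  show "inner x x = 0 \<longleftrightarrow> x = 0"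
  proof
    assume "inner x x = 0"
    then show "x = 0"
    proof transfer
      fix f :: "'a \<Rightarrow> complex"
      assume f: "(\<lambda>i. (cmod (f i))\<^sup>2) summable_on UNIV" "(\<Sum>\<^sub>\<infinity>i. inner (f i) (f i)) = 0"
      have "inner (f i) (f i) = 0" for i
        by (rule nonneg_infsum_le_0D[where A = UNIV])
           (use f in \<open>auto intro: ell2_inner_summable\<close>)
      then show "f = (\<lambda>_. 0)"
        by auto
    qed
  qed (transfer, simp)
  show "norm x = sqrt (inner x x)"
    by transfer (simp add: dot_square_norm)
qed

end

lift_definition scaleC :: "complex \<Rightarrow> 'i ell2 \<Rightarrow> 'i ell2" (infixr \<open>*\<^sub>C\<close> 75) is "\<lambda>c f i. c * f i"
  by (rule ell2_summable_mult)

lemma scaleC_add_right: "c *\<^sub>C (x + y) = c *\<^sub>C x + c *\<^sub>C y"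
  by transfer (simp add: algebra_simps)

lemma scaleC_add_left: "(c + d) *\<^sub>C x = c *\<^sub>C x + d *\<^sub>C x"
  by transfer (simp add: algebra_simps)

lemma scaleC_scaleC: "c *\<^sub>C d *\<^sub>C x = (c * d) *\<^sub>C x"
  by transfer (simp add: algebra_simps)

lemma scaleC_one: "1 *\<^sub>C x = x"
  by transfer simp

lemma scaleC_scaleR: "c *\<^sub>C r *\<^sub>R x = r *\<^sub>R c *\<^sub>C x"
  by transfer (simp add: algebra_simps)

lemma norm_scaleC: "norm (c *\<^sub>C x) = cmod c * norm x"
  by transfer (simp add: norm_mult power_mult_distrib infsum_cmult_right' real_sqrt_mult)


section \<open>Operators\<close>

text \<open>The library type of bounded operators is real-linear; complex linearity is a predicate.
  The real and the complex operator norm of a complex-linear operator coincide.\<close>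

type_synonym 'i ell2_op = "'i ell2 \<Rightarrow>\<^sub>L 'i ell2"

definition complex_linear_op :: "'i ell2_op \<Rightarrow> bool" where
  "complex_linear_op T \<longleftrightarrow>
     (\<forall>c x. blinfun_apply T (c *\<^sub>C x) = c *\<^sub>C blinfun_apply T x)"

definition scaleC_op :: "complex \<Rightarrow> 'i ell2_op \<Rightarrow> 'i ell2_op" where
  "scaleC_op c T = Blinfun (\<lambda>x. c *\<^sub>C blinfun_apply T x)"

lemma bounded_linear_scaleC: "bounded_linear (\<lambda>x. c *\<^sub>C x)"
  by (rule bounded_linear_intro[where K = "cmod c"])
     (simp_all add: scaleC_add_right scaleC_scaleR norm_scaleC mult.commute)

lemma scaleC_op_apply [simp]: "blinfun_apply (scaleC_op c T) x = c *\<^sub>C blinfun_apply T x"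
  unfolding scaleC_op_def
  by (subst bounded_linear_Blinfun_apply)
     (rule bounded_linear_compose[OF bounded_linear_scaleC blinfun.bounded_linear_right], rule refl)

global_interpretation cop: vector_space "scaleC_op :: complex \<Rightarrow> 'i ell2_op \<Rightarrow> 'i ell2_op"
proof
  fix c d :: complex and S T :: "'i ell2_op"
  show "scaleC_op c (S + T) = scaleC_op c S + scaleC_op c T"
    by (rule blinfun_eqI) (simp add: scaleC_add_right blinfun.add_left)
  show "scaleC_op (c + d) T = scaleC_op c T + scaleC_op d T"
    by (rule blinfun_eqI) (simp add: scaleC_add_left blinfun.add_left)
  show "scaleC_op c (scaleC_op d T) = scaleC_op (c * d) T"
    by (rule blinfun_eqI) (simp add: scaleC_scaleC blinfun.add_left)
  show "scaleC_op 1 T = T"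
    by (rule blinfun_eqI) (simp add: scaleC_one blinfun.add_left)
qed

definition compact_op :: "'i ell2_op \<Rightarrow> bool" where
  "compact_op T \<longleftrightarrow>
     complex_linear_op T \<and> compact (closure (blinfun_apply T ` cball 0 1))"

lemma ell2_summable_translate:
  fixes f :: "'g::group_add \<Rightarrow> complex"
  assumes "(\<lambda>i. (cmod (f i))\<^sup>2) summable_on UNIV"
  shows "(\<lambda>i. (cmod (f (- g + i)))\<^sup>2) summable_on UNIV"
  using assms summable_on_reindex_bij_betw[OF bij_plus[of "- g"], of "\<lambda>i. (cmod (f i))\<^sup>2"]
  by simp

lift_definition translate :: "'g::group_add \<Rightarrow> 'g ell2 \<Rightarrow> 'g ell2" is "\<lambda>g f h. f (- g + h)"
  by (rule ell2_summable_translate)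

lemma norm_translate: "norm (translate g x) = norm x"
proof transfer
  fix g :: 'a and f :: "'a \<Rightarrow> complex"
  show "sqrt (\<Sum>\<^sub>\<infinity>h. (cmod (f (- g + h)))\<^sup>2) = sqrt (\<Sum>\<^sub>\<infinity>h. (cmod (f h))\<^sup>2)"
    using infsum_reindex_bij_betw[OF bij_plus[of "- g"], of "\<lambda>h. (cmod (f h))\<^sup>2"] by simp
qed

lemma bounded_linear_translate: "bounded_linear (translate g)"
proof (rule bounded_linear_intro[where K = 1])
  fix x y :: "'a ell2" and r :: real
  show "translate g (x + y) = translate g x + translate g y"
    by transfer simp
  show "translate g (r *\<^sub>R x) = r *\<^sub>R translate g x"
    by transfer simp
  show "norm (translate g x) \<le> norm x * 1"
    by (simp add: norm_translate)
qed

definition left_regular :: "'g::group_add \<Rightarrow> 'g ell2_op" where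
  "left_regular g = Blinfun (translate g)"

lemma left_regular_apply [simp]: "blinfun_apply (left_regular g) x = translate g x"
  by (simp add: left_regular_def bounded_linear_Blinfun_apply bounded_linear_translate)


section \<open>Operator spaces\<close>

text \<open>An operator space is represented by its underlying complex vector space together with the
  norms on square matrices over it; an \<open>n\<close> by \<open>n\<close> matrix is a function on indices below \<open>n\<close>
  (values at other indices are irrelevant).\<close>

record 'a opspace =
  os_carrier :: "'a set"
  os_add :: "'a \<Rightarrow> 'a \<Rightarrow> 'a"
  os_scale :: "complex \<Rightarrow> 'a \<Rightarrow> 'a"
  os_norm :: "nat \<Rightarrow> (nat \<Rightarrow> nat \<Rightarrow> 'a) \<Rightarrow> ennreal"

definition os_mats :: "'a opspace \<Rightarrow> nat \<Rightarrow> (nat \<Rightarrow> nat \<Rightarrow> 'a) set" where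
  "os_mats E n = {X. \<forall>i<n. \<forall>j<n. X i j \<in> os_carrier E}"

text \<open>The operator space structure of a space of operators on \<open>H\<close>: the norm of a matrix of
  operators is its norm as an operator on the \<open>n\<close>-fold Hilbert sum of \<open>H\<close>.\<close>

definition concrete_opspace :: "'i ell2_op set \<Rightarrow> 'i ell2_op opspace" where
  "concrete_opspace S =
     \<lparr>os_carrier = S,
      os_add = (+),
      os_scale = scaleC_op,
      os_norm = (\<lambda>n X. SUP h \<in> {h. (\<Sum>j<n. (norm (h j))\<^sup>2) \<le> 1}.
        ennreal (sqrt (\<Sum>i<n. (norm (\<Sum>j<n. blinfun_apply (X i j) (h j)))\<^sup>2)))\<rparr>"

text \<open>The operator space of complex \<open>m\<close> by \<open>m\<close> matrices, as the bounded operators on \<open>m\<close>-dimensional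
  Hilbert space.\<close>

definition matrix_opspace :: "nat \<Rightarrow> (nat \<Rightarrow> nat \<Rightarrow> complex) opspace" where
  "matrix_opspace m =
     \<lparr>os_carrier = {A. \<forall>p q. A p q \<noteq> 0 \<longrightarrow> p < m \<and> q < m},
      os_add = (\<lambda>A B p q. A p q + B p q),
      os_scale = (\<lambda>c A p q. c * A p q),
      os_norm = (\<lambda>n X. SUP h \<in> {h :: nat \<Rightarrow> nat \<Rightarrow> complex. (\<Sum>j<n. \<Sum>q<m. (cmod (h j q))\<^sup>2) \<le> 1}.
        ennreal (sqrt (\<Sum>i<n. \<Sum>p<m. (cmod (\<Sum>j<n. \<Sum>q<m. X i j p q * h j q))\<^sup>2)))\<rparr>"

definition os_linear :: "'a opspace \<Rightarrow> 'b opspace \<Rightarrow> ('a \<Rightarrow> 'b) \<Rightarrow> bool" where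
  "os_linear E F u \<longleftrightarrow>
     (\<forall>x\<in>os_carrier E. u x \<in> os_carrier F) \<and>
     (\<forall>x\<in>os_carrier E. \<forall>y\<in>os_carrier E. u (os_add E x y) = os_add F (u x) (u y)) \<and>
     (\<forall>c. \<forall>x\<in>os_carrier E. u (os_scale E c x) = os_scale F c (u x))"

definition cb_norm :: "'a opspace \<Rightarrow> 'b opspace \<Rightarrow> ('a \<Rightarrow> 'b) \<Rightarrow> ennreal" where
  "cb_norm E F u =
     (SUP n\<in>{1..}. SUP X\<in>{X \<in> os_mats E n. os_norm E n X \<le> 1}. os_norm F n (\<lambda>i j. u (X i j)))"

definition d_cb :: "'a opspace \<Rightarrow> 'b opspace \<Rightarrow> ennreal" where
  "d_cb E F =
     (INF u\<in>{u. os_linear E F u \<and> bij_betw u (os_carrier E) (os_carrier F)}.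
        cb_norm E F u * cb_norm F E (inv_into (os_carrier E) u))"

definition d_SK :: "'a opspace \<Rightarrow> ennreal" where
  "d_SK E =
     (INF F\<in>{F :: nat ell2_op set. cop.subspace F \<and> closed F \<and> (\<forall>T\<in>F. compact_op T)}.
        d_cb E (concrete_opspace F))"

text \<open>Functionals on \<open>E\<close> are extended by \<open>0\<close> outside the carrier, so that each element of the dual is
  represented by exactly one function. The norm of a matrix of functionals is the
  completely bounded norm of the matrix-valued map which it defines.\<close>

definition os_dual :: "'a opspace \<Rightarrow> ('a \<Rightarrow> complex) opspace" where
  "os_dual E =
     \<lparr>os_carrier = {\<phi>.
        (\<forall>x\<in>os_carrier E. \<forall>y\<in>os_carrier E. \<phi> (os_add E x y) = \<phi> x + \<phi> y) \<and>
        (\<forall>c. \<forall>x\<in>os_carrier E. \<phi> (os_scale E c x) = c * \<phi> x) \<and>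
        (SUP x\<in>{x \<in> os_carrier E. os_norm E 1 (\<lambda>_ _. x) \<le> 1}. ennreal (cmod (\<phi> x))) < \<infinity> \<and>
        (\<forall>x. x \<notin> os_carrier E \<longrightarrow> \<phi> x = 0)},
      os_add = (\<lambda>\<phi> \<psi> x. \<phi> x + \<psi> x),
      os_scale = (\<lambda>c \<phi> x. c * \<phi> x),
      os_norm = (\<lambda>m \<Phi>. cb_norm E (matrix_opspace m)
        (\<lambda>x p q. if p < m \<and> q < m then \<Phi> p q x else 0))\<rparr>"


section \<open>The span of the free generators in the reduced group C*-algebra\<close>

text \<open>The reduced C*-algebra is an algebra of operators on the space of square summable families on the group, so the
  matrix norms on its subspaces are the ones of \<open>concrete_opspace\<close>.\<close>

definition E_lambda :: "'n::finite itself \<Rightarrow> 'n free_group ell2_op opspace" where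
  "E_lambda _ = concrete_opspace (cop.span (range (\<lambda>i::'n. left_regular (free_gen i))))"

end

theory Submission
  imports Defs
begin

text \<open>Let \<open>u\<close> be an isomorphism from the dual onto a space of compact operators, and let \<open>T\<^sub>i\<close> be the
  image of the functional \<open>e\<^sub>i\<close> dual to \<open>\<lambda>(g\<^sub>i)\<close>. The tensor \<open>\<Sum> e\<^sub>i \<otimes> \<lambda>(g\<^sub>i)\<close> represents the identity and has
  norm one, so \<open>\<Sum> T\<^sub>i \<otimes> \<lambda>(g\<^sub>i)\<close> has norm at most \<open>C = \<parallel>u\<parallel>\<close> (in the completely bounded sense). Since the
  free group is residually finite, there are permutation matrices \<open>U\<^sub>i\<close> of size \<open>N\<close> which look like
  \<open>\<lambda>(g\<^sub>i)\<close> on large balls. As the \<open>T\<^sub>i\<close> are compact we may truncate them to \<open>k \<times> k\<close> matrices with \<open>k\<close>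
  independent of \<open>N\<close>, and high moments of \<open>\<Sum> T\<^sub>i \<otimes> U\<^sub>i\<close> show that this operator has norm at most
  \<open>C + \<epsilon>\<close> on \<open>\<complex>\<^sup>k \<otimes> ran q\<close> for a projection \<open>q\<close> of normalised trace at least \<open>1 - \<epsilon>\<close>. With \<open>X\<^sub>i = U\<^sub>i q\<close>,
  applying the inverse of \<open>u\<close> shows that the map \<open>\<lambda>(g\<^sub>i) \<mapsto> X\<^sub>i\<close> has completely bounded norm at most about
  \<open>C D\<close>, where \<open>D\<close> is that of the inverse. Evaluating it on \<open>\<Sum> \<lambda>(g\<^sub>i) \<otimes> U\<^sub>i\<close>, which has norm
  at most \<open>2 \<surd>(n - 1)\<close>, and pairing with the vector \<open>\<Sum> \<delta>\<^sub>x \<otimes> \<delta>\<^sub>x\<close> gives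
  \<open>n tr q / N \<le> 2 \<surd>(n - 1) C D\<close> up to \<open>\<epsilon>\<close>.\<close>

section \<open>Finite actions of the free group\<close>

text \<open>\<open>A\<close> and its image have the same size, hence so do their complements in
  \<open>B\<close>, and any bijection between the complements completes \<open>f\<close>.\<close>

lemma permutes_extends_partial_injection:
  assumes "finite B" "A \<subseteq> B" "inj_on f A" "f ` A \<subseteq> B"
  shows "\<exists>p. p permutes B \<and> (\<forall>x\<in>A. p x = f x)"
proof -
  have "card (B - A) = card (B - f ` A)"
    using assms finite_subset[OF assms(2,1)] by (simp add: card_Diff_subset card_image)
  then obtain g where g: "bij_betw g (B - A) (B - f ` A)"
    using finite_same_card_bij[of "B - A" "B - f ` A"] assms(1) by auto
  define p where "p x = (if x \<in> A then f x else if x \<in> B then g x else x)" for x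
  have "bij_betw p A (f ` A)"
    using inj_on_imp_bij_betw[OF assms(3)] bij_betw_cong[of A p f "f ` A"] by (simp add: p_def)
  moreover have "bij_betw p (B - A) (B - f ` A)"
    using g bij_betw_cong[of "B - A" p g "B - f ` A"] by (simp add: p_def)
  ultimately have "bij_betw p (A \<union> (B - A)) (f ` A \<union> (B - f ` A))"
    by (rule bij_betw_combine) auto
  moreover have "A \<union> (B - A) = B" "f ` A \<union> (B - f ` A) = B"
    using assms by auto
  ultimately have "bij_betw p B B" by simp
  then have "p permutes B"
    by (rule bij_imp_permutes) (use assms in \<open>auto simp: p_def\<close>)
  then show ?thesis
    by (intro exI[of _ p]) (auto simp: p_def)
qed

section \<open>The action of words determined by one bijection per generator\<close>

definition letter_act :: "('a \<Rightarrow> 'b \<Rightarrow> 'b) \<Rightarrow> 'a \<times> bool \<Rightarrow> 'b \<Rightarrow> 'b" where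
  "letter_act s l = (if snd l then s (fst l) else inv (s (fst l)))"

lemma letter_act_inv_letter:
  assumes "\<And>i. bij (s i)"
  shows "letter_act s l (letter_act s (inv_letter l) x) = x"
proof -
  have "s (fst l) (inv (s (fst l)) x) = x" "inv (s (fst l)) (s (fst l) x) = x"
    using assms[of "fst l"] by (simp_all add: bij_is_surj surj_f_inv_f bij_is_inj)
  then show ?thesis by (auto simp: letter_act_def inv_letter_def)
qed

lemma foldr_letter_act_red_cons:
  assumes "\<And>i. bij (s i)"
  shows "foldr (letter_act s) (red_cons l w) x = letter_act s l (foldr (letter_act s) w x)"
proof (cases w)
  case (Cons k v)
  then show ?thesis
    using letter_act_inv_letter[of s l] assms by (auto simp: red_cons_def)
qed (simp add: red_cons_def)

text \<open>Evaluated on the reduced word representing \<open>w\<close>; for bijections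
  \<open>s i\<close> this is the orbit map at \<open>x\<close> of the action in which the generator
  \<open>i\<close> acts by \<open>s i\<close>.\<close>

definition orbit_map :: "('a \<Rightarrow> 'b \<Rightarrow> 'b) \<Rightarrow> 'b \<Rightarrow> 'a free_group \<Rightarrow> 'b" where
  "orbit_map s x w = foldr (letter_act s) (Rep_free_group w) x"

lemma orbit_map_0 [simp]: "orbit_map s x 0 = x"
  by (simp add: orbit_map_def zero_free_group.rep_eq)

lemma Rep_free_gen_add: "Rep_free_group (free_gen i + w) = red_cons (i, True) (Rep_free_group w)"
  by (simp add: plus_free_group.rep_eq free_gen.rep_eq)

lemma Rep_uminus_free_gen_add:
  "Rep_free_group (- free_gen i + w) = red_cons (i, False) (Rep_free_group w)"
  by (simp add: plus_free_group.rep_eq free_gen.rep_eq uminus_free_group.rep_eq inv_letter_def)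

lemma orbit_map_free_gen_add:
  assumes "\<And>i. bij (s i)"
  shows "orbit_map s x (free_gen i + w) = s i (orbit_map s x w)"
  using foldr_letter_act_red_cons[of s "(i, True)" "Rep_free_group w" x] assms
  by (simp add: orbit_map_def Rep_free_gen_add letter_act_def)

section \<open>Word balls and finite quotient actions\<close>

definition word_ball :: "nat \<Rightarrow> 'a free_group set" where
  "word_ball r = {w. length (Rep_free_group w) \<le> r}"

lemma word_ball_mono: "r \<le> r' \<Longrightarrow> word_ball r \<subseteq> word_ball r'"
  by (auto simp: word_ball_def)

lemma zero_in_word_ball [simp]: "0 \<in> word_ball r"
  by (simp add: word_ball_def zero_free_group.rep_eq)

lemma length_red_cons_le: "length (red_cons l w) \<le> Suc (length w)"
  by (auto simp: red_cons_def)

lemma free_gen_add_word_ball: "w \<in> word_ball r \<Longrightarrow> free_gen i + w \<in> word_ball (Suc r)"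
  using length_red_cons_le[of "(i, True)" "Rep_free_group w"]
  by (auto simp: word_ball_def Rep_free_gen_add)

lemma uminus_free_gen_add_word_ball: "w \<in> word_ball r \<Longrightarrow> - free_gen i + w \<in> word_ball (Suc r)"
  using length_red_cons_le[of "(i, False)" "Rep_free_group w"]
  by (auto simp: word_ball_def Rep_uminus_free_gen_add)

lemma finite_reduced_words: "finite {w :: ('a::finite \<times> bool) list. reduced w \<and> length w \<le> r}"
  by (rule finite_subset[OF _ finite_lists_length_le[of "UNIV :: ('a \<times> bool) set" r]]) auto

lemma finite_word_ball [simp]: "finite (word_ball r :: 'a::finite free_group set)"
proof -
  have "Rep_free_group ` (word_ball r :: 'a free_group set) \<subseteq> {w. reduced w \<and> length w \<le> r}"
    using Rep_free_group by (auto simp: word_ball_def)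
  then show ?thesis
    by (rule finite_imageD[OF finite_subset[OF _ finite_reduced_words]])
       (auto intro!: inj_onI simp: Rep_free_group_inject)
qed

text \<open>On the ball, left multiplication by a generator is only a partial injection, because
  words of maximal length may leave it. Any extension to a permutation will do: tracing a reduced
  word from the empty word passes only through its suffixes, which all lie in the ball, so the
  arbitrary part of the extension is never visited.\<close>

lemma free_group_acts_on_words:
  "\<exists>s :: 'a::finite \<Rightarrow> ('a \<times> bool) list \<Rightarrow> ('a \<times> bool) list.
     (\<forall>i. s i permutes {w. reduced w \<and> length w \<le> r}) \<and>
     (\<forall>w\<in>word_ball r. orbit_map s [] w = Rep_free_group w)"
proof -
  define B where "B = {w :: ('a \<times> bool) list. reduced w \<and> length w \<le> r}"
  define A where "A i = {w \<in> B. red_cons (i, True) w \<in> B}" for i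
  have fin: "finite B"
    unfolding B_def by (rule finite_reduced_words)
  have inj: "inj_on (red_cons (i, True)) (A i)" for i
  proof (rule inj_on_inverseI)
    fix w assume "w \<in> A i"
    then have "reduced w" by (simp add: A_def B_def)
    then show "red_cons (i, False) (red_cons (i, True) w) = w"
      using red_cons_inv[of w "(i, False)"] by (simp add: inv_letter_def)
  qed
  have "\<exists>p. p permutes B \<and> (\<forall>w\<in>A i. p w = red_cons (i, True) w)" for i
    by (rule permutes_extends_partial_injection[OF fin _ inj]) (auto simp: A_def)
  then obtain s where s: "\<And>i. s i permutes B" "\<And>i w. w \<in> A i \<Longrightarrow> s i w = red_cons (i, True) w"
    by metis
  \<comment> \<open>For an inverse letter, the shortened or prolonged word lies in
    \<open>A i\<close> and the permutation sends it back to \<open>w\<close>, so the inverse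
    permutation takes the expected value.\<close>
  have step: "letter_act s l w = red_cons l w" if "w \<in> B" "red_cons l w \<in> B" for l w
  proof (cases l)
    case (Pair i b)
    show ?thesis
    proof (cases b)
      case True
      then show ?thesis
        using that s(2)[of w i] by (simp add: Pair letter_act_def A_def)
    next
      case False
      have "red_cons (i, True) (red_cons l w) = w"
        using red_cons_inv[of w "(i, True)"] that False by (simp add: B_def inv_letter_def Pair)
      then have "s i (red_cons l w) = w"
        using that s(2)[of "red_cons l w" i] by (simp add: A_def)
      then have "inv (s i) w = red_cons l w"
        using permutes_inverses(2)[OF s(1)] by metis
      then show ?thesis using False by (simp add: Pair letter_act_def)
    qed
  qed
  have "foldr (letter_act s) w [] = w" if "w \<in> B" for w
    using that
  proof (induction w)
    case (Cons l w)
    then have "w \<in> B" "red_cons l w = l # w"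
      by (auto simp: B_def reduced_Cons red_cons_def)
    then show ?case
      using Cons step[of w l] by simp
  qed simp
  moreover have "Rep_free_group w \<in> B" if "w \<in> word_ball r" for w
    using that Rep_free_group[of w] by (simp add: B_def word_ball_def)
  ultimately show ?thesis
    using s(1) by (auto simp: orbit_map_def B_def)
qed

text \<open>Letting the free group act by left multiplication on the whole symmetric group of the ball makes
  all orbit maps injective on the ball, not only the one based at the empty word.\<close>

lemma free_group_finite_action:
  "\<exists>(N::nat) (s :: 'a::finite \<Rightarrow> nat \<Rightarrow> nat). N > 0 \<and> (\<forall>i. s i permutes {..<N}) \<and>
     (\<forall>x<N. inj_on (orbit_map s x) (word_ball r) \<and> range (orbit_map s x) \<subseteq> {..<N})"
proof -
  define B where "B = {w :: ('a \<times> bool) list. reduced w \<and> length w \<le> r}"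
  obtain p :: "'a \<Rightarrow> ('a \<times> bool) list \<Rightarrow> ('a \<times> bool) list"
    where p_all: "(\<forall>i. p i permutes B) \<and> (\<forall>w\<in>word_ball r. orbit_map p [] w = Rep_free_group w)"
    using free_group_acts_on_words[of r, where ?'a = 'a] unfolding B_def by (rule exE)
  have p: "\<And>i. p i permutes B" "\<And>w. w \<in> word_ball r \<Longrightarrow> orbit_map p [] w = Rep_free_group w"
    using p_all by simp_all
  \<comment> \<open>Points of the new action are all permutations of the ball, numbered by
    \<open>e\<close>; a generator acts by composing with \<open>p i\<close> on the left.\<close>
  define G where "G = {\<sigma>. \<sigma> permutes B}"
  have fin: "finite G"
    unfolding G_def B_def by (intro finite_permutations finite_reduced_words)
  define N where "N = card G"
  obtain e where e: "bij_betw e {..<N} G"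
    using ex_bij_betw_nat_finite[OF fin] by (auto simp: N_def atLeast0LessThan)
  define d where "d = inv_into {..<N} e"
  have e_G: "e x \<in> G" if "x < N" for x
    using e that by (auto simp: bij_betw_def)
  have d_lt: "d \<sigma> < N" and ed: "e (d \<sigma>) = \<sigma>" if "\<sigma> \<in> G" for \<sigma>
    using bij_betw_inv_into_right[OF e that] bij_betwE[OF bij_betw_inv_into[OF e]] that
    by (simp_all add: d_def)
  have de: "d (e x) = x" if "x < N" for x
    using bij_betw_inv_into_left[OF e, of x] that by (simp add: d_def)
  have "id \<in> G" by (simp add: G_def permutes_id)
  then have N: "N > 0" using fin by (auto simp: N_def card_gt_0_iff)
  define s where "s i x = (if x < N then d (p i \<circ> e x) else x)" for i x
  have pe: "p i \<circ> \<sigma> \<in> G" if "\<sigma> \<in> G" for i \<sigma>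
    using that permutes_compose[of \<sigma> B "p i"] p(1)[of i] by (simp add: G_def)
  have s_lt: "s i x < N" if "x < N" for i x
    using that by (simp add: s_def d_lt pe e_G)
  have es: "e (s i x) = p i \<circ> e x" if "x < N" for i x
    using that by (simp add: s_def ed pe e_G)
  have s: "s i permutes {..<N}" for i
  proof (rule bij_imp_permutes)
    have "inj_on (s i) {..<N}"
    proof (rule inj_onI)
      fix x y assume xy: "x \<in> {..<N}" "y \<in> {..<N}" "s i x = s i y"
      then have "p i \<circ> e x = p i \<circ> e y" using es[of x i] es[of y i] by simp
      then have "e x = e y"
        using permutes_inj[OF p(1)[of i]] by (simp add: fun_eq_iff inj_eq)
      then have "d (e x) = d (e y)" by simp
      then show "x = y" using xy by (simp add: de)
    qed
    moreover have "s i ` {..<N} \<subseteq> {..<N}" using s_lt by auto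
    ultimately show "bij_betw (s i) {..<N} {..<N}"
      by (simp add: bij_betw_def endo_inj_surj)
  qed (simp add: s_def)
  have sinv: "inv (s i) x < N" if "x < N" for i x
    using permutes_in_image[OF permutes_inv[OF s[of i]], of x] that by simp
  have act: "letter_act s l x < N" "e (letter_act s l x) = letter_act p l \<circ> e x" if x: "x < N" for l x
  proof -
    show *: "letter_act s l x < N"
      using that by (auto simp: letter_act_def s_lt sinv)
    show "e (letter_act s l x) = letter_act p l \<circ> e x"
    proof (cases "snd l")
      case False
      define y where "y = inv (s (fst l)) x"
      have y: "y < N" "s (fst l) y = x"
        using sinv[OF x] permutes_inverses(1)[OF s] by (simp_all add: y_def)
      have "inv (p (fst l)) \<circ> e x = e y"
        using es[OF y(1), of "fst l"] y(2) permutes_inverses(2)[OF p(1)] by (auto simp: fun_eq_iff)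
      then show ?thesis using False by (simp add: letter_act_def y_def)
    qed (simp add: letter_act_def es x)
  qed
  have words: "foldr (letter_act s) w x < N \<and>
      e (foldr (letter_act s) w x) = foldr (letter_act p) w \<circ> e x" if "x < N" for w x
    using that by (induction w) (auto simp: act fun_eq_iff)
  have "inj_on (orbit_map s x) (word_ball r)" if x: "x < N" for x
  proof (rule inj_onI)
    fix v w assume vw: "v \<in> word_ball r" "w \<in> word_ball r" "orbit_map s x v = orbit_map s x w"
    \<comment> \<open>Evaluating the permutations along the orbit of \<open>x\<close> at the point
      that \<open>e x\<close> sends to the empty word recovers the orbit of the empty word, on which
      words are distinguished.\<close>
    define z where "z = inv (e x) []"
    have z: "e x z = []"
      using e_G[OF x] permutes_inverses(1)[of "e x" B] by (simp add: G_def z_def)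
    have "orbit_map p [] w' = e (orbit_map s x w') z" for w'
      using words[OF x, of "Rep_free_group w'"] z by (simp add: orbit_map_def)
    then have "orbit_map p [] v = orbit_map p [] w"
      by (simp add: vw(3))
    then show "v = w"
      using p(2) vw by (simp add: Rep_free_group_inject)
  qed
  moreover have "range (orbit_map s x) \<subseteq> {..<N}" if "x < N" for x
    using words[OF that] by (auto simp: orbit_map_def)
  ultimately show ?thesis
    using N s by (intro exI[of _ N] exI[of _ s]) simp
qed

section \<open>Matrices indexed by finite sets\<close>

definition ip :: "'s set \<Rightarrow> ('s \<Rightarrow> complex) \<Rightarrow> ('s \<Rightarrow> complex) \<Rightarrow> complex" where
  "ip S f g = (\<Sum>s\<in>S. cnj (f s) * g s)"

definition nsq :: "'s set \<Rightarrow> ('s \<Rightarrow> complex) \<Rightarrow> real" where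
  "nsq S f = (\<Sum>s\<in>S. (cmod (f s))\<^sup>2)"

text \<open>Matrices and vectors are total functions and the index set is an argument, so one matrix
  can be applied on a set and on its subsets; applying it on a subset is a compression. Vectors are
  compared only on the relevant index set.\<close>

definition mulv :: "'t set \<Rightarrow> ('s \<Rightarrow> 't \<Rightarrow> complex) \<Rightarrow> ('t \<Rightarrow> complex) \<Rightarrow> 's \<Rightarrow> complex" where
  "mulv T M h s = (\<Sum>t\<in>T. M s t * h t)"

definition adj :: "('s \<Rightarrow> 't \<Rightarrow> complex) \<Rightarrow> 't \<Rightarrow> 's \<Rightarrow> complex" where
  "adj M t s = cnj (M s t)"

lemma nsq_nonneg [simp]: "nsq S f \<ge> 0"
  by (simp add: nsq_def sum_nonneg)

lemma ip_self: "ip S f f = of_real (nsq S f)"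
  by (simp add: ip_def nsq_def complex_norm_square mult.commute del: of_real_power)

lemma nsq_cong: "(\<And>s. s \<in> S \<Longrightarrow> f s = g s) \<Longrightarrow> nsq S f = nsq S g"
  by (simp add: nsq_def)

lemma ip_cong: "(\<And>s. s \<in> S \<Longrightarrow> f s = f' s) \<Longrightarrow> (\<And>s. s \<in> S \<Longrightarrow> g s = g' s) \<Longrightarrow> ip S f g = ip S f' g'"
  by (simp add: ip_def)

lemma cnj_ip: "cnj (ip S f g) = ip S g f"
  by (simp add: ip_def mult.commute)

lemma nsq_scale: "nsq S (\<lambda>s. c * f s) = (cmod c)\<^sup>2 * nsq S f"
  by (simp add: nsq_def norm_mult power_mult_distrib sum_distrib_left)

lemma ip_Cauchy_Schwarz: "(cmod (ip S f g))\<^sup>2 \<le> nsq S f * nsq S g"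
proof -
  have "cmod (ip S f g) \<le> (\<Sum>s\<in>S. cmod (f s) * cmod (g s))"
    unfolding ip_def by (rule order_trans[OF norm_sum]) (simp add: norm_mult)
  also have "\<dots> \<le> L2_set (\<lambda>s. cmod (f s)) S * L2_set (\<lambda>s. cmod (g s)) S"
    using L2_set_mult_ineq[of "\<lambda>s. cmod (f s)" "\<lambda>s. cmod (g s)" S] by simp
  finally have "(cmod (ip S f g))\<^sup>2 \<le> (L2_set (\<lambda>s. cmod (f s)) S * L2_set (\<lambda>s. cmod (g s)) S)\<^sup>2"
    by (rule power_mono) simp
  then show ?thesis
    by (simp add: nsq_def L2_set_def power_mult_distrib sum_nonneg)
qed

lemma ip_mulv: "ip S f (mulv T M h) = ip T (mulv S (adj M) f) h"
  unfolding ip_def mulv_def adj_def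
  by (simp add: sum_distrib_left sum_distrib_right, subst sum.swap)
     (simp add: mult_ac)

lemma adj_adj [simp]: "adj (adj M) = M"
  by (simp add: adj_def fun_eq_iff)

text \<open>With g = M*f, the norm of g squared is the inner product of f and Mg. Cauchy-Schwarz and
  the bound on M then leave a factor \<open>nsq T g\<close> to cancel.\<close>

lemma nsq_mulv_adj_le:
  assumes "\<And>h. nsq S (mulv T M h) \<le> K * nsq T h" "K \<ge> 0"
  shows "nsq T (mulv S (adj M) f) \<le> K * nsq S f"
proof -
  let ?g = "mulv S (adj M) f"
  have "(nsq T ?g)\<^sup>2 = (cmod (ip S f (mulv T M ?g)))\<^sup>2"
    by (simp add: ip_mulv ip_self)
  also have "\<dots> \<le> nsq S f * nsq S (mulv T M ?g)"
    by (rule ip_Cauchy_Schwarz)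
  also have "\<dots> \<le> nsq S f * (K * nsq T ?g)"
    by (intro mult_left_mono assms) simp
  finally have le: "nsq T ?g * nsq T ?g \<le> K * nsq S f * nsq T ?g"
    by (simp add: power2_eq_square mult_ac)
  show ?thesis
  proof (cases "nsq T ?g = 0")
    case True
    then show ?thesis using assms(2) by simp
  next
    case False
    then have "nsq T ?g > 0" using nsq_nonneg[of T ?g] by linarith
    then show ?thesis using le by simp
  qed
qed

lemma Bessel_inequality:
  assumes "finite J" "\<And>i j. i \<in> J \<Longrightarrow> j \<in> J \<Longrightarrow> ip S (h i) (h j) = of_bool (i = j)"
  shows "(\<Sum>j\<in>J. (cmod (ip S (h j) g))\<^sup>2) \<le> nsq S g"
proof -
  define c where "c j = ip S (h j) g" for j
  define p where "p s = (\<Sum>j\<in>J. c j * h j s)" for s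
  have ip_p: "ip S f p = (\<Sum>j\<in>J. c j * ip S f (h j))" for f
    unfolding ip_def p_def sum_distrib_left
    by (subst sum.swap) (simp add: mult_ac)
  have "ip S (h i) p = c i" if "i \<in> J" for i
  proof -
    have "ip S (h i) p = (\<Sum>j\<in>J. if i = j then c j else 0)"
      unfolding ip_p by (rule sum.cong) (use that assms(2) in auto)
    then show ?thesis using that assms(1) by simp
  qed
  then have hp: "ip S p (h i) = cnj (c i)" if "i \<in> J" for i
    using that by (metis cnj_ip)
  have pp: "ip S p p = of_real (\<Sum>j\<in>J. (cmod (c j))\<^sup>2)"
    by (simp add: ip_p hp complex_norm_square mult.commute del: of_real_power)
  have gp: "ip S g p = of_real (\<Sum>j\<in>J. (cmod (c j))\<^sup>2)"
    by (simp add: ip_p c_def cnj_ip[symmetric, of S g] complex_norm_square mult.commute del: of_real_power)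
  have "ip S p g = of_real (\<Sum>j\<in>J. (cmod (c j))\<^sup>2)"
    using cnj_ip[of S g p] gp by simp
  moreover have "ip S (\<lambda>s. g s - p s) (\<lambda>s. g s - p s) = ip S g g - ip S g p - ip S p g + ip S p p"
    by (simp add: ip_def algebra_simps sum.distrib sum_subtractf)
  ultimately have "of_real (nsq S (\<lambda>s. g s - p s)) = (of_real (nsq S g - (\<Sum>j\<in>J. (cmod (c j))\<^sup>2)) :: complex)"
    using gp pp by (simp add: ip_self)
  then have "nsq S (\<lambda>s. g s - p s) = nsq S g - (\<Sum>j\<in>J. (cmod (c j))\<^sup>2)"
    by (simp only: of_real_eq_iff)
  then show ?thesis
    using nsq_nonneg[of S "\<lambda>s. g s - p s"] unfolding c_def by linarith
qed

section \<open>Powers of M*M: moments and finite propagation\<close>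

definition gram :: "'s set \<Rightarrow> ('s \<Rightarrow> 's \<Rightarrow> complex) \<Rightarrow> ('s \<Rightarrow> complex) \<Rightarrow> 's \<Rightarrow> complex" where
  "gram S M h = mulv S (adj M) (mulv S M h)"

lemma ip_gram: "ip S f (gram S M g) = ip S (gram S M f) g"
  by (simp add: gram_def ip_mulv cnj_ip[symmetric, of S "mulv S M f"]
      ip_mulv[where M = "adj M", symmetric])

lemma ip_gram_power: "ip S f ((gram S M ^^ m) g) = ip S ((gram S M ^^ m) f) g"
  by (induction m arbitrary: f g) (simp_all add: ip_gram funpow_swap1)

text \<open>Self-adjointness and Cauchy-Schwarz give one doubling of the exponent at a time.
  Restricting to powers of two thus replaces an appeal to the spectral theorem.\<close>

lemma gram_power_lower_bound:
  assumes "nsq S h = 1"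
  shows "nsq S (mulv S M h) ^ (2 * 2 ^ j) \<le> nsq S ((gram S M ^^ (2 ^ j)) h)"
proof (induction j)
  case 0
  have "(cmod (ip S h (gram S M h)))\<^sup>2 \<le> nsq S h * nsq S (gram S M h)"
    by (rule ip_Cauchy_Schwarz)
  moreover have "ip S h (gram S M h) = of_real (nsq S (mulv S M h))"
    unfolding gram_def by (simp add: ip_mulv ip_self)
  ultimately show ?case using assms by simp
next
  case (Suc j)
  let ?G = "gram S M ^^ (2 ^ j)"
  have "(nsq S (?G h))\<^sup>2 = (cmod (ip S h (?G (?G h))))\<^sup>2"
    by (simp add: ip_gram_power ip_self)
  also have "\<dots> \<le> nsq S h * nsq S (?G (?G h))"
    by (rule ip_Cauchy_Schwarz)
  also have "?G (?G h) = (gram S M ^^ (2 ^ Suc j)) h"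
    by (simp add: mult_2 funpow_add)
  finally have "(nsq S (?G h))\<^sup>2 \<le> nsq S ((gram S M ^^ (2 ^ Suc j)) h)"
    using assms by simp
  moreover have "(nsq S (mulv S M h) ^ (2 * 2 ^ j))\<^sup>2 \<le> (nsq S (?G h))\<^sup>2"
    by (rule power_mono[OF Suc]) simp
  ultimately show ?case
    by (simp add: power_mult[symmetric] mult_ac)
qed

text \<open>The right hand side bounds the trace of \<open>gram S M ^^ (2 * m)\<close>, each vector of the family contributes
  at least \<open>c ^ (2 * m)\<close> to it.\<close>

lemma card_orthonormal_large_image:
  assumes "finite S" "finite J" "c \<ge> 0" "m = 2 ^ l"
    and orth: "\<And>i j. i \<in> J \<Longrightarrow> j \<in> J \<Longrightarrow> ip S (h i) (h j) = of_bool (i = j)"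
    and large: "\<And>j. j \<in> J \<Longrightarrow> nsq S (mulv S M (h j)) \<ge> c"
    and K: "\<And>s. s \<in> S \<Longrightarrow> nsq S ((gram S M ^^ m) (\<lambda>t. of_bool (t = s))) \<le> K"
  shows "real (card J) * c ^ (2 * m) \<le> real (card S) * K"
proof -
  let ?e = "\<lambda>s t. of_bool (t = s) :: complex"
  let ?G = "gram S M ^^ m"
  have coord: "f s = ip S (?e s) f" if "s \<in> S" for f s
    using that assms(1) by (simp add: ip_def of_bool_def if_distrib if_distribR sum.delta cong: if_cong)
  have "real (card J) * c ^ (2 * m) = (\<Sum>j\<in>J. c ^ (2 * m))" by simp
  also have "\<dots> \<le> (\<Sum>j\<in>J. nsq S (?G (h j)))"
  proof (rule sum_mono)
    fix j assume j: "j \<in> J"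
    have "of_real (nsq S (h j)) = (1::complex)"
      using orth[OF j j] by (simp add: ip_self)
    then have "nsq S (h j) = 1" by (simp only: of_real_eq_1_iff)
    then have "nsq S (mulv S M (h j)) ^ (2 * m) \<le> nsq S (?G (h j))"
      unfolding assms(4) by (rule gram_power_lower_bound)
    moreover have "c ^ (2 * m) \<le> nsq S (mulv S M (h j)) ^ (2 * m)"
      by (rule power_mono[OF large[OF j] assms(3)])
    ultimately show "c ^ (2 * m) \<le> nsq S (?G (h j))" by linarith
  qed
  \<comment> \<open>Self-adjointness moves the power onto the coordinate vectors, so that after
    exchanging the sums Bessel's inequality can be used for each of them.\<close>
  also have "\<dots> = (\<Sum>j\<in>J. \<Sum>s\<in>S. (cmod (ip S (h j) (?G (?e s))))\<^sup>2)"
  proof (intro sum.cong refl)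
    fix j
    have "cmod (?G (h j) s) = cmod (ip S (h j) (?G (?e s)))" if "s \<in> S" for s
      using coord[OF that, of "?G (h j)"]
      by (metis cnj_ip complex_mod_cnj ip_gram_power)
    then show "nsq S (?G (h j)) = (\<Sum>s\<in>S. (cmod (ip S (h j) (?G (?e s))))\<^sup>2)"
      by (simp add: nsq_def)
  qed
  also have "\<dots> = (\<Sum>s\<in>S. \<Sum>j\<in>J. (cmod (ip S (h j) (?G (?e s))))\<^sup>2)"
    by (rule sum.swap)
  also have "\<dots> \<le> (\<Sum>s\<in>S. K)"
    by (intro sum_mono order_trans[OF Bessel_inequality K] assms orth)
  finally show ?thesis by simp
qed

text \<open>Finite propagation: each application of M or its adjoint enlarges the support by one
  layer. As long as 2m layers stay inside \<open>Sr R\<close>, the iteration sees only the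
  compression of M to \<open>Sr R\<close>, and each of its 2m factors contributes at most K to the
  squared norm.\<close>

lemma gram_power_local_bound:
  fixes Sr :: "nat \<Rightarrow> 's set"
  assumes "finite S" and sub: "Sr R \<subseteq> S" and mono: "\<And>r. Sr r \<subseteq> Sr (Suc r)"
    and forw: "\<And>r s t. t \<in> Sr r \<Longrightarrow> s \<in> S \<Longrightarrow> M s t \<noteq> 0 \<Longrightarrow> s \<in> Sr (Suc r)"
    and backw: "\<And>r s t. s \<in> Sr r \<Longrightarrow> t \<in> S \<Longrightarrow> M s t \<noteq> 0 \<Longrightarrow> t \<in> Sr (Suc r)"
    and bound: "\<And>h. nsq (Sr R) (mulv (Sr R) M h) \<le> K * nsq (Sr R) h"
    and e: "nsq S e = 1" "\<And>s. s \<in> S \<Longrightarrow> s \<notin> Sr 0 \<Longrightarrow> e s = 0" and K: "K \<ge> 0"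
  shows "2 * m \<le> R \<Longrightarrow> (\<forall>s\<in>S. s \<notin> Sr (2 * m) \<longrightarrow> (gram S M ^^ m) e s = 0) \<and>
           nsq S ((gram S M ^^ m) e) \<le> K ^ (2 * m)"
proof -
  have Srmono: "Sr r \<subseteq> Sr r'" if "r \<le> r'" for r r'
    using mono that by (rule lift_Suc_mono_le)
  \<comment> \<open>Stated for a general matrix \<open>A\<close> so that it serves for both M and
    its adjoint.\<close>
  have step: "(\<forall>s\<in>S. s \<notin> Sr (Suc r) \<longrightarrow> mulv S A f s = 0) \<and> nsq S (mulv S A f) \<le> K * nsq S f"
    if r: "r < R" and f: "\<And>s. s \<in> S \<Longrightarrow> s \<notin> Sr r \<Longrightarrow> f s = 0"
      and A: "\<And>s t. t \<in> Sr r \<Longrightarrow> s \<in> S \<Longrightarrow> A s t \<noteq> 0 \<Longrightarrow> s \<in> Sr (Suc r)"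
      and bd: "\<And>h. nsq (Sr R) (mulv (Sr R) A h) \<le> K * nsq (Sr R) h" for A f r
  proof
    have R: "Sr r \<subseteq> Sr R" "Sr (Suc r) \<subseteq> Sr R"
      using r by (auto intro!: Srmono)
    show *: "\<forall>s\<in>S. s \<notin> Sr (Suc r) \<longrightarrow> mulv S A f s = 0"
    proof (intro ballI impI)
      fix s assume s: "s \<in> S" "s \<notin> Sr (Suc r)"
      show "mulv S A f s = 0"
        unfolding mulv_def
      proof (rule sum.neutral, rule ballI)
        fix t assume "t \<in> S"
        then show "A s t * f t = 0"
          using s A[of t s] f[of t] by (cases "t \<in> Sr r") auto
      qed
    qed
    have "nsq S (mulv S A f) = nsq (Sr R) (mulv S A f)"
      unfolding nsq_def by (rule sum.mono_neutral_right) (use assms(1) sub * R in auto)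
    also have "\<dots> = nsq (Sr R) (mulv (Sr R) A f)"
      unfolding mulv_def
      by (intro nsq_cong sum.mono_neutral_right) (use assms(1) sub f R in auto)
    also have "\<dots> \<le> K * nsq (Sr R) f" by (rule bd)
    also have "\<dots> \<le> K * nsq S f"
      using K unfolding nsq_def by (intro mult_left_mono sum_mono2) (use assms(1) sub in auto)
    finally show "nsq S (mulv S A f) \<le> K * nsq S f" .
  qed
  show ?thesis if "2 * m \<le> R"
    using that
  proof (induction m)
    case 0
    then show ?case using e by auto
  next
    case (Suc m)
    let ?f = "(gram S M ^^ m) e"
    have IH: "\<forall>s\<in>S. s \<notin> Sr (2 * m) \<longrightarrow> ?f s = 0" "nsq S ?f \<le> K ^ (2 * m)"
      using Suc by auto
    have 1: "(\<forall>s\<in>S. s \<notin> Sr (Suc (2 * m)) \<longrightarrow> mulv S M ?f s = 0) \<and> nsq S (mulv S M ?f) \<le> K * nsq S ?f"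
      by (rule step) (use Suc.prems IH forw bound in auto)
    have 2: "(\<forall>s\<in>S. s \<notin> Sr (Suc (Suc (2 * m))) \<longrightarrow> mulv S (adj M) (mulv S M ?f) s = 0) \<and>
        nsq S (mulv S (adj M) (mulv S M ?f)) \<le> K * nsq S (mulv S M ?f)"
    proof (rule step)
      show "nsq (Sr R) (mulv (Sr R) (adj M) h) \<le> K * nsq (Sr R) h" for h
        by (rule nsq_mulv_adj_le[OF bound K])
    qed (use Suc.prems 1 backw in \<open>auto simp: adj_def\<close>)
    have "nsq S (gram S M ?f) \<le> K * (K * K ^ (2 * m))"
      using 2 1 IH(2) K unfolding gram_def
      by (meson mult_left_mono order_trans)
    then show ?case
      using 2 by (simp add: gram_def[of S M ?f])
  qed
qed

section \<open>Orthogonal projections of large trace\<close>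

definition is_proj :: "'x set \<Rightarrow> ('x \<Rightarrow> 'x \<Rightarrow> complex) \<Rightarrow> bool" where
  "is_proj X q \<longleftrightarrow> (\<forall>x\<in>X. \<forall>y\<in>X. cnj (q x y) = q y x) \<and>
     (\<forall>x\<in>X. \<forall>y\<in>X. (\<Sum>z\<in>X. q x z * q z y) = q x y)"

lemma is_proj_id: "finite X \<Longrightarrow> is_proj X (\<lambda>x y. of_bool (x = y))"
proof -
  assume fin: "finite X"
  have "(\<Sum>z\<in>X. of_bool (x = z) * of_bool (z = y)) = (of_bool (x = y) :: complex)"
    if "x \<in> X" for x y
  proof -
    have "(\<Sum>z\<in>X. of_bool (x = z) * of_bool (z = y)) = (\<Sum>z\<in>X. if x = z then of_bool (x = y) else 0 :: complex)"
      by (rule sum.cong) auto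
    then show ?thesis using that fin by simp
  qed
  then show ?thesis by (auto simp: is_proj_def)
qed

lemma ip_proj:
  assumes "is_proj X q"
  shows "ip X (mulv X q f) g = ip X f (mulv X q g)"
proof -
  have "ip X (mulv X (adj q) f) g = ip X f (mulv X q g)"
    by (simp add: ip_mulv)
  moreover have "mulv X (adj q) f x = mulv X q f x" if "x \<in> X" for x
    using that assms by (auto simp: is_proj_def mulv_def adj_def intro!: sum.cong)
  ultimately show ?thesis
    using ip_cong[of X "mulv X (adj q) f" "mulv X q f" g g] by simp
qed

lemma mulv_proj_idem:
  assumes "is_proj X q" "x \<in> X"
  shows "mulv X q (mulv X q f) x = mulv X q f x"
proof -
  have "mulv X q (mulv X q f) x = (\<Sum>y\<in>X. (\<Sum>z\<in>X. q x z * q z y) * f y)"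
    unfolding mulv_def sum_distrib_left sum_distrib_right
    by (subst sum.swap) (simp add: mult_ac)
  then show ?thesis
    using assms by (simp add: is_proj_def mulv_def)
qed

lemma nsq_proj_le:
  assumes "is_proj X q"
  shows "nsq X (mulv X q f) \<le> nsq X f"
proof -
  let ?g = "mulv X q f"
  have "ip X f ?g = ip X ?g ?g"
    using ip_proj[OF assms, of f ?g] ip_cong[of X f f "mulv X q ?g" ?g] mulv_proj_idem[OF assms]
    by metis
  then have "(nsq X ?g)\<^sup>2 \<le> nsq X f * nsq X ?g"
    using ip_Cauchy_Schwarz[of X f ?g] by (simp add: ip_self)
  then show ?thesis
    using nsq_nonneg[of X f] nsq_nonneg[of X ?g]
    by (cases "nsq X ?g = 0") (auto simp: power2_eq_square)
qed

lemma mulv_zero: "(\<And>t. t \<in> T \<Longrightarrow> h t = 0) \<Longrightarrow> mulv T M h s = 0"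
  by (simp add: mulv_def)

lemma ip_zero_right: "(\<And>s. s \<in> S \<Longrightarrow> g s = 0) \<Longrightarrow> ip S f g = 0"
  by (simp add: ip_def)

lemma nsq_eq_0_iff: "finite S \<Longrightarrow> nsq S f = 0 \<longleftrightarrow> (\<forall>s\<in>S. f s = 0)"
  by (simp add: nsq_def sum_nonneg_eq_0_iff)

text \<open>If w = qv is not zero, subtract from q the rank-one projection onto w. Since w lies in
  the range of q, the result is again a projection, its kernel contains that of q, and its trace is
  smaller by one.\<close>

lemma is_proj_kill:
  assumes fin: "finite X" and q: "is_proj X q"
  shows "\<exists>q'. is_proj X q' \<and> (\<forall>x\<in>X. mulv X q' v x = 0) \<and>
    (\<forall>f. (\<forall>x\<in>X. mulv X q f x = 0) \<longrightarrow> (\<forall>x\<in>X. mulv X q' f x = 0)) \<and>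
    Re (\<Sum>x\<in>X. q' x x) \<ge> Re (\<Sum>x\<in>X. q x x) - 1"
proof (cases "\<forall>x\<in>X. mulv X q v x = 0")
  case True
  then show ?thesis using q by (intro exI[of _ q]) auto
next
  case False
  define w where "w = mulv X q v"
  define c where "c = complex_of_real (nsq X w)"
  have c: "c \<noteq> 0"
    using False fin by (auto simp: c_def w_def nsq_eq_0_iff)
  have ww: "(\<Sum>x\<in>X. cnj (w x) * w x) = c"
    using ip_self[of X w] by (simp add: c_def ip_def)
  have qw: "(\<Sum>z\<in>X. q x z * w z) = w x" if "x \<in> X" for x
    using mulv_proj_idem[OF q that, of v] by (simp add: w_def mulv_def)
  have herm: "cnj (q x y) = q y x" if "x \<in> X" "y \<in> X" for x y
    using q that by (simp add: is_proj_def)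
  have wq: "(\<Sum>z\<in>X. cnj (w z) * q z y) = cnj (w y)" if "y \<in> X" for y
  proof -
    have "(\<Sum>z\<in>X. cnj (w z) * q z y) = cnj (\<Sum>z\<in>X. q y z * w z)"
      unfolding cnj_sum by (rule sum.cong) (use herm that in \<open>auto simp: mult.commute\<close>)
    then show ?thesis using qw[OF that] by simp
  qed
  \<comment> \<open>This identity is what makes the new projection vanish wherever \<open>q\<close>
    does.\<close>
  have wf: "ip X w f = ip X w (mulv X q f)" for f
    using ip_proj[OF q, of w f] ip_cong[of X "mulv X q w" w f f] qw by (simp add: mulv_def)
  define q' where "q' x y = q x y - w x * cnj (w y) / c" for x y
  have mq': "mulv X q' f x = mulv X q f x - w x * ip X w f / c" for f x
    unfolding mulv_def q'_def ip_def
    by (simp add: algebra_simps sum_subtractf sum_distrib_left sum_divide_distrib)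
  have "is_proj X q'"
    unfolding is_proj_def
  proof (intro conjI ballI)
    fix x y assume xy: "x \<in> X" "y \<in> X"
    have "cnj c = c" by (simp add: c_def)
    then show "cnj (q' x y) = q' y x"
      using herm[OF xy] by (simp add: q'_def mult.commute)
    have "(\<Sum>z\<in>X. q' x z * q' z y) = (\<Sum>z\<in>X. q x z * q z y) - (\<Sum>z\<in>X. q x z * w z) * cnj (w y) / c
        - w x / c * (\<Sum>z\<in>X. cnj (w z) * q z y) + w x / c * (\<Sum>z\<in>X. cnj (w z) * w z) * cnj (w y) / c"
      by (simp add: q'_def algebra_simps sum.distrib sum_subtractf sum_distrib_left sum_distrib_right
          sum_divide_distrib)
    also have "\<dots> = q' x y"
      using q xy c by (simp add: qw wq ww q'_def is_proj_def)
    finally show "(\<Sum>z\<in>X. q' x z * q' z y) = q' x y" .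
  qed
  moreover have "ip X w v = c"
    using wf[of v] ww unfolding w_def[symmetric] by (simp add: ip_def)
  then have "mulv X q' v x = 0" if "x \<in> X" for x
    using c by (simp add: mq' w_def[symmetric])
  moreover have "mulv X q' f x = 0" if "\<forall>x\<in>X. mulv X q f x = 0" "x \<in> X" for f x
    using that by (simp add: mq' wf[of f] ip_zero_right)
  moreover have "(\<Sum>x\<in>X. q' x x) = (\<Sum>x\<in>X. q x x) - 1"
    using ww c by (simp add: q'_def sum_subtractf sum_divide_distrib[symmetric] mult.commute)
  ultimately show ?thesis
    by (intro exI[of _ q']) auto
qed

lemma is_proj_kill_many:
  assumes fin: "finite X" and q: "is_proj X q"
  shows "\<exists>q'. is_proj X q' \<and> (\<forall>a<k. \<forall>x\<in>X. mulv X q' (v a) x = 0) \<and>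
    (\<forall>f. (\<forall>x\<in>X. mulv X q f x = 0) \<longrightarrow> (\<forall>x\<in>X. mulv X q' f x = 0)) \<and>
    Re (\<Sum>x\<in>X. q' x x) \<ge> Re (\<Sum>x\<in>X. q x x) - real k"
proof (induction k)
  case 0
  then show ?case using q by (intro exI[of _ q]) auto
next
  case (Suc k)
  then obtain p where p: "is_proj X p" "\<forall>a<k. \<forall>x\<in>X. mulv X p (v a) x = 0"
    "\<forall>f. (\<forall>x\<in>X. mulv X q f x = 0) \<longrightarrow> (\<forall>x\<in>X. mulv X p f x = 0)"
    "Re (\<Sum>x\<in>X. p x x) \<ge> Re (\<Sum>x\<in>X. q x x) - real k" by blast
  obtain q' where q': "is_proj X q'" "\<forall>x\<in>X. mulv X q' (v k) x = 0"
    "\<forall>f. (\<forall>x\<in>X. mulv X p f x = 0) \<longrightarrow> (\<forall>x\<in>X. mulv X q' f x = 0)"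
    "Re (\<Sum>x\<in>X. q' x x) \<ge> Re (\<Sum>x\<in>X. p x x) - 1"
    using is_proj_kill[OF fin p(1), of "v k"] by blast
  show ?case
    by (intro exI[of _ q']) (use p q' in \<open>auto simp: less_Suc_eq\<close>)
qed

text \<open>The operator 1 \<otimes> q on the tensor product of a space with basis indexed by
  numbers and the space on X.\<close>

definition ampl :: "'x set \<Rightarrow> ('x \<Rightarrow> 'x \<Rightarrow> complex) \<Rightarrow> (nat \<times> 'x \<Rightarrow> complex) \<Rightarrow> nat \<times> 'x \<Rightarrow> complex" where
  "ampl X q h = (\<lambda>(a, x). mulv X q (\<lambda>y. h (a, y)) x)"

lemma nsq_Times: "nsq (A \<times> X) h = (\<Sum>a\<in>A. nsq X (\<lambda>x. h (a, x)))"
  by (simp add: nsq_def sum.cartesian_product)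

lemma ip_Times: "ip (A \<times> X) f g = (\<Sum>a\<in>A. ip X (\<lambda>x. f (a, x)) (\<lambda>x. g (a, x)))"
  by (simp add: ip_def sum.cartesian_product)

lemma nsq_ampl_le: "is_proj X q \<Longrightarrow> nsq (A \<times> X) (ampl X q h) \<le> nsq (A \<times> X) h"
  by (simp add: nsq_Times ampl_def sum_mono nsq_proj_le)

lemma mulv_scale: "mulv T M (\<lambda>t. c * h t) s = c * mulv T M h s"
  by (simp add: mulv_def sum_distrib_left mult_ac)

lemma ip_scale_right: "ip S f (\<lambda>s. c * g s) = c * ip S f g"
  by (simp add: ip_def sum_distrib_left mult_ac)

lemma ip_scale_left: "ip S (\<lambda>s. c * f s) g = cnj c * ip S f g"
  by (simp add: ip_def sum_distrib_left mult_ac)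

text \<open>Greedy choice: as long as some vector in the range of \<open>1 \<otimes> q\<close> has a large image, add it to the
  orthonormal family and shrink \<open>q\<close> so that it kills the \<open>k\<close> slices of that vector.\<close>

lemma exists_proj_small_restriction:
  fixes X :: "'x set" and k :: nat
  defines "S \<equiv> {..<k} \<times> X"
  assumes fin: "finite X" and c: "c \<ge> 0"
    and few: "\<And>r H. (\<And>i j. i < r \<Longrightarrow> j < r \<Longrightarrow> ip S (H i) (H j) = of_bool (i = j)) \<Longrightarrow>
        (\<And>j. j < r \<Longrightarrow> nsq S (mulv S M (H j)) \<ge> c) \<Longrightarrow> real r \<le> \<rho>"
  shows "\<exists>q. is_proj X q \<and> Re (\<Sum>x\<in>X. q x x) \<ge> real (card X) - real k * \<rho> \<and>
    (\<forall>h. nsq S (mulv S M (ampl X q h)) \<le> c * nsq S h)"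
proof (rule ccontr)
  assume "\<not> ?thesis"
  then have large: "\<exists>h. nsq S (mulv S M (ampl X q h)) > c * nsq S h"
    if "is_proj X q" "Re (\<Sum>x\<in>X. q x x) \<ge> real (card X) - real k * \<rho>" for q
    using that not_le by blast
  have finS: "finite S" using fin by (simp add: S_def)
  \<comment> \<open>State after r rounds: r orthonormal vectors with large images, and a projection
    that kills all slices of these vectors and has lost at most k from its trace in each
    round.\<close>
  have states: "\<exists>H q. (\<forall>i<r. \<forall>j<r. ip S (H i) (H j) = of_bool (i = j)) \<and>
      (\<forall>j<r. nsq S (mulv S M (H j)) \<ge> c) \<and> is_proj X q \<and>
      Re (\<Sum>x\<in>X. q x x) \<ge> real (card X) - real k * real r \<and>
      (\<forall>j<r. \<forall>a<k. \<forall>x\<in>X. mulv X q (\<lambda>y. H j (a, y)) x = 0)" for r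
  proof (induction r)
    case 0
    show ?case
      by (rule exI, rule exI[of _ "\<lambda>x y. of_bool (x = y)"]) (simp add: is_proj_id fin)
  next
    case (Suc r)
    then obtain H q where H: "\<And>i j. i < r \<Longrightarrow> j < r \<Longrightarrow> ip S (H i) (H j) = of_bool (i = j)"
      "\<And>j. j < r \<Longrightarrow> nsq S (mulv S M (H j)) \<ge> c"
      and q: "is_proj X q" "Re (\<Sum>x\<in>X. q x x) \<ge> real (card X) - real k * real r"
      and kill: "\<And>j a x. j < r \<Longrightarrow> a < k \<Longrightarrow> x \<in> X \<Longrightarrow> mulv X q (\<lambda>y. H j (a, y)) x = 0"
      by blast
    have "real r \<le> \<rho>" by (rule few[OF H])
    then have "real k * real r \<le> real k * \<rho>" by (simp add: mult_left_mono)
    then obtain h where h: "nsq S (mulv S M (ampl X q h)) > c * nsq S h"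
      using large[OF q(1)] q(2) by fastforce
    define g where "g = ampl X q h"
    have le: "nsq S g \<le> nsq S h"
      unfolding g_def S_def by (rule nsq_ampl_le[OF q(1)])
    have Mg: "nsq S (mulv S M g) > c * nsq S g"
      using h mult_left_mono[OF le c] unfolding g_def by linarith
    have pos: "nsq S g > 0"
    proof (rule ccontr)
      assume "\<not> nsq S g > 0"
      then have "nsq S g = 0" using nsq_nonneg[of S g] by linarith
      then have "\<forall>s\<in>S. g s = 0" using finS by (simp add: nsq_eq_0_iff)
      then have "nsq S (mulv S M g) = 0"
        using finS by (simp add: nsq_eq_0_iff mulv_zero)
      then show False using Mg \<open>nsq S g = 0\<close> by simp
    qed
    \<comment> \<open>Normalising factor; the new vector lies in the range of 1 \<otimes> q and has
      a large image after scaling.\<close>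
    define d where "d = complex_of_real (1 / sqrt (nsq S g))"
    have d: "(cmod d)\<^sup>2 = 1 / nsq S g" "cnj d * d = complex_of_real (1 / nsq S g)"
      using pos by (simp_all add: d_def norm_divide power_divide flip: of_real_mult)
    define g' where "g' s = d * g s" for s
    have "nsq S (mulv S M g') = nsq S (mulv S M g) / nsq S g"
      unfolding g'_def mulv_scale[abs_def] using d(1) by (simp add: nsq_scale mulv_scale)
    then have g'1: "nsq S (mulv S M g') \<ge> c"
      using Mg pos by (simp add: pos_le_divide_eq)
    have g'2: "ip S g' g' = 1"
    proof -
      have "ip S g' g' = cnj d * d * of_real (nsq S g)"
        unfolding g'_def by (simp add: ip_scale_left ip_scale_right ip_self mult.assoc)
      then show ?thesis using d(2) pos by simp
    qed
    \<comment> \<open>Moving the projection to the other side of the inner product hits slices of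
      \<open>H j\<close>, which it kills; this is why the family stays orthogonal.\<close>
    have Hg: "ip S (H j) g' = 0" if j: "j < r" for j
    proof -
      have "ip S (H j) g = (\<Sum>a<k. ip X (mulv X q (\<lambda>x. H j (a, x))) (\<lambda>x. h (a, x)))"
        unfolding S_def ip_Times g_def ampl_def by (simp add: ip_proj[OF q(1)])
      also have "\<dots> = 0"
        by (rule sum.neutral) (use kill[OF j] in \<open>auto simp: ip_def\<close>)
      finally show ?thesis unfolding g'_def by (simp add: ip_scale_right)
    qed
    then have gH: "ip S g' (H j) = 0" if "j < r" for j
      using that by (metis cnj_ip complex_cnj_zero)
    obtain q' where q': "is_proj X q'" "\<forall>a<k. \<forall>x\<in>X. mulv X q' (\<lambda>y. g' (a, y)) x = 0"
      "\<forall>f. (\<forall>x\<in>X. mulv X q f x = 0) \<longrightarrow> (\<forall>x\<in>X. mulv X q' f x = 0)"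
      "Re (\<Sum>x\<in>X. q' x x) \<ge> Re (\<Sum>x\<in>X. q x x) - real k"
      using is_proj_kill_many[OF fin q(1), of k "\<lambda>a y. g' (a, y)"] by blast
    define H' where "H' j = (if j < r then H j else g')" for j
    show ?case
    proof (rule exI[of _ H'], rule exI[of _ q'], intro conjI allI impI)
      show "ip S (H' i) (H' j) = of_bool (i = j)" if "i < Suc r" "j < Suc r" for i j
        using that by (auto simp: H'_def H g'2 Hg gH less_Suc_eq)
      show "c \<le> nsq S (mulv S M (H' j))" if "j < Suc r" for j
        using that by (simp add: H'_def H g'1)
      show "real (card X) - real k * real (Suc r) \<le> Re (\<Sum>x\<in>X. q' x x)"
        using q' q by (simp add: algebra_simps)
      show "\<forall>x\<in>X. mulv X q' (\<lambda>y. H' j (a, y)) x = 0" if "j < Suc r" "a < k" for j a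
        using that q' kill by (auto simp: H'_def)
    qed (rule q'(1))
  qed
  \<comment> \<open>The process never stops, yet \<open>few\<close> bounds the number of
    rounds.\<close>
  have "real r \<le> \<rho>" for r
  proof -
    obtain H where "\<forall>i<r. \<forall>j<r. ip S (H i) (H j) = of_bool (i = j)"
      "\<forall>j<r. nsq S (mulv S M (H j)) \<ge> c"
      using states[of r] by blast
    then show ?thesis by (intro few[of r H]) simp_all
  qed
  then show False
    using reals_Archimedean2[of \<rho>] by (auto simp: not_le[symmetric])
qed

text \<open>Call a unit vector bad if its image has norm at least c. Around every point the action
  looks like a word ball, so each basis vector adds at most C^(4m) to the trace of (M*M)^(2m), while
  each member of an orthonormal family of bad vectors adds at least c^(4m). Such families are
  therefore small compared with N once m is large, and the greedy choice above costs only k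
  dimensions for each of their members.\<close>

lemma exists_free_permutations_with_small_compression:
  fixes t :: "'n::finite \<Rightarrow> nat \<Rightarrow> nat \<Rightarrow> complex" and k :: nat
  assumes C: "0 \<le> C" "C < c" and eps: "\<epsilon> > 0"
    and tree: "\<And>R h. nsq ({..<k} \<times> word_ball R) (mulv ({..<k} \<times> word_ball R)
      (\<lambda>(b, v) (a, w). \<Sum>l\<in>UNIV. t l b a * of_bool (v = free_gen l + w)) h)
      \<le> C\<^sup>2 * nsq ({..<k} \<times> word_ball R) h"
  shows "\<exists>(N::nat) (s :: 'n \<Rightarrow> nat \<Rightarrow> nat) q. N > 0 \<and> (\<forall>l. s l permutes {..<N}) \<and>
    is_proj {..<N} q \<and> Re (\<Sum>x<N. q x x) \<ge> (1 - \<epsilon>) * real N \<and>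
    (\<forall>h. nsq ({..<k} \<times> {..<N}) (mulv ({..<k} \<times> {..<N})
      (\<lambda>(b, y) (a, x). \<Sum>l\<in>UNIV. t l b a * of_bool (y = s l x)) (ampl {..<N} q h))
      \<le> c\<^sup>2 * nsq ({..<k} \<times> {..<N}) h)"
proof -
  have c: "c > 0" using C by linarith
  \<comment> \<open>Chosen so that \<theta>^m is the quotient of the two moment bounds
    \<open>(C\<^sup>2) ^ (2 * m)\<close> and \<open>(c\<^sup>2) ^ (2 * m)\<close>.\<close>
  define \<theta> where "\<theta> = (C\<^sup>2 / c\<^sup>2)\<^sup>2"
  have \<theta>: "0 \<le> \<theta>" "\<theta> < 1"
  proof -
    have "C\<^sup>2 < c\<^sup>2" using C by (intro power_strict_mono) auto
    then have "C\<^sup>2 / c\<^sup>2 < 1" using c by simp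
    then have "(C\<^sup>2 / c\<^sup>2)\<^sup>2 < 1\<^sup>2" by (intro power_strict_mono) auto
    then show "\<theta> < 1" by (simp add: \<theta>_def)
  qed (simp add: \<theta>_def)
  \<comment> \<open>One factor k comes from the dimension k N of the whole space, the other from the
    k slices removed per bad vector.\<close>
  have "(\<lambda>m. real k * real k * \<theta> ^ m) \<longlonglongrightarrow> real k * real k * 0"
    using \<theta> by (intro tendsto_mult tendsto_const LIMSEQ_power_zero) simp
  then have "\<forall>\<^sub>F m in sequentially. real k * real k * \<theta> ^ m < \<epsilon>"
    using eps by (intro order_tendstoD) auto
  then obtain j where "\<forall>m\<ge>j. real k * real k * \<theta> ^ m < \<epsilon>"
    by (auto simp: eventually_sequentially)
  \<comment> \<open>The moment comparison needs a power of two, and 2^j is at least j.\<close>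
  moreover define m :: nat where "m = 2 ^ j"
  moreover have "j \<le> m" unfolding m_def using less_exp[of j] by simp
  ultimately have m: "real k * real k * \<theta> ^ m < \<epsilon>" by blast
  \<comment> \<open>Each application of \<open>gram\<close> moves by two layers.\<close>
  define R where "R = 2 * m"
  obtain N and s :: "'n \<Rightarrow> nat \<Rightarrow> nat" where N: "N > 0" and s: "\<And>l. s l permutes {..<N}"
    and inj: "\<And>x. x < N \<Longrightarrow> inj_on (orbit_map s x) (word_ball (Suc R))"
    and ran: "\<And>x. x < N \<Longrightarrow> range (orbit_map s x) \<subseteq> {..<N}"
    using free_group_finite_action[of "Suc R", where ?'a = 'n] by metis
  define S where "S = {..<k} \<times> {..<N}"
  define M where "M = (\<lambda>(b, y) (a, x). \<Sum>l\<in>UNIV. t l b a * of_bool (y = s l x) :: complex)"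
  have bij: "bij (s l)" for l using permutes_bij[OF s] .
  have loc: "nsq S ((gram S M ^^ m) (\<lambda>u. of_bool (u = u0))) \<le> (C\<^sup>2) ^ (2 * m)" if u0S: "u0 \<in> S" for u0
  proof -
    obtain b0 x where u0: "u0 = (b0, x)" "b0 < k" "x < N"
      using u0S by (auto simp: S_def)
    define \<phi> where "\<phi> = orbit_map s x"
    have \<phi>_gen: "\<phi> (free_gen l + w) = s l (\<phi> w)" for l w
      unfolding \<phi>_def by (rule orbit_map_free_gen_add[OF bij])
    have \<phi>_inv: "\<phi> v = s l y \<Longrightarrow> y = \<phi> (- free_gen l + v)" for l y v
      using \<phi>_gen[of l "- free_gen l + v"] bij_is_inj[OF bij[of l]] by (simp add: inj_eq add.assoc[symmetric])
    have \<phi>_lt: "\<phi> w < N" for w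
      using ran[OF u0(3)] by (auto simp: \<phi>_def)
    have inj': "inj_on \<phi> (word_ball (Suc R))" unfolding \<phi>_def by (rule inj[OF u0(3)])
    define Sr where "Sr r = {..<k} \<times> \<phi> ` word_ball r" for r
    have "(\<forall>u\<in>S. u \<notin> Sr (2 * m) \<longrightarrow> (gram S M ^^ m) (\<lambda>u. of_bool (u = u0)) u = 0) \<and>
        nsq S ((gram S M ^^ m) (\<lambda>u. of_bool (u = u0))) \<le> (C\<^sup>2) ^ (2 * m)"
    proof (rule gram_power_local_bound[where R = R])
      show "finite S" by (simp add: S_def)
      show "Sr R \<subseteq> S" using \<phi>_lt by (auto simp: Sr_def S_def)
      show "Sr r \<subseteq> Sr (Suc r)" for r
        using word_ball_mono[of r "Suc r", where ?'a = 'n] by (auto simp: Sr_def)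
      show "u \<in> Sr (Suc r)" if uu: "u' \<in> Sr r" "u \<in> S" "M u u' \<noteq> 0" for r u u'
      proof -
        obtain a w where u': "u' = (a, \<phi> w)" "w \<in> word_ball r" using uu by (auto simp: Sr_def)
        obtain b y where u: "u = (b, y)" "b < k" using uu by (auto simp: S_def)
        have "\<exists>l. y = s l (\<phi> w)"
        proof (rule ccontr)
          assume "\<not> ?thesis"
          then have "M u u' = 0" by (simp add: M_def u u')
          then show False using uu(3) by simp
        qed
        then obtain l where "y = \<phi> (free_gen l + w)" using \<phi>_gen by auto
        then show ?thesis
          using u free_gen_add_word_ball[OF u'(2), of l] by (auto simp: Sr_def)
      qed
      show "u' \<in> Sr (Suc r)" if uu: "u \<in> Sr r" "u' \<in> S" "M u u' \<noteq> 0" for r u u'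
      proof -
        obtain b v where u: "u = (b, \<phi> v)" "v \<in> word_ball r" using uu by (auto simp: Sr_def)
        obtain a y where u': "u' = (a, y)" "a < k" using uu by (auto simp: S_def)
        have "\<exists>l. \<phi> v = s l y"
        proof (rule ccontr)
          assume "\<not> ?thesis"
          then have "M u u' = 0" by (simp add: M_def u u')
          then show False using uu(3) by simp
        qed
        then obtain l where "y = \<phi> (- free_gen l + v)" using \<phi>_inv by blast
        then show ?thesis
          using u' uminus_free_gen_add_word_ball[OF u(2), of l] by (auto simp: Sr_def)
      qed
      show "nsq (Sr R) (mulv (Sr R) M h) \<le> C\<^sup>2 * nsq (Sr R) h" for h
      proof -
        define g where "g = map_prod (id :: nat \<Rightarrow> nat) \<phi>"
        let ?B = "{..<k} \<times> (word_ball R :: 'n free_group set)"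
        let ?M = "\<lambda>(b, v) (a, w). \<Sum>l\<in>UNIV. t l b a * of_bool (v = free_gen l + w)"
        have injg: "inj_on g ?B"
          unfolding g_def
          by (intro map_prod_inj_on inj_on_id inj_on_subset[OF inj' word_ball_mono]) simp
        have Sr: "Sr R = g ` ?B" by (simp add: Sr_def g_def map_prod_surj_on)
        \<comment> \<open>Here w is in the ball of radius R, but its neighbour may only be in the
          next ball. Injectivity up to \<open>Suc R\<close> therefore rules out edges of the action
          that have no counterpart in the group.\<close>
        have Mg: "M (g u) (g u') = ?M u u'" if uB: "u \<in> ?B" "u' \<in> ?B" for u u'
        proof -
          obtain b v a w where u: "u = (b, v)" "v \<in> word_ball R" "u' = (a, w)" "w \<in> word_ball R"
            using uB by auto
          have "\<phi> v = s l (\<phi> w) \<longleftrightarrow> v = free_gen l + w" for l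
            using inj_onD[OF inj', of v "free_gen l + w"] free_gen_add_word_ball[OF u(4), of l]
              word_ball_mono[of R "Suc R", where ?'a = 'n] u(2) \<phi>_gen[of l w] by auto
          then show ?thesis by (simp add: u M_def g_def)
        qed
        have nsqg: "nsq (Sr R) f = nsq ?B (f \<circ> g)" for f
          unfolding Sr nsq_def by (simp add: sum.reindex[OF injg])
        have "mulv (Sr R) M h (g u) = mulv ?B ?M (h \<circ> g) u" if "u \<in> ?B" for u
          unfolding Sr mulv_def sum.reindex[OF injg]
          by (rule sum.cong) (use that Mg in auto)
        then have "nsq (Sr R) (mulv (Sr R) M h) = nsq ?B (mulv ?B ?M (h \<circ> g))"
          unfolding nsqg by (intro nsq_cong) simp
        then show ?thesis using tree[of R "h \<circ> g"] by (simp only: nsqg)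
      qed
      show "nsq S (\<lambda>u. of_bool (u = u0)) = 1"
      proof -
        have "nsq S (\<lambda>u. of_bool (u = u0)) = (\<Sum>u\<in>S. if u = u0 then 1 else 0)"
          unfolding nsq_def by (rule sum.cong) auto
        then show ?thesis using u0S by (simp add: S_def)
      qed
      show "of_bool (u = u0) = (0 :: complex)" if "u \<in> S" "u \<notin> Sr 0" for u
      proof -
        have "x = \<phi> 0" by (simp add: \<phi>_def)
        then have "u0 \<in> Sr 0" using u0 by (auto simp: Sr_def)
        then show ?thesis using that by auto
      qed
    qed (simp_all add: R_def)
    then show ?thesis by simp
  qed
  \<comment> \<open>Upper bound for the length of an orthonormal family of bad vectors.\<close>
  define \<rho> where "\<rho> = real k * real N * \<theta> ^ m"
  have "\<exists>q. is_proj {..<N} q \<and> Re (\<Sum>x\<in>{..<N}. q x x) \<ge> real (card {..<N}) - real k * \<rho> \<and>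
    (\<forall>h. nsq ({..<k} \<times> {..<N}) (mulv ({..<k} \<times> {..<N}) M (ampl {..<N} q h))
       \<le> c\<^sup>2 * nsq ({..<k} \<times> {..<N}) h)"
  proof (rule exists_proj_small_restriction)
    fix r :: nat and H
    assume H: "\<And>i j. i < r \<Longrightarrow> j < r \<Longrightarrow> ip ({..<k} \<times> {..<N}) (H i) (H j) = of_bool (i = j)"
      "\<And>j. j < r \<Longrightarrow> nsq ({..<k} \<times> {..<N}) (mulv ({..<k} \<times> {..<N}) M (H j)) \<ge> c\<^sup>2"
    have "real (card {..<r}) * (c\<^sup>2) ^ (2 * m) \<le> real (card S) * (C\<^sup>2) ^ (2 * m)"
      by (rule card_orthonormal_large_image[where h = H and M = M and l = j])
         (use H loc in \<open>auto simp: S_def m_def\<close>)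
    then have "real r * (c\<^sup>2) ^ (2 * m) \<le> real k * real N * (C\<^sup>2) ^ (2 * m)"
      by (simp add: S_def)
    then have "real r \<le> real k * real N * (C\<^sup>2) ^ (2 * m) / (c\<^sup>2) ^ (2 * m)"
      using c by (simp add: pos_le_divide_eq)
    also have "\<dots> = \<rho>" by (simp add: \<rho>_def \<theta>_def power_divide power_mult)
    finally show "real r \<le> \<rho>" .
  qed simp_all
  then obtain q where q: "is_proj {..<N} q" "Re (\<Sum>x<N. q x x) \<ge> real N - real k * \<rho>"
    "\<And>h. nsq S (mulv S M (ampl {..<N} q h)) \<le> c\<^sup>2 * nsq S h"
    unfolding S_def by auto
  have "real k * \<rho> = real k * real k * \<theta> ^ m * real N" by (simp add: \<rho>_def)
  also have "\<dots> \<le> \<epsilon> * real N"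
    using m by (intro mult_right_mono) auto
  finally have "Re (\<Sum>x<N. q x x) \<ge> (1 - \<epsilon>) * real N"
    using q(2) by (simp add: left_diff_distrib)
  then show ?thesis
    using N s q unfolding S_def M_def by (intro exI[of _ N] exI[of _ s] exI[of _ q]) simp
qed

section \<open>Vectors and compact operators on square summable families\<close>

lemma ell2_eqI: "(\<And>i. ell2_coord x i = ell2_coord y i) \<Longrightarrow> x = y"
  by (simp add: ell2_coord_inject[symmetric] fun_eq_iff)

lemma ell2_coord_simps [simp]:
  "ell2_coord 0 i = 0"
  "ell2_coord (x + y) i = ell2_coord x i + ell2_coord y i"
  "ell2_coord (- x) i = - ell2_coord x i"
  "ell2_coord (c *\<^sub>C x) i = c * ell2_coord x i"
  "ell2_coord (r *\<^sub>R x) i = of_real r * ell2_coord x i"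
  by (simp_all add: zero_ell2.rep_eq plus_ell2.rep_eq uminus_ell2.rep_eq scaleC.rep_eq
      scaleR_ell2.rep_eq)

lemma ell2_coord_diff [simp]: "ell2_coord (x - y) i = ell2_coord x i - ell2_coord y i"
  unfolding minus_ell2_def plus_ell2.rep_eq uminus_ell2.rep_eq by simp

lemma ell2_coord_sum [simp]: "ell2_coord (sum f A) i = (\<Sum>a\<in>A. ell2_coord (f a) i)"
  by (induction A rule: infinite_finite_induct) simp_all

lemma has_sum_norm_ell2: "((\<lambda>i. (cmod (ell2_coord x i))\<^sup>2) has_sum (norm x)\<^sup>2) UNIV"
proof -
  have "(\<lambda>i. (cmod (ell2_coord x i))\<^sup>2) summable_on UNIV"
    using ell2_coord[of x] by simp
  moreover have "(norm x)\<^sup>2 = (\<Sum>\<^sub>\<infinity>i. (cmod (ell2_coord x i))\<^sup>2)"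
    by (simp add: norm_ell2.rep_eq infsum_nonneg)
  ultimately show ?thesis by simp
qed

lemma sum_coord_le_norm: "finite F \<Longrightarrow> (\<Sum>i\<in>F. (cmod (ell2_coord x i))\<^sup>2) \<le> (norm x)\<^sup>2"
  by (rule has_sum_mono2[OF has_sum_finite has_sum_norm_ell2]) auto

lemma norm_ell2_Pythagoras:
  assumes "\<And>i. ell2_coord x i = 0 \<or> ell2_coord y i = 0"
  shows "(norm (x + y))\<^sup>2 = (norm x)\<^sup>2 + (norm y)\<^sup>2"
proof (rule has_sum_unique[OF has_sum_norm_ell2])
  have "(cmod (ell2_coord (x + y) i))\<^sup>2 = (cmod (ell2_coord x i))\<^sup>2 + (cmod (ell2_coord y i))\<^sup>2" for i
    using assms[of i] by auto
  then show "((\<lambda>i. (cmod (ell2_coord (x + y) i))\<^sup>2) has_sum (norm x)\<^sup>2 + (norm y)\<^sup>2) UNIV"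
    by (simp add: has_sum_add has_sum_norm_ell2)
qed

lift_definition ket :: "'i \<Rightarrow> 'i ell2" is "\<lambda>j i. of_bool (i = j)"
proof (rule finite_nonzero_values_imp_summable_on)
  fix j :: 'i
  have "{i \<in> UNIV. (cmod (of_bool (i = j)))\<^sup>2 \<noteq> 0} \<subseteq> {j}" by auto
  then show "finite {i \<in> UNIV. (cmod (of_bool (i = j)))\<^sup>2 \<noteq> 0}"
    by (rule finite_subset) simp
qed

lemma ell2_coord_ket [simp]: "ell2_coord (ket j) i = of_bool (i = j)"
  by (simp add: ket.rep_eq)

definition finvec :: "'i set \<Rightarrow> ('i \<Rightarrow> complex) \<Rightarrow> 'i ell2" where
  "finvec F h = (\<Sum>i\<in>F. h i *\<^sub>C ket i)"

lemma ell2_coord_finvec: "finite F \<Longrightarrow> ell2_coord (finvec F h) i = (if i \<in> F then h i else 0)"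
proof -
  assume "finite F"
  have "ell2_coord (finvec F h) i = (\<Sum>j\<in>F. if i = j then h j else 0)"
    by (auto simp: finvec_def intro!: sum.cong)
  then show ?thesis using \<open>finite F\<close> by simp
qed

lemma norm_finvec: "finite F \<Longrightarrow> (norm (finvec F h))\<^sup>2 = nsq F h"
proof (rule has_sum_unique[OF has_sum_norm_ell2])
  assume "finite F"
  then show "((\<lambda>i. (cmod (ell2_coord (finvec F h) i))\<^sup>2) has_sum nsq F h) UNIV"
    unfolding nsq_def by (intro has_sum_finite_neutralI) (auto simp: ell2_coord_finvec intro!: sum.cong)
qed

definition trunc :: "nat \<Rightarrow> nat ell2 \<Rightarrow> nat ell2" where
  "trunc k x = finvec {..<k} (ell2_coord x)"

lemma ell2_coord_trunc [simp]: "ell2_coord (trunc k x) i = (if i < k then ell2_coord x i else 0)"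
  by (simp add: trunc_def ell2_coord_finvec)

lemma trunc_diff: "trunc k (x - y) = trunc k x - trunc k y"
  by (rule ell2_eqI) simp

lemma trunc_scaleR: "trunc k (r *\<^sub>R x) = r *\<^sub>R trunc k x"
  by (rule ell2_eqI) simp

lemma norm_trunc_Pythagoras: "(norm x)\<^sup>2 = (norm (trunc k x))\<^sup>2 + (norm (x - trunc k x))\<^sup>2"
  using norm_ell2_Pythagoras[of "trunc k x" "x - trunc k x"] by simp

lemma norm_trunc_le: "norm (trunc k x) \<le> norm x"
  using norm_trunc_Pythagoras[of x k] by (simp add: power2_le_imp_le)

lemma norm_diff_trunc_le: "norm (x - trunc k x) \<le> norm x"
  using norm_trunc_Pythagoras[of x k] by (simp add: power2_le_imp_le)

lemma trunc_tendsto: "(\<lambda>k. trunc k x) \<longlonglongrightarrow> x"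
proof -
  have "(\<lambda>i. (cmod (ell2_coord x i))\<^sup>2) sums (norm x)\<^sup>2"
    by (rule has_sum_imp_sums[OF has_sum_norm_ell2])
  then have "(\<lambda>k. (norm x)\<^sup>2 - (\<Sum>i<k. (cmod (ell2_coord x i))\<^sup>2)) \<longlonglongrightarrow> (norm x)\<^sup>2 - (norm x)\<^sup>2"
    unfolding sums_def by (intro tendsto_diff tendsto_const)
  moreover have "(norm x)\<^sup>2 - (\<Sum>i<k. (cmod (ell2_coord x i))\<^sup>2) = (norm (x - trunc k x))\<^sup>2" for k
    using norm_trunc_Pythagoras[of x k] by (simp add: trunc_def norm_finvec nsq_def)
  ultimately have "(\<lambda>k. sqrt ((norm (x - trunc k x))\<^sup>2)) \<longlonglongrightarrow> sqrt 0"
    by (intro tendsto_real_sqrt) simp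
  then have "(\<lambda>k. norm (trunc k x - x)) \<longlonglongrightarrow> 0"
    by (simp add: norm_minus_commute)
  then show ?thesis
    by (simp add: tendsto_norm_zero_iff LIM_zero_iff)
qed

text \<open>A finitely supported vector which almost attains the norm of \<open>\<phi>\<close> leaves no room for \<open>\<phi>\<close> on the
  vectors orthogonal to its support.\<close>

lemma bounded_functional_small_on_tails:
  fixes \<phi> :: "nat ell2 \<Rightarrow> real"
  assumes "bounded_linear \<phi>" "e > 0"
  shows "\<exists>l. \<forall>y. (\<forall>i<l. ell2_coord y i = 0) \<longrightarrow> norm y \<le> 1 \<longrightarrow> \<bar>\<phi> y\<bar> \<le> e"
proof -
  interpret bounded_linear \<phi> by fact
  define m where "m = onorm \<phi>"
  have m: "m \<ge> 0" and phi_le: "\<bar>\<phi> x\<bar> \<le> m * norm x" for x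
    using onorm_pos_le[OF assms(1)] onorm[OF assms(1), of x] by (simp_all add: m_def)
  \<comment> \<open>The final comparison reads s \<phi>(y) \<le> m (1 + s^2/2) - (m - s^2) = s * s
    (m/2 + 1), so s is chosen to make s (m/2 + 1) equal to e.\<close>
  define s where "s = e / (m / 2 + 1)"
  have s: "s > 0" "s * (m / 2 + 1) = e"
    using m assms(2) by (simp_all add: s_def)
  have "\<exists>x. norm x \<le> 1 \<and> \<phi> x > m - s\<^sup>2"
  proof (rule ccontr)
    assume "\<not> ?thesis"
    then have le: "\<phi> x \<le> m - s\<^sup>2" if "norm x \<le> 1" for x
      using that not_le by blast
    have b: "m - s\<^sup>2 \<ge> 0" using le[of 0] by (simp add: zero)
    have "\<phi> x \<le> (m - s\<^sup>2) * norm x" for x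
    proof (cases "x = 0")
      case False
      have "\<phi> ((1 / norm x) *\<^sub>R x) \<le> m - s\<^sup>2"
        using False by (intro le) simp
      then show ?thesis
        using False by (simp add: scaleR pos_divide_le_eq)
    qed (simp add: zero)
    then have "norm (\<phi> x) \<le> (m - s\<^sup>2) * norm x" for x
      using \<open>\<And>x. \<phi> x \<le> _\<close>[of x] \<open>\<And>x. \<phi> x \<le> _\<close>[of "- x"] by (simp add: neg abs_le_iff)
    then have "onorm \<phi> \<le> m - s\<^sup>2" by (intro onorm_bound b)
    then show False using s by (simp add: m_def)
  qed
  then obtain x where x: "norm x \<le> 1" "\<phi> x > m - s\<^sup>2" by blast
  have "(\<lambda>k. \<phi> (trunc k x)) \<longlonglongrightarrow> \<phi> x"
    by (rule tendsto[OF trunc_tendsto])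
  then have "\<forall>\<^sub>F k in sequentially. \<phi> (trunc k x) > m - s\<^sup>2"
    using x(2) by (rule order_tendstoD)
  then obtain l where l: "\<phi> (trunc l x) > m - s\<^sup>2"
    by (auto simp: eventually_sequentially)
  have bound: "\<phi> y \<le> e" if y: "\<forall>i<l. ell2_coord y i = 0" "norm y \<le> 1" for y
  proof -
    \<comment> \<open>Perturbing the almost extremal vector by s y, orthogonal to it, increases the
      norm only to second order in s, whereas the value of \<phi> changes to first order.\<close>
    have "(norm (trunc l x + s *\<^sub>R y))\<^sup>2 = (norm (trunc l x))\<^sup>2 + (norm (s *\<^sub>R y))\<^sup>2"
      by (rule norm_ell2_Pythagoras) (use y in auto)
    also have "\<dots> \<le> 1 + s\<^sup>2"
    proof -
      have "norm (trunc l x) \<le> 1" using norm_trunc_le[of l x] x by linarith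
      moreover have "norm (s *\<^sub>R y) \<le> s" using y s by simp
      ultimately show ?thesis
        using power_mono[of "norm (trunc l x)" 1 2] power_mono[of "norm (s *\<^sub>R y)" s 2] by simp
    qed
    also have "\<dots> \<le> (1 + s\<^sup>2 / 2)\<^sup>2" by (simp add: power2_sum)
    finally have "norm (trunc l x + s *\<^sub>R y) \<le> 1 + s\<^sup>2 / 2"
      by (rule power2_le_imp_le) simp
    then have "m * norm (trunc l x + s *\<^sub>R y) \<le> m * (1 + s\<^sup>2 / 2)"
      using m by (rule mult_left_mono)
    then have "\<phi> (trunc l x) + s * \<phi> y \<le> m * (1 + s\<^sup>2 / 2)"
      using phi_le[of "trunc l x + s *\<^sub>R y"] by (simp add: add scaleR)
    then have "s * \<phi> y \<le> s * (s * (m / 2 + 1))"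
      using l by (simp add: algebra_simps power2_eq_square)
    then show ?thesis using s by simp
  qed
  show ?thesis
  proof (intro exI[of _ l] allI impI)
    fix y :: "nat ell2" assume "\<forall>i<l. ell2_coord y i = 0" "norm y \<le> 1"
    then show "\<bar>\<phi> y\<bar> \<le> e"
      using bound[of y] bound[of "- y"] by (simp add: neg abs_le_iff)
  qed
qed

text \<open>A finite net of the image of the unit ball controls truncation on the left. For
  truncation on the right, let y be a tail: Ty is close to a net point z, and the inner product of
  Ty with z is small by the previous lemma, so the norm of Ty is small. Compactness of the adjoint
  is thus not invoked.\<close>

lemma compact_op_trunc:
  assumes "compact_op T" "e > 0"
  shows "\<exists>k0. \<forall>k\<ge>k0. \<forall>x. norm (T x - trunc k (T (trunc k x))) \<le> e * norm x"
proof -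
  \<comment> \<open>The first entry serves the left truncation, with error 2 d \<le> e/2; the second
    serves the tail estimate, where the squared norm is at most d (1 + norm T).\<close>
  define d where "d = min (e / 4) ((e / 2)\<^sup>2 / (1 + norm T))"
  have nT: "1 + norm T > 0"
    using norm_ge_zero[of T] by linarith
  have d: "d > 0" "2 * d \<le> e / 2" "d * (1 + norm T) \<le> (e / 2)\<^sup>2"
  proof -
    show "d > 0" using assms(2) nT by (simp add: d_def)
    have "d \<le> e / 4" unfolding d_def by (rule min.cobounded1)
    then show "2 * d \<le> e / 2" by simp
    have "d \<le> (e / 2)\<^sup>2 / (1 + norm T)" by (simp add: d_def)
    then show "d * (1 + norm T) \<le> (e / 2)\<^sup>2" using nT by (simp add: pos_le_divide_eq)
  qed
  obtain Z where Z: "finite Z" "closure (blinfun_apply T ` cball 0 1) \<subseteq> (\<Union>z\<in>Z. ball z d)"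
    using assms(1) d(1) unfolding compact_op_def compact_eq_totally_bounded by blast
  have net: "\<exists>z\<in>Z. norm (T x - z) \<le> d" if "norm x \<le> 1" for x
  proof -
    have "T x \<in> closure (blinfun_apply T ` cball 0 1)"
      using that by (intro subsetD[OF closure_subset]) auto
    then obtain z where "z \<in> Z" "dist z (T x) < d" using Z(2) by auto
    then show ?thesis by (intro bexI[of _ z]) (auto simp: dist_norm norm_minus_commute)
  qed
  have "\<forall>\<^sub>F k in sequentially. \<forall>z\<in>Z. norm (trunc k z - z) < d"
    by (intro eventually_ball_finite ballI Z(1))
       (use trunc_tendsto d(1) in \<open>auto simp: tendsto_iff dist_norm\<close>)
  then obtain k1 where k1: "\<And>k z. k \<ge> k1 \<Longrightarrow> z \<in> Z \<Longrightarrow> norm (z - trunc k z) < d"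
    by (auto simp: eventually_sequentially norm_minus_commute)
  have "\<exists>l. \<forall>y. (\<forall>i<l. ell2_coord y i = 0) \<longrightarrow> norm y \<le> 1 \<longrightarrow> \<bar>inner (T y) z\<bar> \<le> d" for z
    by (rule bounded_functional_small_on_tails)
       (use d(1) in \<open>auto intro!: bounded_linear_compose[OF bounded_linear_inner_left] blinfun.bounded_linear_right\<close>)
  then obtain l where l: "\<And>z y. (\<forall>i<l z. ell2_coord y i = 0) \<Longrightarrow> norm y \<le> 1 \<Longrightarrow> \<bar>inner (T y) z\<bar> \<le> d"
    by metis
  define k0 where "k0 = max k1 (Max (insert 0 (l ` Z)))"
  have lk0: "l z \<le> k0" if "z \<in> Z" for z
    using that Z(1) unfolding k0_def by (intro max.coboundedI2 Max_ge) auto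
  have unit: "norm (T x - trunc k (T (trunc k x))) \<le> e" if k: "k \<ge> k0" and x: "norm x \<le> 1" for k x
  proof -
    obtain z where z: "z \<in> Z" "norm (T x - z) \<le> d" using net[OF x] by blast
    have "T x - trunc k (T x) = ((T x - z) - trunc k (T x - z)) + (z - trunc k z)"
      by (simp add: trunc_diff)
    then have "norm (T x - trunc k (T x)) \<le> norm ((T x - z) - trunc k (T x - z)) + norm (z - trunc k z)"
      by (metis norm_triangle_ineq)
    also have "\<dots> \<le> d + d"
      using z k k1[of k z] norm_diff_trunc_le[of "T x - z" k] by (simp add: k0_def)
    finally have 1: "norm (T x - trunc k (T x)) \<le> e / 2" using d(2) by linarith
    define y where "y = x - trunc k x"
    have y: "norm y \<le> 1" using norm_diff_trunc_le[of x k] x unfolding y_def by linarith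
    obtain z where z: "z \<in> Z" "norm (T y - z) \<le> d" using net[OF y] by blast
    have "norm (T y) \<le> norm T"
      using norm_blinfun[of T y] y mult_left_mono[OF y norm_ge_zero[of T]] by linarith
    have "\<bar>inner (T y) z\<bar> \<le> d"
      by (rule l[OF _ y]) (use lk0[OF z(1)] k in \<open>auto simp: y_def\<close>)
    have "(norm (T y))\<^sup>2 = inner (T y) z + inner (T y) (T y - z)"
      by (simp add: power2_norm_eq_inner inner_diff_right)
    also have "\<dots> \<le> d + norm (T y) * norm (T y - z)"
      using \<open>\<bar>inner (T y) z\<bar> \<le> d\<close> norm_cauchy_schwarz[of "T y" "T y - z"] by linarith
    also have "\<dots> \<le> d + norm T * d"
      using \<open>norm (T y) \<le> norm T\<close> z(2) by (intro add_left_mono mult_mono) auto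
    also have "\<dots> \<le> (e / 2)\<^sup>2" using d(3) by (simp add: algebra_simps)
    finally have "norm (T y) \<le> e / 2"
      by (rule power2_le_imp_le) (use assms(2) in simp)
    then have 2: "norm (trunc k (T y)) \<le> e / 2"
      using norm_trunc_le[of k "T y"] by linarith
    \<comment> \<open>The two truncations are separated: the first summand is the left error, the
      second the truncated image of the tail.\<close>
    have eq: "T x - trunc k (T (trunc k x)) = (T x - trunc k (T x)) + trunc k (T y)"
      by (simp add: y_def blinfun.diff_right trunc_diff)
    show ?thesis
      unfolding eq using 1 2 norm_triangle_ineq[of "T x - trunc k (T x)" "trunc k (T y)"] by linarith
  qed
  have "norm (T x - trunc k (T (trunc k x))) \<le> e * norm x" if "k \<ge> k0" for k x
  proof (cases "x = 0")
    case True
    have "trunc k (0 :: nat ell2) = 0" by (rule ell2_eqI) simp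
    then show ?thesis using True by (simp add: blinfun.zero_right)
  next
    case False
    let ?D = "\<lambda>x. T x - trunc k (T (trunc k x))"
    have "?D ((1 / norm x) *\<^sub>R x) = (1 / norm x) *\<^sub>R ?D x"
      by (simp add: trunc_scaleR blinfun.scaleR_right scaleR_diff_right)
    moreover have "norm (?D ((1 / norm x) *\<^sub>R x)) \<le> e"
      by (rule unit[OF that]) (use False in simp)
    ultimately show ?thesis using False by (simp add: pos_divide_le_eq)
  qed
  then show ?thesis by blast
qed

lemma has_sum_finite_sum:
  fixes f :: "'a \<Rightarrow> 'b \<Rightarrow> real"
  assumes "finite A" "\<And>a. a \<in> A \<Longrightarrow> (f a has_sum s a) B"
  shows "((\<lambda>x. \<Sum>a\<in>A. f a x) has_sum (\<Sum>a\<in>A. s a)) B"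
  using assms by (induction A rule: finite_induct) (auto intro!: has_sum_add)

text \<open>A scalar matrix keeps its norm when tensored with the identity of a Hilbert space: apply
  the scalar bound in each coordinate and sum.\<close>

lemma ell2_matrix_bound:
  assumes "finite I" "finite J" "\<And>h. nsq I (mulv J A h) \<le> K * nsq J h"
  shows "(\<Sum>i\<in>I. (norm (\<Sum>j\<in>J. A i j *\<^sub>C y j))\<^sup>2) \<le> K * (\<Sum>j\<in>J. (norm (y j))\<^sup>2)"
proof (rule has_sum_mono)
  show "((\<lambda>v. \<Sum>i\<in>I. (cmod (ell2_coord (\<Sum>j\<in>J. A i j *\<^sub>C y j) v))\<^sup>2) has_sum
      (\<Sum>i\<in>I. (norm (\<Sum>j\<in>J. A i j *\<^sub>C y j))\<^sup>2)) UNIV"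
    by (intro has_sum_finite_sum has_sum_norm_ell2 assms)
  show "((\<lambda>v. K * (\<Sum>j\<in>J. (cmod (ell2_coord (y j) v))\<^sup>2)) has_sum K * (\<Sum>j\<in>J. (norm (y j))\<^sup>2)) UNIV"
    by (intro has_sum_cmult_right has_sum_finite_sum has_sum_norm_ell2 assms)
  show "(\<Sum>i\<in>I. (cmod (ell2_coord (\<Sum>j\<in>J. A i j *\<^sub>C y j) v))\<^sup>2)
      \<le> K * (\<Sum>j\<in>J. (cmod (ell2_coord (y j) v))\<^sup>2)" for v
    using assms(3)[of "\<lambda>j. ell2_coord (y j) v"] by (simp add: nsq_def mulv_def)
qed

section \<open>The norm of the sum of the generators\<close>

definition starts_with :: "'a \<times> bool \<Rightarrow> 'a free_group \<Rightarrow> bool" where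
  "starts_with l w \<longleftrightarrow> Rep_free_group w \<noteq> [] \<and> hd (Rep_free_group w) = l"

lemma starts_with_unique: "starts_with l w \<Longrightarrow> starts_with l' w \<Longrightarrow> l = l'"
  by (simp add: starts_with_def)

text \<open>Multiplying by the inverse generator either cancels a leading \<open>(i, True)\<close>
  or prepends \<open>(i, False)\<close>. In the tree this says that exactly one end of each edge is
  nearer to the root.\<close>

lemma starts_with_uminus_free_gen_add:
  "starts_with (i, False) (- free_gen i + v) \<longleftrightarrow> \<not> starts_with (i, True) v"
proof -
  have "reduced (Rep_free_group v)"
    using Rep_free_group[of v] by simp
  then show ?thesis
    by (cases "Rep_free_group v")
       (auto simp: starts_with_def Rep_uminus_free_gen_add red_cons_def inv_letter_def reduced_Cons)
qed

text \<open>With \<rho>^2 = n - 1, one weight \<rho> and n - 1 weights 1/\<rho> add up to exactly 2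
  \<rho>. Having no large weight only decreases the sum, as 1/\<rho> \<le> \<rho> for n \<ge>
  2.\<close>

lemma sum_one_large_weight_le:
  fixes P :: "'n::finite \<Rightarrow> bool"
  assumes "CARD('n) \<ge> 2" "\<And>i j. P i \<Longrightarrow> P j \<Longrightarrow> i = j"
  shows "(\<Sum>i\<in>UNIV. if P i then sqrt (real CARD('n) - 1) else 1 / sqrt (real CARD('n) - 1))
    \<le> 2 * sqrt (real CARD('n) - 1)"
proof -
  define \<rho> where "\<rho> = sqrt (real CARD('n) - 1)"
  have \<rho>: "\<rho> \<ge> 1" "\<rho> * \<rho> = real CARD('n) - 1"
    using assms(1) by (simp_all add: \<rho>_def)
  have r1: "1 / \<rho> \<le> \<rho>" using \<rho>(1) by (simp add: divide_le_eq order_trans[of 1 \<rho>] mult_le_one)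
  have "(\<Sum>i\<in>UNIV. if P i then \<rho> else 1 / \<rho>) = (\<Sum>i\<in>UNIV. 1 / \<rho> + (if P i then \<rho> - 1 / \<rho> else 0))"
    by (rule sum.cong) auto
  also have "\<dots> = real CARD('n) / \<rho> + (\<Sum>i | P i. \<rho> - 1 / \<rho>)"
    by (simp add: sum.distrib sum.If_cases)
  also have "(\<Sum>i | P i. \<rho> - 1 / \<rho>) \<le> \<rho> - 1 / \<rho>"
  proof -
    have "card {i. P i} \<le> 1"
      using assms(2) by (simp add: card_le_Suc0_iff_eq)
    then have "real (card {i. P i}) * (\<rho> - 1 / \<rho>) \<le> 1 * (\<rho> - 1 / \<rho>)"
      using r1 by (intro mult_right_mono) auto
    then show ?thesis by simp
  qed
  also have "real CARD('n) / \<rho> + (\<rho> - 1 / \<rho>) = 2 * \<rho>"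
    using \<rho> by (simp add: field_simps)
  finally show ?thesis unfolding \<rho>_def by simp
qed

lemma norm_sum_sq_weighted:
  fixes a :: "'l \<Rightarrow> complex" and t :: "'l \<Rightarrow> real"
  assumes "\<And>l. t l > 0"
  shows "(cmod (\<Sum>l\<in>A. a l))\<^sup>2 \<le> (\<Sum>l\<in>A. 1 / t l) * (\<Sum>l\<in>A. t l * (cmod (a l))\<^sup>2)"
proof -
  have "cmod (\<Sum>l\<in>A. a l) \<le> (\<Sum>l\<in>A. (1 / sqrt (t l)) * (sqrt (t l) * cmod (a l)))"
    using assms by (intro order_trans[OF norm_sum] sum_mono) (simp add: less_imp_neq[symmetric])
  then have "(cmod (\<Sum>l\<in>A. a l))\<^sup>2 \<le> (\<Sum>l\<in>A. (1 / sqrt (t l)) * (sqrt (t l) * cmod (a l)))\<^sup>2"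
    by (rule power_mono) simp
  also have "\<dots> \<le> (\<Sum>l\<in>A. (1 / sqrt (t l))\<^sup>2) * (\<Sum>l\<in>A. (sqrt (t l) * cmod (a l))\<^sup>2)"
    by (rule Cauchy_Schwarz_ineq_sum)
  finally show ?thesis
    using assms by (simp add: power_divide power_mult_distrib less_imp_le)
qed

text \<open>Schur's test on the \<open>n\<close>-regular bipartite forest with edges \<open>(w, g\<^sub>i w)\<close>, where an edge is weighted
  according to whether it leads towards or away from the root of its tree. The number
  \<open>2 \<surd>(n - 1)\<close> is the norm of the adjacency operator of that forest.\<close>

lemma left_regular_sum_bound:
  fixes h :: "nat \<Rightarrow> 'n::finite free_group ell2" and s :: "'n \<Rightarrow> nat \<Rightarrow> nat"
  assumes n: "CARD('n) \<ge> 2" and s: "\<And>l. s l permutes {..<N}"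
  shows "(\<Sum>i<N. (norm (\<Sum>l\<in>UNIV. translate (free_gen l) (h (inv (s l) i))))\<^sup>2)
    \<le> (2 * sqrt (real CARD('n) - 1))\<^sup>2 * (\<Sum>j<N. (norm (h j))\<^sup>2)"
proof -
  define \<rho> where "\<rho> = sqrt (real CARD('n) - 1)"
  have \<rho>: "\<rho> > 0" using n by (simp add: \<rho>_def)
  \<comment> \<open>Weight of the edge from w to g_l w; it is large when the edge leads towards the
    root, which happens for at most one l at each w.\<close>
  define t where "t l w = (if starts_with (l, False) w then \<rho> else 1 / \<rho>)" for l :: 'n and w
  have t_pos: "t l w > 0" for l w using \<rho> by (simp add: t_def)
  have A: "(\<Sum>l\<in>UNIV. t l w) \<le> 2 * \<rho>" for w
    unfolding t_def \<rho>_def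
    by (rule sum_one_large_weight_le[OF n]) (use starts_with_unique in blast)
  \<comment> \<open>Seen from the other end of the edge, the inverse weights have the same shape, so
    the same bound applies at both ends.\<close>
  have t_inv: "1 / t l (- free_gen l + v) = (if starts_with (l, True) v then \<rho> else 1 / \<rho>)" for l v
    by (simp add: t_def starts_with_uminus_free_gen_add)
  have B: "(\<Sum>l\<in>UNIV. 1 / t l (- free_gen l + v)) \<le> 2 * \<rho>" for v
    unfolding t_inv \<rho>_def
    by (rule sum_one_large_weight_le[OF n]) (use starts_with_unique in blast)
  define f where "f l j w = t l w * (cmod (ell2_coord (h j) w))\<^sup>2" for l j w
  define \<Sigma> where "\<Sigma> l j = infsum (f l j) UNIV" for l j
  have sf: "(f l j has_sum \<Sigma> l j) UNIV" for l j
  proof -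
    have "f l j summable_on UNIV"
    proof (rule summable_on_comparison_test)
      show "(\<lambda>w. 2 * \<rho> * (cmod (ell2_coord (h j) w))\<^sup>2) summable_on UNIV"
        by (rule has_sum_imp_summable[OF has_sum_cmult_right[OF has_sum_norm_ell2]])
      show "f l j w \<le> 2 * \<rho> * (cmod (ell2_coord (h j) w))\<^sup>2" for w
      proof -
        have "t l w \<le> (\<Sum>l\<in>UNIV. t l w)"
          by (rule member_le_sum) (auto simp: t_pos less_imp_le)
        then show ?thesis using A[of w] by (simp add: f_def mult_right_mono)
      qed
    qed (simp add: f_def t_pos less_imp_le)
    then show ?thesis by (simp add: \<Sigma>_def)
  qed
  have sf': "((\<lambda>v. f l j (- free_gen l + v)) has_sum \<Sigma> l j) UNIV" for l j
    using sf[of l j] has_sum_reindex_bij_betw[OF bij_plus[of "- free_gen l"], of "f l j"] by simp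
  have "(\<Sum>i<N. (norm (\<Sum>l\<in>UNIV. translate (free_gen l) (h (inv (s l) i))))\<^sup>2)
      \<le> 2 * \<rho> * (\<Sum>i<N. \<Sum>l\<in>UNIV. \<Sigma> l (inv (s l) i))"
  proof (rule has_sum_mono)
    let ?x = "\<lambda>i. \<Sum>l\<in>UNIV. translate (free_gen l) (h (inv (s l) i))"
    show "((\<lambda>v. \<Sum>i<N. (cmod (ell2_coord (?x i) v))\<^sup>2) has_sum (\<Sum>i<N. (norm (?x i))\<^sup>2)) UNIV"
      by (intro has_sum_finite_sum has_sum_norm_ell2) simp
    show "((\<lambda>v. 2 * \<rho> * (\<Sum>i<N. \<Sum>l\<in>UNIV. f l (inv (s l) i) (- free_gen l + v))) has_sum
        2 * \<rho> * (\<Sum>i<N. \<Sum>l\<in>UNIV. \<Sigma> l (inv (s l) i))) UNIV"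
      by (intro has_sum_cmult_right has_sum_finite_sum sf') auto
    show "(\<Sum>i<N. (cmod (ell2_coord (?x i) v))\<^sup>2)
        \<le> 2 * \<rho> * (\<Sum>i<N. \<Sum>l\<in>UNIV. f l (inv (s l) i) (- free_gen l + v))" for v
      unfolding sum_distrib_left[of "2 * \<rho>" _ "{..<N}"]
    proof (rule sum_mono)
      fix i
      let ?a = "\<lambda>l. ell2_coord (h (inv (s l) i)) (- free_gen l + v)"
      have "(cmod (ell2_coord (?x i) v))\<^sup>2 = (cmod (\<Sum>l\<in>UNIV. ?a l))\<^sup>2"
        by (simp add: translate.rep_eq)
      also have "\<dots> \<le> (\<Sum>l\<in>UNIV. 1 / t l (- free_gen l + v)) *
          (\<Sum>l\<in>UNIV. t l (- free_gen l + v) * (cmod (?a l))\<^sup>2)"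
        by (rule norm_sum_sq_weighted) (rule t_pos)
      also have "\<dots> \<le> 2 * \<rho> * (\<Sum>l\<in>UNIV. t l (- free_gen l + v) * (cmod (?a l))\<^sup>2)"
        by (intro mult_right_mono B sum_nonneg) (simp add: t_pos less_imp_le)
      finally show "(cmod (ell2_coord (?x i) v))\<^sup>2
          \<le> 2 * \<rho> * (\<Sum>l\<in>UNIV. f l (inv (s l) i) (- free_gen l + v))"
        by (simp add: f_def)
    qed
  qed
  \<comment> \<open>Permutations only relabel the blocks, so tensoring the generators with
    permutation matrices does not worsen the bound.\<close>
  also have "(\<Sum>i<N. \<Sum>l\<in>UNIV. \<Sigma> l (inv (s l) i)) = (\<Sum>j<N. \<Sum>l\<in>UNIV. \<Sigma> l j)"
  proof -
    have "(\<Sum>i<N. \<Sigma> l (inv (s l) i)) = (\<Sum>j<N. \<Sigma> l j)" for l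
      using sum.permute[OF permutes_inv[OF s[of l]], of "\<Sigma> l"] by (simp add: comp_def)
    then show ?thesis by (subst (1 2) sum.swap) simp
  qed
  also have "\<dots> \<le> (\<Sum>j<N. 2 * \<rho> * (norm (h j))\<^sup>2)"
  proof (rule sum_mono)
    fix j
    show "(\<Sum>l\<in>UNIV. \<Sigma> l j) \<le> 2 * \<rho> * (norm (h j))\<^sup>2"
    proof (rule has_sum_mono)
      show "((\<lambda>w. \<Sum>l\<in>UNIV. f l j w) has_sum (\<Sum>l\<in>UNIV. \<Sigma> l j)) UNIV"
        by (intro has_sum_finite_sum sf) simp
      show "((\<lambda>w. 2 * \<rho> * (cmod (ell2_coord (h j) w))\<^sup>2) has_sum 2 * \<rho> * (norm (h j))\<^sup>2) UNIV"
        by (intro has_sum_cmult_right has_sum_norm_ell2)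
      show "(\<Sum>l\<in>UNIV. f l j w) \<le> 2 * \<rho> * (cmod (ell2_coord (h j) w))\<^sup>2" for w
        unfolding f_def sum_distrib_right[symmetric] by (intro mult_right_mono A) simp
    qed
  qed
  finally have "(\<Sum>i<N. (norm (\<Sum>l\<in>UNIV. translate (free_gen l) (h (inv (s l) i))))\<^sup>2)
      \<le> 2 * \<rho> * (\<Sum>j<N. 2 * \<rho> * (norm (h j))\<^sup>2)"
    using \<rho> by simp
  also have "\<dots> = (2 * \<rho>)\<^sup>2 * (\<Sum>j<N. (norm (h j))\<^sup>2)"
    unfolding sum_distrib_left[symmetric] by (simp add: power2_eq_square)
  finally show ?thesis
    unfolding \<rho>_def .
qed

section \<open>Compact tuples\<close>

lemma coord_apply_finvec:
  assumes "complex_linear_op T"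
  shows "ell2_coord (blinfun_apply T (finvec F h)) b = (\<Sum>a\<in>F. ell2_coord (blinfun_apply T (ket a)) b * h a)"
  using assms by (simp add: finvec_def blinfun.sum_right complex_linear_op_def mult.commute)

lemma norm_trunc_sq: "(norm (trunc k x))\<^sup>2 = (\<Sum>a<k. (cmod (ell2_coord x a))\<^sup>2)"
  by (simp add: trunc_def norm_finvec nsq_def)

lemma trunc_scaleC: "trunc k (c *\<^sub>C x) = c *\<^sub>C trunc k x"
  by (rule ell2_eqI) simp

lemma trunc_sum: "trunc k (\<Sum>a\<in>A. f a) = (\<Sum>a\<in>A. trunc k (f a))"
  by (rule ell2_eqI) auto

lemma trunc_trunc [simp]: "trunc k (trunc k x) = trunc k x"
  by (rule ell2_eqI) simp

lemma nsq_Times_swap: "nsq (A \<times> X) h = (\<Sum>x\<in>X. nsq A (\<lambda>a. h (a, x)))"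
  by (subst nsq_Times, unfold nsq_def, rule sum.swap)

lemma mulv_Times: "mulv (A \<times> X) M h u = (\<Sum>a\<in>A. \<Sum>x\<in>X. M u (a, x) * h (a, x))"
  by (simp add: mulv_def sum.cartesian_product)

lemma L2_set_norm_add_le:
  fixes a b :: "'i \<Rightarrow> 'v::real_normed_vector"
  shows "L2_set (\<lambda>i. norm (a i + b i)) I \<le> L2_set (\<lambda>i. norm (a i)) I + L2_set (\<lambda>i. norm (b i)) I"
  by (rule order_trans[OF L2_set_mono L2_set_triangle_ineq]) (auto simp: norm_triangle_ineq)

lemma L2_set_norm_sum_le:
  fixes a :: "'l \<Rightarrow> 'i \<Rightarrow> 'v::real_normed_vector"
  assumes "finite A"
  shows "L2_set (\<lambda>i. norm (\<Sum>l\<in>A. a l i)) I \<le> (\<Sum>l\<in>A. L2_set (\<lambda>i. norm (a l i)) I)"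
  using assms
proof (induction A rule: finite_induct)
  case (insert l A)
  then show ?case
    using L2_set_norm_add_le[of "a l" "\<lambda>i. \<Sum>l\<in>A. a l i" I] by simp
qed (simp add: L2_set_def)

lemma L2_set_norm_le_iff:
  assumes "K \<ge> 0"
  shows "L2_set (\<lambda>i. norm (x i)) I \<le> K * L2_set (\<lambda>j. norm (y j)) J \<longleftrightarrow>
    (\<Sum>i\<in>I. (norm (x i))\<^sup>2) \<le> K\<^sup>2 * (\<Sum>j\<in>J. (norm (y j))\<^sup>2)"
proof -
  have "K * L2_set (\<lambda>j. norm (y j)) J = sqrt (K\<^sup>2 * (\<Sum>j\<in>J. (norm (y j))\<^sup>2))"
    using assms by (simp add: L2_set_def real_sqrt_mult)
  then show ?thesis by (simp add: L2_set_def)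
qed

text \<open>Write U_l for the permutation matrix of \<open>s l\<close>; then
  \<open>q (inv (s l) i) j\<close> is the (i, j) entry of U_l q. In the final constant, C +
  \<epsilon> comes from the truncated tuple and each generator adds a truncation error \<epsilon>.
  The size k of the truncation is fixed before N is chosen, as the matrix result requires.\<close>

lemma compact_tuple_finite_dimensional_bound:
  fixes T :: "'n::finite \<Rightarrow> nat ell2_op"
  assumes T: "\<And>l. compact_op (T l)" and C: "C \<ge> 0" and eps: "\<epsilon> > 0"
    and tree: "\<And>R (H :: 'n free_group \<Rightarrow> nat ell2).
      (\<Sum>v\<in>word_ball R. (norm (\<Sum>w\<in>word_ball R. \<Sum>l\<in>UNIV. of_bool (v = free_gen l + w) *\<^sub>C T l (H w)))\<^sup>2)
      \<le> C\<^sup>2 * (\<Sum>w\<in>word_ball R. (norm (H w))\<^sup>2)"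
  shows "\<exists>(N::nat) (s :: 'n \<Rightarrow> nat \<Rightarrow> nat) q. N > 0 \<and> (\<forall>l. s l permutes {..<N}) \<and>
    is_proj {..<N} q \<and> Re (\<Sum>x<N. q x x) \<ge> (1 - \<epsilon>) * real N \<and>
    (\<forall>h. (\<Sum>i<N. (norm (\<Sum>j<N. \<Sum>l\<in>UNIV. q (inv (s l) i) j *\<^sub>C T l (h j)))\<^sup>2)
      \<le> (C + \<epsilon> + real CARD('n) * \<epsilon>)\<^sup>2 * (\<Sum>j<N. (norm (h j))\<^sup>2))"
proof -
  have lin: "complex_linear_op (T l)" for l
    using T[of l] by (simp add: compact_op_def)
  have "\<exists>k0. \<forall>k\<ge>k0. \<forall>x. norm (T l x - trunc k (T l (trunc k x))) \<le> \<epsilon> * norm x" for l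
    by (rule compact_op_trunc[OF T eps])
  then obtain k0 where k0: "\<And>l k x. k \<ge> k0 l \<Longrightarrow> norm (T l x - trunc k (T l (trunc k x))) \<le> \<epsilon> * norm x"
    by metis
  \<comment> \<open>One truncation size for all of the finitely many generators.\<close>
  define k where "k = Max (range k0)"
  have k: "norm (T l x - trunc k (T l (trunc k x))) \<le> \<epsilon> * norm x" for l x
    by (rule k0) (simp add: k_def)
  define t where "t l b a = ell2_coord (T l (ket a)) b" for l b a
  have coordT: "ell2_coord (T l (trunc k x)) b = (\<Sum>a<k. t l b a * ell2_coord x a)" for l x b
    unfolding trunc_def t_def by (rule coord_apply_finvec[OF lin])
  have "nsq ({..<k} \<times> word_ball R) (mulv ({..<k} \<times> word_ball R)
      (\<lambda>(b, v) (a, w). \<Sum>l\<in>UNIV. t l b a * of_bool (v = free_gen l + w)) h)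
      \<le> C\<^sup>2 * nsq ({..<k} \<times> word_ball R) h" for R and h :: "nat \<times> 'n free_group \<Rightarrow> complex"
  proof -
    let ?B = "word_ball R :: 'n free_group set"
    define H where "H w = finvec {..<k} (\<lambda>a. h (a, w))" for w
    define y where "y v = (\<Sum>w\<in>?B. \<Sum>l\<in>UNIV. of_bool (v = free_gen l + w) *\<^sub>C T l (H w))" for v
    have "ell2_coord (T l (H w)) b = (\<Sum>a<k. t l b a * h (a, w))" for l w b
      unfolding H_def t_def by (rule coord_apply_finvec[OF lin])
    then have "ell2_coord (y v) b = (\<Sum>w\<in>?B. \<Sum>l\<in>UNIV. \<Sum>a<k. of_bool (v = free_gen l + w) * (t l b a * h (a, w)))"
      for v b
      by (simp add: y_def sum_distrib_left)
    also have "\<dots> v b = (\<Sum>w\<in>?B. \<Sum>a<k. (\<Sum>l\<in>UNIV. t l b a * of_bool (v = free_gen l + w)) * h (a, w))" for v b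
      by (rule sum.cong[OF refl], subst sum.swap, simp only: sum_distrib_right, intro sum.cong refl)
         (simp only: mult_ac)
    also have "\<dots> v b = mulv ({..<k} \<times> ?B) (\<lambda>(b, v) (a, w). \<Sum>l\<in>UNIV. t l b a * of_bool (v = free_gen l + w)) h (b, v)" for v b
      unfolding mulv_def by (subst sum.swap) (simp add: sum.cartesian_product case_prod_unfold)
    finally have "nsq ({..<k} \<times> ?B) (mulv ({..<k} \<times> ?B)
        (\<lambda>(b, v) (a, w). \<Sum>l\<in>UNIV. t l b a * of_bool (v = free_gen l + w)) h) =
        (\<Sum>v\<in>?B. \<Sum>b<k. (cmod (ell2_coord (y v) b))\<^sup>2)"
      unfolding nsq_Times_swap by (simp add: nsq_def)
    also have "\<dots> \<le> (\<Sum>v\<in>?B. (norm (y v))\<^sup>2)"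
      by (intro sum_mono sum_coord_le_norm) simp
    also have "\<dots> \<le> C\<^sup>2 * (\<Sum>w\<in>?B. (norm (H w))\<^sup>2)"
      unfolding y_def by (rule tree)
    also have "(\<Sum>w\<in>?B. (norm (H w))\<^sup>2) = nsq ({..<k} \<times> ?B) h"
      unfolding nsq_Times_swap by (simp add: H_def norm_finvec nsq_def)
    finally show ?thesis .
  qed
  then obtain N and s :: "'n \<Rightarrow> nat \<Rightarrow> nat" and q where N: "N > 0" and s: "\<And>l. s l permutes {..<N}"
    and q: "is_proj {..<N} q" "Re (\<Sum>x<N. q x x) \<ge> (1 - \<epsilon>) * real N"
    and bound: "\<And>h. nsq ({..<k} \<times> {..<N}) (mulv ({..<k} \<times> {..<N})
      (\<lambda>(b, y) (a, x). \<Sum>l\<in>UNIV. t l b a * of_bool (y = s l x)) (ampl {..<N} q h))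
      \<le> (C + \<epsilon>)\<^sup>2 * nsq ({..<k} \<times> {..<N}) h"
    using exists_free_permutations_with_small_compression[of C "C + \<epsilon>" \<epsilon> k t] C eps by auto
  have "(\<Sum>i<N. (norm (\<Sum>j<N. \<Sum>l\<in>UNIV. q (inv (s l) i) j *\<^sub>C T l (h j)))\<^sup>2)
      \<le> (C + \<epsilon> + real CARD('n) * \<epsilon>)\<^sup>2 * (\<Sum>j<N. (norm (h j))\<^sup>2)" for h
  proof -
    define L where "L = L2_set (\<lambda>j. norm (h j)) {..<N}"
    define y' where "y' i = (\<Sum>j<N. \<Sum>l\<in>UNIV. q (inv (s l) i) j *\<^sub>C trunc k (T l (trunc k (h j))))" for i
    define z where "z l i = (\<Sum>j<N. q (inv (s l) i) j *\<^sub>C (T l (h j) - trunc k (T l (trunc k (h j)))))" for l i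
    have split: "(\<Sum>j<N. \<Sum>l\<in>UNIV. q (inv (s l) i) j *\<^sub>C T l (h j)) = y' i + (\<Sum>l\<in>UNIV. z l i)" for i
    proof -
      have "(\<Sum>l\<in>UNIV. z l i) = (\<Sum>j<N. \<Sum>l\<in>UNIV. q (inv (s l) i) j *\<^sub>C (T l (h j) - trunc k (T l (trunc k (h j)))))"
        unfolding z_def by (rule sum.swap)
      then show ?thesis
        by (simp add: y'_def sum.distrib[symmetric] scaleC_add_right[symmetric])
    qed
    \<comment> \<open>U_l q is a contraction and remains one after tensoring with the identity, so
      it does not enlarge the truncation error.\<close>
    have "L2_set (\<lambda>i. norm (z l i)) {..<N} \<le> \<epsilon> * L" for l
      unfolding L_def
    proof (subst L2_set_norm_le_iff)
      let ?d = "\<lambda>j. T l (h j) - trunc k (T l (trunc k (h j)))"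
      have "(\<Sum>i<N. (norm (z l i))\<^sup>2) = (\<Sum>i<N. (norm (\<Sum>j<N. q i j *\<^sub>C ?d j))\<^sup>2)"
        using sum.permute[OF permutes_inv[OF s[of l]], of "\<lambda>i. (norm (\<Sum>j<N. q i j *\<^sub>C ?d j))\<^sup>2"]
        by (simp add: z_def comp_def)
      also have "\<dots> \<le> 1 * (\<Sum>j<N. (norm (?d j))\<^sup>2)"
        by (rule ell2_matrix_bound) (use nsq_proj_le[OF q(1)] in auto)
      also have "\<dots> \<le> 1 * (\<Sum>j<N. (\<epsilon> * norm (h j))\<^sup>2)"
        using k by (intro mult_left_mono sum_mono power_mono) auto
      finally show "(\<Sum>i<N. (norm (z l i))\<^sup>2) \<le> \<epsilon>\<^sup>2 * (\<Sum>j<N. (norm (h j))\<^sup>2)"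
        by (simp add: power_mult_distrib sum_distrib_left)
    qed (use eps in simp)
    then have "(\<Sum>l\<in>UNIV. L2_set (\<lambda>i. norm (z l i)) {..<N}) \<le> (\<Sum>l\<in>(UNIV :: 'n set). \<epsilon> * L)"
      by (rule sum_mono)
    then have 1: "L2_set (\<lambda>i. norm (\<Sum>l\<in>UNIV. z l i)) {..<N} \<le> real CARD('n) * \<epsilon> * L"
      using L2_set_norm_sum_le[of UNIV z "{..<N}"] by simp
    have 2: "L2_set (\<lambda>i. norm (y' i)) {..<N} \<le> (C + \<epsilon>) * L"
      unfolding L_def
    proof (subst L2_set_norm_le_iff)
      define f where "f = (\<lambda>(a, j). ell2_coord (h j) a)"
      \<comment> \<open>The right hand side is the sum of t_l \<otimes> U_l composed with 1
        \<otimes> q; the condition i = s l x selects the row \<open>inv (s l) i\<close> of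
        q.\<close>
      have coord: "ell2_coord (y' i) b = mulv ({..<k} \<times> {..<N})
          (\<lambda>(b, y) (a, x). \<Sum>l\<in>UNIV. t l b a * of_bool (y = s l x)) (ampl {..<N} q f) (b, i)"
        if "i < N" "b < k" for i b
      proof -
        have inv: "i = s l x \<longleftrightarrow> inv (s l) i = x" for l x
          using permutes_inv_eq[OF s[of l]] by metis
        have "mulv ({..<k} \<times> {..<N})
          (\<lambda>(b, y) (a, x). \<Sum>l\<in>UNIV. t l b a * of_bool (y = s l x)) (ampl {..<N} q f) (b, i) =
          (\<Sum>a<k. \<Sum>x<N. \<Sum>l\<in>UNIV. if inv (s l) i = x then t l b a * (\<Sum>j<N. q x j * ell2_coord (h j) a) else 0)"
        proof -
          have "(\<Sum>l\<in>UNIV. t l b a * of_bool (i = s l x)) * (\<Sum>j<N. q x j * ell2_coord (h j) a) =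
              (\<Sum>l\<in>UNIV. if inv (s l) i = x then t l b a * (\<Sum>j<N. q x j * ell2_coord (h j) a) else 0)" for a x
            unfolding sum_distrib_right[of _ UNIV] inv by (rule sum.cong) auto
          then show ?thesis
            unfolding mulv_Times ampl_def f_def by (simp add: mulv_def)
        qed
        also have "\<dots> = (\<Sum>a<k. \<Sum>l\<in>UNIV. \<Sum>x<N. if inv (s l) i = x then t l b a * (\<Sum>j<N. q x j * ell2_coord (h j) a) else 0)"
          by (rule sum.cong[OF refl], rule sum.swap)
        also have "\<dots> = (\<Sum>a<k. \<Sum>l\<in>UNIV. t l b a * (\<Sum>j<N. q (inv (s l) i) j * ell2_coord (h j) a))"
          using permutes_in_image[OF permutes_inv[OF s], of _ i] \<open>i < N\<close> by simp
        also have "\<dots> = (\<Sum>j<N. \<Sum>l\<in>UNIV. q (inv (s l) i) j * (\<Sum>a<k. t l b a * ell2_coord (h j) a))"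
          unfolding sum_distrib_left
          by (subst sum.swap, subst (2) sum.swap, subst sum.swap) (simp add: mult_ac)
        also have "\<dots> = ell2_coord (y' i) b"
          using that by (simp add: y'_def coordT)
        finally show ?thesis ..
      qed
      have "trunc k (y' i) = y' i" for i
        by (simp add: y'_def trunc_sum trunc_scaleC)
      then have "(\<Sum>i<N. (norm (y' i))\<^sup>2) = (\<Sum>i<N. \<Sum>b<k. (cmod (ell2_coord (y' i) b))\<^sup>2)"
        using norm_trunc_sq[of k "y' _"] by simp
      also have "\<dots> = nsq ({..<k} \<times> {..<N}) (mulv ({..<k} \<times> {..<N})
          (\<lambda>(b, y) (a, x). \<Sum>l\<in>UNIV. t l b a * of_bool (y = s l x)) (ampl {..<N} q f))"
        unfolding nsq_Times_swap by (simp add: nsq_def coord)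
      also have "\<dots> \<le> (C + \<epsilon>)\<^sup>2 * nsq ({..<k} \<times> {..<N}) f"
        by (rule bound)
      also have "nsq ({..<k} \<times> {..<N}) f = (\<Sum>j<N. \<Sum>a<k. (cmod (ell2_coord (h j) a))\<^sup>2)"
        unfolding nsq_Times_swap by (simp add: nsq_def f_def)
      also have "(C + \<epsilon>)\<^sup>2 * \<dots> \<le> (C + \<epsilon>)\<^sup>2 * (\<Sum>j<N. (norm (h j))\<^sup>2)"
        by (intro mult_left_mono sum_mono sum_coord_le_norm) auto
      finally show "(\<Sum>i<N. (norm (y' i))\<^sup>2) \<le> (C + \<epsilon>)\<^sup>2 * (\<Sum>j<N. (norm (h j))\<^sup>2)" .
    qed (use C eps in simp)
    have "L2_set (\<lambda>i. norm (\<Sum>j<N. \<Sum>l\<in>UNIV. q (inv (s l) i) j *\<^sub>C T l (h j))) {..<N}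
        \<le> (C + \<epsilon> + real CARD('n) * \<epsilon>) * L"
      unfolding split
      using L2_set_norm_add_le[of y' "\<lambda>i. \<Sum>l\<in>UNIV. z l i" "{..<N}"] 1 2
      by (simp add: distrib_right)
    then show ?thesis
      unfolding L_def by (subst (asm) L2_set_norm_le_iff) (use C eps in auto)
  qed
  then show ?thesis
    using N s q by (intro exI[of _ N] exI[of _ s] exI[of _ q]) simp
qed

section \<open>Operator spaces\<close>

text \<open>This and the next lemma trade the extended-real supremum over the unit ball for a
  homogeneous quadratic inequality over all families of vectors.\<close>

lemma os_norm_concrete_leI:
  assumes "c \<ge> 0"
    and "\<And>h. (\<Sum>i<n. (norm (\<Sum>j<n. blinfun_apply (X i j) (h j)))\<^sup>2) \<le> c\<^sup>2 * (\<Sum>j<n. (norm (h j))\<^sup>2)"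
  shows "os_norm (concrete_opspace S) n X \<le> ennreal c"
  unfolding concrete_opspace_def opspace.simps
proof (rule SUP_least, rule ennreal_leI)
  fix h :: "nat \<Rightarrow> 'a ell2" assume "h \<in> {h. (\<Sum>j<n. (norm (h j))\<^sup>2) \<le> 1}"
  then have "c\<^sup>2 * (\<Sum>j<n. (norm (h j))\<^sup>2) \<le> c\<^sup>2 * 1"
    by (intro mult_left_mono) auto
  then have "(\<Sum>i<n. (norm (\<Sum>j<n. blinfun_apply (X i j) (h j)))\<^sup>2) \<le> c\<^sup>2"
    using assms(2)[of h] by linarith
  then show "sqrt (\<Sum>i<n. (norm (\<Sum>j<n. blinfun_apply (X i j) (h j)))\<^sup>2) \<le> c"
    using assms(1) by (simp add: real_le_lsqrt sum_nonneg)
qed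

lemma os_norm_concrete_leD:
  assumes "os_norm (concrete_opspace S) n X \<le> ennreal c" "c \<ge> 0"
  shows "(\<Sum>i<n. (norm (\<Sum>j<n. blinfun_apply (X i j) (h j)))\<^sup>2) \<le> c\<^sup>2 * (\<Sum>j<n. (norm (h j))\<^sup>2)"
proof (cases "(\<Sum>j<n. (norm (h j))\<^sup>2) = 0")
  case True
  then have "\<forall>j<n. h j = 0" by (simp add: sum_nonneg_eq_0_iff)
  then show ?thesis by (simp add: blinfun.zero_right)
next
  case False
  define L where "L = (\<Sum>j<n. (norm (h j))\<^sup>2)"
  have L: "L > 0" using False sum_nonneg[of "{..<n}" "\<lambda>j. (norm (h j))\<^sup>2"] by (simp add: L_def)
  define h' where "h' j = (1 / sqrt L) *\<^sub>R h j" for j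
  have h': "(\<Sum>j<n. (norm (h' j))\<^sup>2) = 1"
    using L by (simp add: h'_def power_mult_distrib power_divide sum_divide_distrib[symmetric])
       (simp add: L_def)
  have "ennreal (sqrt (\<Sum>i<n. (norm (\<Sum>j<n. blinfun_apply (X i j) (h' j)))\<^sup>2))
      \<le> os_norm (concrete_opspace S) n X"
    unfolding concrete_opspace_def opspace.simps by (rule SUP_upper) (simp add: h')
  then have "ennreal (sqrt (\<Sum>i<n. (norm (\<Sum>j<n. blinfun_apply (X i j) (h' j)))\<^sup>2)) \<le> ennreal c"
    using assms(1) by (rule order_trans)
  then have "sqrt (\<Sum>i<n. (norm (\<Sum>j<n. blinfun_apply (X i j) (h' j)))\<^sup>2) \<le> c"
    using assms(2) by simp
  then have "(\<Sum>i<n. (norm (\<Sum>j<n. blinfun_apply (X i j) (h' j)))\<^sup>2) \<le> c\<^sup>2"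
    by (rule sqrt_le_D)
  moreover have "(\<Sum>j<n. blinfun_apply (X i j) (h' j)) = (1 / sqrt L) *\<^sub>R (\<Sum>j<n. blinfun_apply (X i j) (h j))" for i
    by (simp add: h'_def blinfun.scaleR_right scaleR_sum_right)
  ultimately have "(\<Sum>i<n. (norm (\<Sum>j<n. blinfun_apply (X i j) (h j)))\<^sup>2 / L) \<le> c\<^sup>2"
    using L by (simp add: power_mult_distrib power_divide)
  then show ?thesis
    using L by (simp add: sum_divide_distrib[symmetric] pos_divide_le_eq L_def[symmetric])
qed

lemma os_norm_le_cb_norm:
  assumes "n \<ge> 1" "X \<in> os_mats E n" "os_norm E n X \<le> 1"
  shows "os_norm F n (\<lambda>i j. u (X i j)) \<le> cb_norm E F u"
  unfolding cb_norm_def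
  by (rule SUP_upper2[of n], use assms in simp, rule SUP_upper2[of X], use assms in simp_all)

lemma cb_norm_leI:
  assumes "\<And>n X. n \<ge> 1 \<Longrightarrow> X \<in> os_mats E n \<Longrightarrow> os_norm E n X \<le> 1 \<Longrightarrow> os_norm F n (\<lambda>i j. u (X i j)) \<le> K"
  shows "cb_norm E F u \<le> K"
  unfolding cb_norm_def by (intro SUP_least) (use assms in auto)

section \<open>The span of the generators and its coefficient functionals\<close>

definition gen_span :: "'n::finite free_group ell2_op set" where
  "gen_span = cop.span (range (\<lambda>i. left_regular (free_gen i)))"

lemma E_lambda_eq: "E_lambda TYPE('n::finite) = concrete_opspace (gen_span :: 'n free_group ell2_op set)"
  by (simp add: E_lambda_def gen_span_def)

lemma os_carrier_concrete [simp]: "os_carrier (concrete_opspace S) = S"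
  by (simp add: concrete_opspace_def)

lemma os_add_concrete [simp]: "os_add (concrete_opspace S) = (+)"
  by (simp add: concrete_opspace_def)

lemma os_scale_concrete [simp]: "os_scale (concrete_opspace S) = scaleC_op"
  by (simp add: concrete_opspace_def)

lemma os_add_dual [simp]: "os_add (os_dual E) = (\<lambda>\<phi> \<psi> x. \<phi> x + \<psi> x)"
  by (simp add: os_dual_def)

lemma os_scale_dual [simp]: "os_scale (os_dual E) = (\<lambda>c \<phi> x. c * \<phi> x)"
  by (simp add: os_dual_def)

lemma gen_span_induct [consumes 1, case_names base zero add scale]:
  assumes "T \<in> gen_span" "\<And>l. P (left_regular (free_gen l))" "P 0"
    "\<And>S T. P S \<Longrightarrow> P T \<Longrightarrow> P (S + T)" "\<And>c T. P T \<Longrightarrow> P (scaleC_op c T)"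
  shows "P T"
  using assms(1) unfolding gen_span_def
proof (rule cop.span_induct)
  show "cop.subspace (Collect P)"
    unfolding cop.subspace_def using assms by auto
qed (use assms in auto)

lemma complex_linear_gen_span: "T \<in> gen_span \<Longrightarrow> complex_linear_op T"
proof (induction T rule: gen_span_induct)
  case (base l)
  have "translate (free_gen l) (c *\<^sub>C x) = c *\<^sub>C translate (free_gen l) x" for c and x :: "'a free_group ell2"
    by (rule ell2_eqI) (simp add: translate.rep_eq)
  then show ?case by (simp add: complex_linear_op_def)
qed (auto simp: complex_linear_op_def blinfun.add_left scaleC_add_right scaleC_scaleC mult.commute
      intro!: ell2_eqI)

lemma free_gen_eq_iff [simp]: "free_gen i = free_gen j \<longleftrightarrow> i = j"
  by (metis Pair_inject free_gen.rep_eq list.inject)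

lemma coord_translate_ket: "ell2_coord (translate g (ket w)) v = of_bool (v = g + w)"
  by (auto simp: translate.rep_eq add.assoc[symmetric])

lemma norm_ket [simp]: "norm (ket w) = 1"
  using norm_finvec[of "{w}" "\<lambda>_. 1"] by (simp add: finvec_def nsq_def scaleC_one power2_eq_1_iff)
     (smt (verit) norm_ge_zero)

text \<open>Set to 0 off the span because elements of \<open>os_dual\<close> are normalised in that
  way.\<close>

definition matrix_coef :: "'n::finite free_group \<Rightarrow> 'n free_group \<Rightarrow> 'n free_group ell2_op \<Rightarrow> complex" where
  "matrix_coef v w T = (if T \<in> gen_span then ell2_coord (blinfun_apply T (ket w)) v else 0)"

text \<open>Since \<lambda>(g) sends the basis vector at the neutral element to the one at g, these
  functionals form the basis dual to the generators.\<close>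

abbreviation dual_gen :: "'n::finite \<Rightarrow> 'n free_group ell2_op \<Rightarrow> complex" where
  "dual_gen l \<equiv> matrix_coef (free_gen l) 0"

text \<open>The matrix with entries \<open>matrix_coef v w\<close> is the matrix of the tensor
  \<Sum> e_l \<otimes> \<lambda>(g_l) in the standard basis of the group; written through the dual
  basis, it can be mapped entrywise by a linear u.\<close>

lemma matrix_coef_eq_sum:
  "matrix_coef v w = (\<lambda>T. \<Sum>l\<in>UNIV. of_bool (v = free_gen l + w) * dual_gen l T)"
proof
  fix T :: "'a free_group ell2_op"
  have "ell2_coord (blinfun_apply T (ket w)) v =
      (\<Sum>l\<in>UNIV. of_bool (v = free_gen l + w) * ell2_coord (blinfun_apply T (ket 0)) (free_gen l))"
    if "T \<in> gen_span"
    using that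
  proof (induction T rule: gen_span_induct)
    case (base l')
    have "(\<Sum>l\<in>UNIV. of_bool (v = free_gen l + w) * ell2_coord (translate (free_gen l') (ket 0)) (free_gen l)) =
        (\<Sum>l\<in>UNIV. if l = l' then of_bool (v = free_gen l + w) else 0 :: complex)"
      by (rule sum.cong) (auto simp: coord_translate_ket)
    then show ?case by (simp add: coord_translate_ket)
  next
    case (add S T)
    then show ?case
      by (simp only: blinfun.add_left ell2_coord_simps distrib_left sum.distrib)
  next
    case (scale c T)
    then show ?case
      by (simp only: scaleC_op_apply ell2_coord_simps sum_distrib_left mult.left_commute)
  qed simp
  then show "matrix_coef v w T = (\<Sum>l\<in>UNIV. of_bool (v = free_gen l + w) * dual_gen l T)"
    unfolding matrix_coef_def by (cases "T \<in> gen_span") (simp_all only: if_True if_False, simp)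
qed

lemma norm_apply_le_of_os_norm:
  assumes "os_norm (concrete_opspace S) 1 (\<lambda>_ _. T) \<le> 1"
  shows "norm (blinfun_apply T x) \<le> norm x"
  by (rule power2_le_imp_le) (use os_norm_concrete_leD[of S 1 "\<lambda>_ _. T" 1 "\<lambda>_. x"] assms in simp_all)

lemma cmod_coord_le: "cmod (ell2_coord x i) \<le> norm x"
  by (rule power2_le_imp_le) (use sum_coord_le_norm[of "{i}" x] in simp_all)

lemma dual_gen_lincomb_in_dual:
  fixes A :: "'n::finite set"
  shows "(\<lambda>T. \<Sum>l\<in>A. c l * dual_gen l T) \<in> os_carrier (os_dual (E_lambda TYPE('n)))"
proof -
  define \<phi> where "\<phi> T = (\<Sum>l\<in>A. c l * dual_gen l T)" for T
  have "(SUP x\<in>{x \<in> gen_span. os_norm (concrete_opspace gen_span) 1 (\<lambda>_ _. x) \<le> 1}. ennreal (cmod (\<phi> x)))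
      \<le> ennreal (\<Sum>l\<in>A. cmod (c l))"
  proof (rule SUP_least, rule ennreal_leI)
    fix x :: "'n free_group ell2_op"
    assume x: "x \<in> {x \<in> gen_span. os_norm (concrete_opspace gen_span) 1 (\<lambda>_ _. x) \<le> 1}"
    have "cmod (dual_gen l x) \<le> 1" for l
      using x norm_apply_le_of_os_norm[of gen_span x "ket 0"]
        cmod_coord_le[of "blinfun_apply x (ket 0)" "free_gen l"] by (auto simp: matrix_coef_def)
    then have "cmod (c l) * cmod (dual_gen l x) \<le> cmod (c l) * 1" for l
      by (rule mult_left_mono) simp
    then show "cmod (\<phi> x) \<le> (\<Sum>l\<in>A. cmod (c l))"
      unfolding \<phi>_def by (intro order_trans[OF norm_sum] sum_mono) (simp add: norm_mult)
  qed
  also have "\<dots> < \<infinity>" by simp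
  finally have "(SUP x\<in>{x \<in> gen_span. os_norm (concrete_opspace gen_span) 1 (\<lambda>_ _. x) \<le> 1}. ennreal (cmod (\<phi> x))) < \<infinity>" .
  moreover have "\<phi> (S + T) = \<phi> S + \<phi> T" if "S \<in> gen_span" "T \<in> gen_span" for S T
  proof -
    have "S + T \<in> gen_span" using that by (simp add: gen_span_def cop.span_add)
    then show ?thesis
      using that by (simp add: \<phi>_def matrix_coef_def blinfun.add_left distrib_left sum.distrib)
  qed
  moreover have "\<phi> (scaleC_op a T) = a * \<phi> T" if "T \<in> gen_span" for a T
  proof -
    have "scaleC_op a T \<in> gen_span" using that by (simp add: gen_span_def cop.span_scale)
    then show ?thesis
      using that by (simp add: \<phi>_def matrix_coef_def sum_distrib_left mult.left_commute)
  qed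
  moreover have "\<phi> T = 0" if "T \<notin> gen_span" for T
    using that by (simp add: \<phi>_def matrix_coef_def)
  ultimately have "\<phi> \<in> os_carrier (os_dual (E_lambda TYPE('n)))"
    by (simp add: os_dual_def E_lambda_eq)
  then show ?thesis unfolding \<phi>_def .
qed

lemma dual_gen_in_dual: "dual_gen (l :: 'n::finite) \<in> os_carrier (os_dual (E_lambda TYPE('n)))"
proof -
  have "dual_gen l = (\<lambda>T. \<Sum>l\<in>{l}. 1 * dual_gen l T)" by simp
  then show ?thesis
    using dual_gen_lincomb_in_dual[of "\<lambda>_. 1" "{l}"] by simp
qed

lemma os_linear_dual_gen_lincomb:
  fixes u :: "('n::finite free_group ell2_op \<Rightarrow> complex) \<Rightarrow> 'i ell2_op" and A :: "'n set"
  assumes u: "os_linear (os_dual (E_lambda TYPE('n))) (concrete_opspace S) u"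
  shows "u (\<lambda>T. \<Sum>l\<in>A. c l * dual_gen l T) = (\<Sum>l\<in>A. scaleC_op (c l) (u (dual_gen l)))"
proof -
  have add: "u (\<lambda>T. \<phi> T + \<psi> T) = u \<phi> + u \<psi>" and scale: "u (\<lambda>T. a * \<phi> T) = scaleC_op a (u \<phi>)"
    if "\<phi> \<in> os_carrier (os_dual (E_lambda TYPE('n)))" "\<psi> \<in> os_carrier (os_dual (E_lambda TYPE('n)))" for \<phi> \<psi> a
    using u that by (simp_all add: os_linear_def)
  have fin: "finite A" by simp
  show ?thesis
    using fin
  proof (induction A rule: finite_induct)
    case empty
    have "u (\<lambda>T. 0 * dual_gen undefined T) = scaleC_op 0 (u (dual_gen undefined))"
      by (rule scale) (rule dual_gen_in_dual)+
    then show ?case by simp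
  next
    case (insert l A)
    have "(\<lambda>T. c l * dual_gen l T) \<in> os_carrier (os_dual (E_lambda TYPE('n)))"
      using dual_gen_lincomb_in_dual[of c "{l}"] by simp
    then have "u (\<lambda>T. c l * dual_gen l T + (\<Sum>l\<in>A. c l * dual_gen l T)) =
        u (\<lambda>T. c l * dual_gen l T) + u (\<lambda>T. \<Sum>l\<in>A. c l * dual_gen l T)"
      by (rule add) (rule dual_gen_lincomb_in_dual)
    then show ?case
      using insert scale[OF dual_gen_in_dual dual_gen_in_dual, of "c l" l] by simp
  qed
qed

section \<open>Matrices of functionals and the two completely bounded norms\<close>

lemma scaleC_of_bool: "of_bool P *\<^sub>C x = (if P then x else 0)"
  by (rule ell2_eqI) simp

lemma norm_sum_ket:
  assumes "finite A" "inj_on b A"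
  shows "(norm (\<Sum>q\<in>A. c q *\<^sub>C ket (b q)))\<^sup>2 = (\<Sum>q\<in>A. (cmod (c q))\<^sup>2)"
proof -
  have "(\<Sum>q\<in>A. c q *\<^sub>C ket (b q)) = finvec (b ` A) (c \<circ> the_inv_into A b)"
    unfolding finvec_def sum.reindex[OF assms(2)]
    by (rule sum.cong) (simp_all add: the_inv_into_f_f[OF assms(2)])
  then show ?thesis
    using assms by (simp add: norm_finvec nsq_def sum.reindex the_inv_into_f_f)
qed

lemma os_norm_dual: "os_norm (os_dual E) m \<Phi> =
    cb_norm E (matrix_opspace m) (\<lambda>x p q. if p < m \<and> q < m then \<Phi> p q x else 0)"
  by (simp add: os_dual_def)

lemma os_norm_matrix: "os_norm (matrix_opspace m) n X =
    (SUP h \<in> {h :: nat \<Rightarrow> nat \<Rightarrow> complex. (\<Sum>j<n. \<Sum>q<m. (cmod (h j q))\<^sup>2) \<le> 1}.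
        ennreal (sqrt (\<Sum>i<n. \<Sum>p<m. (cmod (\<Sum>j<n. \<Sum>q<m. X i j p q * h j q))\<^sup>2)))"
  by (simp add: matrix_opspace_def)

text \<open>Under the definition of the dual norm, this matrix of functionals is the map sending T
  to its compression to the span of the basis vectors at the points \<open>b i\<close>, and
  compressions are completely contractive.\<close>

lemma os_norm_dual_compression:
  assumes b: "inj_on b {..<N}"
  shows "os_norm (os_dual (E_lambda TYPE('n::finite))) N
    (\<lambda>i j. matrix_coef (b i :: 'n free_group) (b j)) \<le> 1"
  unfolding os_norm_dual
proof (rule cb_norm_leI)
  fix n and X :: "nat \<Rightarrow> nat \<Rightarrow> 'n free_group ell2_op"
  assume X: "X \<in> os_mats (E_lambda TYPE('n)) n" "os_norm (E_lambda TYPE('n)) n X \<le> 1"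
  have Xin: "X i j \<in> gen_span" if "i < n" "j < n" for i j
    using X(1) that by (simp add: os_mats_def E_lambda_eq)
  show "os_norm (matrix_opspace N) n
      (\<lambda>i j p q. if p < N \<and> q < N then matrix_coef (b p) (b q) (X i j) else 0) \<le> 1"
    unfolding os_norm_matrix
  proof (rule SUP_least)
    fix h :: "nat \<Rightarrow> nat \<Rightarrow> complex"
    assume "h \<in> {h. (\<Sum>j<n. \<Sum>q<N. (cmod (h j q))\<^sup>2) \<le> 1}"
    then have h: "(\<Sum>j<n. \<Sum>q<N. (cmod (h j q))\<^sup>2) \<le> 1" by simp
    \<comment> \<open>Image of h under the isometry onto the span of the chosen basis vectors;
      injectivity of \<open>b\<close> makes it isometric.\<close>
    define H where "H j = (\<Sum>q<N. h j q *\<^sub>C ket (b q))" for j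
    have coord: "(\<Sum>j<n. \<Sum>q<N. (if p < N \<and> q < N then matrix_coef (b p) (b q) (X i j) else 0) * h j q) =
        ell2_coord (\<Sum>j<n. blinfun_apply (X i j) (H j)) (b p)" if ip: "i < n" "p < N" for i p
      unfolding ell2_coord_sum
    proof (rule sum.cong[OF refl])
      fix j assume "j \<in> {..<n}"
      then have "X i j \<in> gen_span" "complex_linear_op (X i j)"
        using Xin[of i j] ip complex_linear_gen_span by auto
      then show "(\<Sum>q<N. (if p < N \<and> q < N then matrix_coef (b p) (b q) (X i j) else 0) * h j q) =
          ell2_coord (blinfun_apply (X i j) (H j)) (b p)"
        using ip by (auto simp: H_def blinfun.sum_right complex_linear_op_def matrix_coef_def mult.commute
            intro!: sum.cong)
    qed
    have "(\<Sum>i<n. \<Sum>p<N. (cmod (\<Sum>j<n. \<Sum>q<N. (if p < N \<and> q < N then matrix_coef (b p) (b q) (X i j) else 0) * h j q))\<^sup>2)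
        = (\<Sum>i<n. \<Sum>p<N. (cmod (ell2_coord (\<Sum>j<n. blinfun_apply (X i j) (H j)) (b p)))\<^sup>2)"
      using coord by (intro sum.cong refl) simp
    also have "\<dots> \<le> (\<Sum>i<n. (norm (\<Sum>j<n. blinfun_apply (X i j) (H j)))\<^sup>2)"
    proof (rule sum_mono)
      fix i
      show "(\<Sum>p<N. (cmod (ell2_coord (\<Sum>j<n. blinfun_apply (X i j) (H j)) (b p)))\<^sup>2)
          \<le> (norm (\<Sum>j<n. blinfun_apply (X i j) (H j)))\<^sup>2"
        using sum_coord_le_norm[of "b ` {..<N}" "\<Sum>j<n. blinfun_apply (X i j) (H j)"]
        by (simp only: sum.reindex[OF b] comp_def finite_imageI finite_lessThan)
    qed
    also have "\<dots> \<le> 1\<^sup>2 * (\<Sum>j<n. (norm (H j))\<^sup>2)"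
      by (rule os_norm_concrete_leD[of gen_span]) (use X(2) in \<open>simp_all add: E_lambda_eq\<close>)
    also have "\<dots> \<le> 1"
      using h by (simp add: H_def norm_sum_ket b)
    finally show "ennreal (sqrt (\<Sum>i<n. \<Sum>p<N. (cmod (\<Sum>j<n. \<Sum>q<N.
        (if p < N \<and> q < N then matrix_coef (b p) (b q) (X i j) else 0) * h j q))\<^sup>2)) \<le> 1"
      by (simp only: ennreal_le_1 real_sqrt_le_1_iff)
  qed
qed

text \<open>Applying u entrywise to the contractive matrix of coefficient functionals on a ball
  yields the bound that \<open>compact_tuple_finite_dimensional_bound\<close> assumes. The ball is
  enumerated because matrices over operator spaces are indexed by numbers.\<close>

lemma tree_bound_of_cb_norm:
  fixes u :: "('n::finite free_group ell2_op \<Rightarrow> complex) \<Rightarrow> 'i ell2_op"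
    and H :: "'n free_group \<Rightarrow> 'i ell2"
  assumes u: "os_linear (os_dual (E_lambda TYPE('n))) (concrete_opspace S) u"
    and C: "cb_norm (os_dual (E_lambda TYPE('n))) (concrete_opspace S) u \<le> ennreal C" "C \<ge> 0"
  shows "(\<Sum>v\<in>word_ball R. (norm (\<Sum>w\<in>word_ball R. \<Sum>l\<in>UNIV.
      of_bool (v = free_gen l + w) *\<^sub>C blinfun_apply (u (dual_gen l)) (H w)))\<^sup>2)
      \<le> C\<^sup>2 * (\<Sum>w\<in>word_ball R. (norm (H w))\<^sup>2)"
proof -
  let ?B = "word_ball R :: 'n free_group set"
  define N where "N = card ?B"
  obtain b where b: "bij_betw b {..<N} ?B"
    using ex_bij_betw_nat_finite[of ?B] by (auto simp: N_def atLeast0LessThan)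
  have "?B \<noteq> {}" using zero_in_word_ball by blast
  then have N: "N \<ge> 1" using card_gt_0_iff[of ?B] by (simp add: N_def Suc_le_eq)
  have "matrix_coef v w \<in> os_carrier (os_dual (E_lambda TYPE('n)))" for v w :: "'n free_group"
    unfolding matrix_coef_eq_sum[of v w] by (rule dual_gen_lincomb_in_dual)
  then have "os_norm (concrete_opspace S) N (\<lambda>i j. u (matrix_coef (b i) (b j)))
      \<le> cb_norm (os_dual (E_lambda TYPE('n))) (concrete_opspace S) u"
    using b by (intro os_norm_le_cb_norm[OF N] os_norm_dual_compression)
      (auto simp: os_mats_def bij_betw_def)
  then have "os_norm (concrete_opspace S) N (\<lambda>i j. u (matrix_coef (b i) (b j))) \<le> ennreal C"
    using C(1) by (rule order_trans)
  from os_norm_concrete_leD[OF this C(2), of "\<lambda>j. H (b j)"]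
  have le: "(\<Sum>i<N. (norm (\<Sum>j<N. blinfun_apply (u (matrix_coef (b i) (b j))) (H (b j))))\<^sup>2)
      \<le> C\<^sup>2 * (\<Sum>j<N. (norm (H (b j)))\<^sup>2)" .
  define f where "f v w = (\<Sum>l\<in>UNIV. of_bool (v = free_gen l + w) *\<^sub>C blinfun_apply (u (dual_gen l)) (H w))" for v w
  have f: "f v w = blinfun_apply (u (matrix_coef v w)) (H w)" for v w
    unfolding f_def matrix_coef_eq_sum[of v w] os_linear_dual_gen_lincomb[OF u] blinfun.sum_left scaleC_op_apply ..
  have "(\<Sum>v\<in>?B. (norm (\<Sum>w\<in>?B. f v w))\<^sup>2) = (\<Sum>i<N. (norm (\<Sum>w\<in>?B. f (b i) w))\<^sup>2)"
    by (rule sum.reindex_bij_betw[OF b, symmetric])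
  also have "\<dots> = (\<Sum>i<N. (norm (\<Sum>j<N. f (b i) (b j)))\<^sup>2)"
    by (simp add: sum.reindex_bij_betw[OF b, of "f _"])
  also have "\<dots> \<le> C\<^sup>2 * (\<Sum>j<N. (norm (H (b j)))\<^sup>2)"
    unfolding f by (rule le)
  also have "(\<Sum>j<N. (norm (H (b j)))\<^sup>2) = (\<Sum>w\<in>?B. (norm (H w))\<^sup>2)"
    by (rule sum.reindex_bij_betw[OF b])
  finally show ?thesis unfolding f_def .
qed

text \<open>The inverse of u turns \<Sum> X_l \<otimes> u(e_l) into \<Sum> X_l \<otimes> e_l. The
  dual norm of the latter is the completely bounded norm of the map \<lambda>(g_l) \<mapsto> X_l,
  which is then tested on the contraction Z.\<close>

lemma os_norm_matrix_le_cb_norm_inverse: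
  fixes u :: "('n::finite free_group ell2_op \<Rightarrow> complex) \<Rightarrow> 'i ell2_op"
  assumes u: "os_linear (os_dual (E_lambda TYPE('n))) (concrete_opspace S) u"
    and bij: "bij_betw u (os_carrier (os_dual (E_lambda TYPE('n)))) S"
    and N: "N \<ge> 1" "N' \<ge> 1"
    and X: "os_norm (concrete_opspace S) N (\<lambda>i j. \<Sum>l\<in>UNIV. scaleC_op (X l i j) (u (dual_gen l))) \<le> 1"
    and Z: "\<And>i j. Z i j \<in> gen_span" "os_norm (concrete_opspace gen_span) N' Z \<le> 1"
  shows "os_norm (matrix_opspace N) N'
      (\<lambda>i j p q. if p < N \<and> q < N then \<Sum>l\<in>UNIV. X l p q * dual_gen l (Z i j) else 0)
    \<le> cb_norm (concrete_opspace S) (os_dual (E_lambda TYPE('n)))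
        (inv_into (os_carrier (os_dual (E_lambda TYPE('n)))) u)"
proof -
  let ?E = "E_lambda TYPE('n)"
  let ?v = "inv_into (os_carrier (os_dual ?E)) u"
  define Y where "Y i j = (\<Sum>l\<in>UNIV. scaleC_op (X l i j) (u (dual_gen l)))" for i j
  have Y: "Y i j = u (\<lambda>T. \<Sum>l\<in>UNIV. X l i j * dual_gen l T)" for i j
    unfolding Y_def by (rule os_linear_dual_gen_lincomb[OF u, symmetric])
  have vY: "?v (Y i j) = (\<lambda>T. \<Sum>l\<in>UNIV. X l i j * dual_gen l T)" for i j
    unfolding Y by (rule inv_into_f_f[OF bij_betw_imp_inj_on[OF bij] dual_gen_lincomb_in_dual])
  have "os_norm (matrix_opspace N) N'
      (\<lambda>i j p q. if p < N \<and> q < N then ?v (Y p q) (Z i j) else 0)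
    \<le> cb_norm ?E (matrix_opspace N) (\<lambda>x p q. if p < N \<and> q < N then ?v (Y p q) x else 0)"
    using Z by (intro os_norm_le_cb_norm[OF N(2)]) (auto simp: os_mats_def E_lambda_eq)
  also have "\<dots> = os_norm (os_dual ?E) N (\<lambda>p q. ?v (Y p q))"
    by (simp add: os_norm_dual)
  also have "\<dots> \<le> cb_norm (concrete_opspace S) (os_dual ?E) ?v"
  proof (rule os_norm_le_cb_norm[OF N(1)])
    show "Y \<in> os_mats (concrete_opspace S) N"
      using bij_betwE[OF bij, rule_format, OF dual_gen_lincomb_in_dual] by (simp add: os_mats_def Y)
    show "os_norm (concrete_opspace S) N Y \<le> 1"
      using X by (simp add: Y_def[abs_def])
  qed
  finally show ?thesis unfolding vY .
qed

lemma dual_gen_sum_left_regular: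
  "dual_gen l (\<Sum>l'\<in>UNIV. scaleC_op (c l') (left_regular (free_gen l'))) = c l"
proof -
  have "(\<Sum>l'\<in>UNIV. scaleC_op (c l') (left_regular (free_gen l'))) \<in> gen_span"
    unfolding gen_span_def by (intro cop.span_sum cop.span_scale cop.span_base) auto
  moreover have "(\<Sum>l'\<in>UNIV. c l' * of_bool (free_gen l = free_gen l' + 0)) = (\<Sum>l'\<in>UNIV. if l = l' then c l' else 0)"
    by (rule sum.cong) auto
  ultimately show ?thesis
    by (simp add: matrix_coef_def blinfun.sum_left coord_translate_ket del: sum_mult_of_bool_eq)
qed

lemma cb_norm_product_lower_bound:
  fixes u :: "('n::finite free_group ell2_op \<Rightarrow> complex) \<Rightarrow> nat ell2_op"
  assumes n: "CARD('n) \<ge> 2"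
    and S: "\<And>T. T \<in> S \<Longrightarrow> compact_op T"
    and u: "os_linear (os_dual (E_lambda TYPE('n))) (concrete_opspace S) u"
    and bij: "bij_betw u (os_carrier (os_dual (E_lambda TYPE('n)))) S"
    and C: "cb_norm (os_dual (E_lambda TYPE('n))) (concrete_opspace S) u \<le> ennreal C" "C \<ge> 0"
    and D: "cb_norm (concrete_opspace S) (os_dual (E_lambda TYPE('n)))
        (inv_into (os_carrier (os_dual (E_lambda TYPE('n)))) u) \<le> ennreal D" "D \<ge> 0"
  shows "real CARD('n) \<le> 2 * sqrt (real CARD('n) - 1) * (C * D)"
proof -
  let ?n = "real CARD('n)"
  define \<beta> where "\<beta> = 2 * sqrt (?n - 1)"
  have \<beta>: "\<beta> > 0" using n by (simp add: \<beta>_def)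
  define T where "T l = u (dual_gen l)" for l
  have T: "compact_op (T l)" for l
    using bij_betwE[OF bij] dual_gen_in_dual S by (auto simp: T_def)
  \<comment> \<open>The estimate with an error parameter, which tends to zero only at the end
    because N and q depend on it.\<close>
  have eps: "?n * (1 - \<epsilon>) \<le> \<beta> * D * (C + \<epsilon> + ?n * \<epsilon>)" if \<epsilon>: "\<epsilon> > 0" for \<epsilon>
  proof -
    define c where "c = C + \<epsilon> + ?n * \<epsilon>"
    have c: "c > 0" using \<epsilon> C(2) by (simp add: c_def add_nonneg_pos add_pos_nonneg)
    obtain N and s :: "'n \<Rightarrow> nat \<Rightarrow> nat" and q where N: "N > 0" and s: "\<And>l. s l permutes {..<N}"
      and q: "Re (\<Sum>x<N. q x x) \<ge> (1 - \<epsilon>) * real N"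
      and bound: "\<And>h. (\<Sum>i<N. (norm (\<Sum>j<N. \<Sum>l\<in>UNIV. q (inv (s l) i) j *\<^sub>C T l (h j)))\<^sup>2)
        \<le> c\<^sup>2 * (\<Sum>j<N. (norm (h j))\<^sup>2)"
      using compact_tuple_finite_dimensional_bound[OF T C(2) \<epsilon> tree_bound_of_cb_norm[OF u C, folded T_def]]
      unfolding c_def by blast
    \<comment> \<open>The matrix U_l q divided by c, which makes \<Sum> X_l \<otimes> T_l a
      contraction.\<close>
    define X where "X l i j = q (inv (s l) i) j / c" for l i j
    \<comment> \<open>The tensor \<Sum> \<lambda>(g_l) \<otimes> U_l divided by its norm bound
      \<beta>.\<close>
    define Z where "Z i j = (\<Sum>l\<in>UNIV. scaleC_op (of_bool (i = s l j) / complex_of_real \<beta>) (left_regular (free_gen l :: 'n free_group)))" for i j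
    have normX: "os_norm (concrete_opspace S) N (\<lambda>i j. \<Sum>l\<in>UNIV. scaleC_op (X l i j) (u (dual_gen l))) \<le> ennreal 1"
    proof (rule os_norm_concrete_leI)
      fix h :: "nat \<Rightarrow> nat ell2"
      have "(\<Sum>j<N. blinfun_apply (\<Sum>l\<in>UNIV. scaleC_op (X l i j) (u (dual_gen l))) (h j)) =
          (1 / of_real c) *\<^sub>C (\<Sum>j<N. \<Sum>l\<in>UNIV. q (inv (s l) i) j *\<^sub>C T l (h j))" for i
        by (rule ell2_eqI) (simp add: blinfun.sum_left X_def T_def sum_divide_distrib)
      then have "(\<Sum>i<N. (norm (\<Sum>j<N. blinfun_apply (\<Sum>l\<in>UNIV. scaleC_op (X l i j) (u (dual_gen l))) (h j)))\<^sup>2) =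
          (\<Sum>i<N. (norm (\<Sum>j<N. \<Sum>l\<in>UNIV. q (inv (s l) i) j *\<^sub>C T l (h j)))\<^sup>2) / c\<^sup>2"
        by (simp add: norm_scaleC norm_divide power_divide sum_divide_distrib)
      also have "\<dots> \<le> 1\<^sup>2 * (\<Sum>j<N. (norm (h j))\<^sup>2)"
        using bound[of h] c by (simp add: pos_divide_le_eq mult.commute)
      finally show "(\<Sum>i<N. (norm (\<Sum>j<N. blinfun_apply (\<Sum>l\<in>UNIV. scaleC_op (X l i j) (u (dual_gen l))) (h j)))\<^sup>2)
          \<le> 1\<^sup>2 * (\<Sum>j<N. (norm (h j))\<^sup>2)" .
    qed simp
    have normZ: "os_norm (concrete_opspace gen_span) N Z \<le> ennreal 1"
    proof (rule os_norm_concrete_leI)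
      fix h :: "nat \<Rightarrow> 'n free_group ell2"
      have "(\<Sum>j<N. blinfun_apply (Z i j) (h j)) =
          (1 / of_real \<beta>) *\<^sub>C (\<Sum>l\<in>UNIV. translate (free_gen l) (h (inv (s l) i)))" if i: "i < N" for i
      proof (rule ell2_eqI)
        fix v
        have iff: "i = s l j \<longleftrightarrow> inv (s l) i = j" for l j
          using permutes_inv_eq[OF s[of l]] by metis
        have "ell2_coord (\<Sum>j<N. blinfun_apply (Z i j) (h j)) v =
            (\<Sum>j<N. \<Sum>l\<in>UNIV. if inv (s l) i = j then ell2_coord (translate (free_gen l) (h j)) v / \<beta> else 0)"
          unfolding Z_def blinfun.sum_left scaleC_op_apply ell2_coord_sum ell2_coord_simps iff left_regular_apply
          by (intro sum.cong) auto
        also have "\<dots> = (\<Sum>l\<in>UNIV. \<Sum>j<N. if inv (s l) i = j then ell2_coord (translate (free_gen l) (h j)) v / \<beta> else 0)"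
          by (rule sum.swap)
        also have "\<dots> = (\<Sum>l\<in>UNIV. ell2_coord (translate (free_gen l) (h (inv (s l) i))) v / \<beta>)"
          using permutes_in_image[OF permutes_inv[OF s], of _ i] i by simp
        finally show "ell2_coord (\<Sum>j<N. blinfun_apply (Z i j) (h j)) v =
            ell2_coord ((1 / of_real \<beta>) *\<^sub>C (\<Sum>l\<in>UNIV. translate (free_gen l) (h (inv (s l) i)))) v"
          by (simp add: sum_divide_distrib)
      qed
      then have "(\<Sum>i<N. (norm (\<Sum>j<N. blinfun_apply (Z i j) (h j)))\<^sup>2) =
          (\<Sum>i<N. (norm (\<Sum>l\<in>UNIV. translate (free_gen l) (h (inv (s l) i))))\<^sup>2) / \<beta>\<^sup>2"
        by (simp add: norm_scaleC norm_divide power_divide sum_divide_distrib)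
      also have "\<dots> \<le> 1\<^sup>2 * (\<Sum>j<N. (norm (h j))\<^sup>2)"
        using left_regular_sum_bound[OF n s, of h] \<beta>
        by (simp add: \<beta>_def[symmetric] pos_divide_le_eq mult.commute)
      finally show "(\<Sum>i<N. (norm (\<Sum>j<N. blinfun_apply (Z i j) (h j)))\<^sup>2) \<le> 1\<^sup>2 * (\<Sum>j<N. (norm (h j))\<^sup>2)" .
    qed simp
    have Zin: "Z i j \<in> gen_span" for i j
      unfolding Z_def gen_span_def by (intro cop.span_sum cop.span_scale cop.span_base) auto
    have eZ: "dual_gen l (Z i j) = of_bool (i = s l j) / complex_of_real \<beta>" for l i j
      unfolding Z_def by (rule dual_gen_sum_left_regular)
    \<comment> \<open>Coordinates of \<Sum> U_l \<otimes> U_l q applied to the diagonal vector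
      \<Sum> \<delta>_j \<otimes> \<delta>_j, before the factors c, \<beta> and
      \<open>sqrt (real N)\<close> are divided out.\<close>
    define W where "W i p = (\<Sum>j<N. \<Sum>l\<in>UNIV. q (inv (s l) p) j * of_bool (i = s l j))" for i p
    \<comment> \<open>The diagonal vector, normalised to length one.\<close>
    define h where "h j r = (of_bool (j = r) / sqrt (real N) :: complex)" for j r :: nat
    have hnorm: "(\<Sum>j<N. \<Sum>r<N. (cmod (h j r))\<^sup>2) = 1"
    proof -
      have "(cmod (h j r))\<^sup>2 = (if j = r then 1 / real N else 0)" for j r
        by (simp add: h_def norm_divide power_divide)
      then show ?thesis using N by simp
    qed
    have "ennreal (sqrt (\<Sum>i<N. \<Sum>p<N. (cmod (\<Sum>j<N. \<Sum>r<N.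
        (if p < N \<and> r < N then \<Sum>l\<in>UNIV. X l p r * dual_gen l (Z i j) else 0) * h j r))\<^sup>2))
        \<le> os_norm (matrix_opspace N) N
          (\<lambda>i j p r. if p < N \<and> r < N then \<Sum>l\<in>UNIV. X l p r * dual_gen l (Z i j) else 0)"
      unfolding os_norm_matrix by (rule SUP_upper) (simp add: hnorm)
    also have "\<dots> \<le> cb_norm (concrete_opspace S) (os_dual (E_lambda TYPE('n)))
        (inv_into (os_carrier (os_dual (E_lambda TYPE('n)))) u)"
      by (rule os_norm_matrix_le_cb_norm_inverse[OF u bij _ _ _ Zin])
         (use N normX normZ in auto)
    also have "\<dots> \<le> ennreal D" by (rule D(1))
    finally have le: "(\<Sum>i<N. \<Sum>p<N. (cmod (\<Sum>j<N. \<Sum>r<N.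
        (if p < N \<and> r < N then \<Sum>l\<in>UNIV. X l p r * dual_gen l (Z i j) else 0) * h j r))\<^sup>2) \<le> D\<^sup>2"
      using D(2) by (simp only: ennreal_le_iff sqrt_le_D)
    have val: "(\<Sum>j<N. \<Sum>r<N.
        (if p < N \<and> r < N then \<Sum>l\<in>UNIV. X l p r * dual_gen l (Z i j) else 0) * h j r) =
        W i p / (c * \<beta> * sqrt (real N))" if "p < N" for i p
    proof -
      have "(\<Sum>r<N. (if p < N \<and> r < N then \<Sum>l\<in>UNIV. X l p r * dual_gen l (Z i j) else 0) * h j r) =
          (\<Sum>r<N. if j = r then (\<Sum>l\<in>UNIV. X l p r * dual_gen l (Z i j)) / sqrt (real N) else 0)" if "j < N" for j
        using \<open>p < N\<close> by (intro sum.cong) (auto simp: h_def)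
      then have "(\<Sum>j<N. \<Sum>r<N. (if p < N \<and> r < N then \<Sum>l\<in>UNIV. X l p r * dual_gen l (Z i j) else 0) * h j r) =
          (\<Sum>j<N. (\<Sum>l\<in>UNIV. X l p j * dual_gen l (Z i j)) / sqrt (real N))"
        by simp
      then show ?thesis
        by (simp only: W_def X_def eZ sum_divide_distrib times_divide_times_eq divide_divide_eq_left of_real_mult)
    qed
    have "(\<Sum>i<N. \<Sum>p<N. (cmod (W i p))\<^sup>2) / (c * \<beta> * sqrt (real N))\<^sup>2 \<le> D\<^sup>2"
      using le val c \<beta> by (simp add: norm_divide norm_mult power_divide sum_divide_distrib abs_mult)
    then have W: "(\<Sum>i<N. \<Sum>p<N. (cmod (W i p))\<^sup>2) \<le> D\<^sup>2 * (c * \<beta> * sqrt (real N))\<^sup>2"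
      using c \<beta> N by (simp add: pos_divide_le_eq)
    \<comment> \<open>Pairing with the diagonal vector gives the trace of U_l q U_l^T for each l,
      which is the trace of q since U_l is a permutation matrix.\<close>
    have trace: "(\<Sum>i<N. W i i) = of_nat CARD('n) * (\<Sum>x<N. q x x)"
    proof -
      have "(\<Sum>i<N. W i i) = (\<Sum>i<N. \<Sum>l\<in>UNIV. \<Sum>j<N. q (inv (s l) i) j * of_bool (i = s l j))"
        unfolding W_def by (intro sum.cong refl) (rule sum.swap)
      also have "\<dots> = (\<Sum>l\<in>UNIV. \<Sum>i<N. \<Sum>j<N. q (inv (s l) i) j * of_bool (i = s l j))"
        by (rule sum.swap)
      also have "\<dots> = (\<Sum>l\<in>(UNIV :: 'n set). \<Sum>x<N. q x x)"
      proof (rule sum.cong[OF refl])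
        fix l
        have iff: "i = s l j \<longleftrightarrow> inv (s l) i = j" for i j
          using permutes_inv_eq[OF s[of l]] by metis
        have "(\<Sum>j<N. q (inv (s l) i) j * of_bool (i = s l j)) = q (inv (s l) i) (inv (s l) i)" if "i < N" for i
        proof -
          have "(\<Sum>j<N. q (inv (s l) i) j * of_bool (i = s l j)) =
              (\<Sum>j<N. if inv (s l) i = j then q (inv (s l) i) j else 0)"
            unfolding iff by (rule sum.cong) auto
          then show ?thesis
            using permutes_in_image[OF permutes_inv[OF s[of l]], of i] that by simp
        qed
        then have "(\<Sum>i<N. \<Sum>j<N. q (inv (s l) i) j * of_bool (i = s l j)) =
            (\<Sum>i<N. q (inv (s l) i) (inv (s l) i))" by (intro sum.cong) auto
        also have "\<dots> = (\<Sum>x<N. q x x)"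
          using sum.permute[OF permutes_inv[OF s[of l]], of "\<lambda>x. q x x"] by (simp add: comp_def)
        finally show "(\<Sum>i<N. \<Sum>j<N. q (inv (s l) i) j * of_bool (i = s l j)) = (\<Sum>x<N. q x x)" .
      qed
      finally show ?thesis by simp
    qed
    \<comment> \<open>Cauchy-Schwarz against the diagonal vector of squared length N; together with
      the N already contained in the bound for W this gives N^2, which cancels against the
      normalisation of the trace.\<close>
    have "(cmod (\<Sum>i<N. W i i))\<^sup>2 \<le> real N * (\<Sum>i<N. (cmod (W i i))\<^sup>2)"
      using ip_Cauchy_Schwarz[of "{..<N}" "\<lambda>_. 1" "\<lambda>i. W i i"] by (simp add: ip_def nsq_def)
    also have "\<dots> \<le> real N * (\<Sum>i<N. \<Sum>p<N. (cmod (W i p))\<^sup>2)"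
      by (intro mult_left_mono sum_mono member_le_sum[of _ "{..<N}" "\<lambda>p. (cmod (W _ p))\<^sup>2"]) auto
    also have "\<dots> \<le> real N * (D\<^sup>2 * (c * \<beta> * sqrt (real N))\<^sup>2)"
      by (intro mult_left_mono W) simp
    also have "\<dots> = (real N * (\<beta> * D * c))\<^sup>2"
      by (simp add: power_mult_distrib) (simp add: power2_eq_square mult_ac)
    finally have "cmod (\<Sum>i<N. W i i) \<le> real N * (\<beta> * D * c)"
      by (rule power2_le_imp_le) (use \<beta> D(2) c in simp)
    moreover have "?n * ((1 - \<epsilon>) * real N) \<le> Re (\<Sum>i<N. W i i)"
      unfolding trace using q by (simp add: mult_left_mono)
    ultimately have "?n * ((1 - \<epsilon>) * real N) \<le> real N * (\<beta> * D * c)"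
      using complex_Re_le_cmod[of "\<Sum>i<N. W i i"] by linarith
    then have "real N * (?n * (1 - \<epsilon>)) \<le> real N * (\<beta> * D * c)"
      by (simp add: mult_ac)
    then show ?thesis using N by (simp add: c_def)
  qed
  \<comment> \<open>Collects the coefficients of \<epsilon> when \<open>eps\<close> is solved for
    n.\<close>
  define K where "K = ?n + \<beta> * D * (1 + ?n)"
  have K: "K \<ge> 0" using \<beta> D(2) by (simp add: K_def)
  have "?n \<le> \<beta> * (C * D) + e" if "e > 0" for e
  proof -
    define \<epsilon> where "\<epsilon> = e / (K + 1)"
    have \<epsilon>: "\<epsilon> > 0" using that K by (simp add: \<epsilon>_def)
    have "\<epsilon> * K \<le> e" using that K by (simp add: \<epsilon>_def pos_divide_le_eq)
    moreover have "?n \<le> \<beta> * (C * D) + \<epsilon> * K"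
      using eps[OF \<epsilon>] by (simp add: K_def algebra_simps)
    ultimately show ?thesis by linarith
  qed
  then show ?thesis
    unfolding \<beta>_def by (rule field_le_epsilon)
qed

theorem mainTheorem4:
  fixes n :: nat
  assumes "CARD('n::finite) = n" and "n \<ge> 2"
  shows "d_SK (os_dual (E_lambda TYPE('n)))
           \<ge> ennreal (real n / (2 * sqrt (real n - 1)))"
  unfolding d_SK_def d_cb_def
proof (intro INF_greatest)
  fix S :: "nat ell2_op set" and u :: "('n free_group ell2_op \<Rightarrow> complex) \<Rightarrow> nat ell2_op"
  let ?V = "os_dual (E_lambda TYPE('n))"
  assume S_all: "S \<in> {F. cop.subspace F \<and> closed F \<and> (\<forall>T\<in>F. compact_op T)}"
    and u_all: "u \<in> {u. os_linear ?V (concrete_opspace S) u \<and>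
      bij_betw u (os_carrier ?V) (os_carrier (concrete_opspace S))}"
  have S: "\<And>T. T \<in> S \<Longrightarrow> compact_op T" using S_all by auto
  have u: "os_linear ?V (concrete_opspace S) u" "bij_betw u (os_carrier ?V) S" using u_all by auto
  define a where "a = cb_norm ?V (concrete_opspace S) u"
  define d where "d = cb_norm (concrete_opspace S) ?V (inv_into (os_carrier ?V) u)"
  \<comment> \<open>Fixes an arbitrary generator; its functional witnesses that the dual is not
    zero.\<close>
  obtain l :: 'n where True by blast
  define T where "T = u (dual_gen l)"
  \<comment> \<open>In the extended reals 0 times infinity is 0, so both factors must be shown
    nonzero before the infinite case can be settled. If a were 0, the tree bound would force T = 0,
    contradicting injectivity of u.\<close>
  have "a \<noteq> 0"
  proof
    assume "a = 0"
    have "blinfun_apply T x = 0" for x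
    proof -
      \<comment> \<open>With H concentrated at the neutral element, the component of the image at
        g_l is exactly T x; the ball of radius one already contains g_l.\<close>
      define H where "H w = (if w = 0 then x else 0)" for w :: "'n free_group"
      let ?y = "\<lambda>v. \<Sum>w\<in>word_ball 1. \<Sum>l\<in>UNIV. of_bool (v = free_gen l + w) *\<^sub>C blinfun_apply (u (dual_gen l)) (H w)"
      have "(\<Sum>v\<in>word_ball 1. (norm (?y v))\<^sup>2) \<le> 0\<^sup>2 * (\<Sum>w\<in>word_ball 1. (norm (H w))\<^sup>2)"
        by (rule tree_bound_of_cb_norm[OF u(1)]) (use \<open>a = 0\<close> in \<open>simp_all add: a_def\<close>)
      then have "(\<Sum>v\<in>word_ball 1. (norm (?y v))\<^sup>2) = 0"
        using sum_nonneg[of "word_ball 1" "\<lambda>v. (norm (?y v))\<^sup>2"] by simp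
      then have "\<forall>v\<in>word_ball 1. (norm (?y v))\<^sup>2 = 0"
        by (subst (asm) sum_nonneg_eq_0_iff) auto
      moreover have "free_gen l \<in> word_ball 1"
        using free_gen_add_word_ball[of 0 0 l] by simp
      ultimately have y: "?y (free_gen l) = 0" by auto
      have "?y (free_gen l) = (\<Sum>w\<in>(word_ball 1 :: 'n free_group set). if w = 0 then (\<Sum>l'\<in>UNIV. if l = l' then blinfun_apply (u (dual_gen l')) x else 0) else 0)"
      proof (rule sum.cong[OF refl])
        fix w :: "'n free_group"
        show "(\<Sum>l'\<in>UNIV. of_bool (free_gen l = free_gen l' + w) *\<^sub>C blinfun_apply (u (dual_gen l')) (H w)) =
            (if w = 0 then (\<Sum>l'\<in>UNIV. if l = l' then blinfun_apply (u (dual_gen l')) x else 0) else 0)"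
          by (cases "w = 0") (simp_all add: H_def blinfun.zero_right scaleC_of_bool)
      qed
      also have "\<dots> = blinfun_apply T x" by (simp add: T_def)
      finally show ?thesis using y by simp
    qed
    then have "T = 0" by (intro blinfun_eqI) simp
    moreover have "u (\<lambda>T. \<Sum>l\<in>{}. 0 * dual_gen l T) = 0"
      using os_linear_dual_gen_lincomb[OF u(1), of "\<lambda>_. 0" "{}"] by simp
    ultimately have "dual_gen l = (\<lambda>T. \<Sum>l\<in>{}. 0 * dual_gen l T)"
      using inj_onD[OF bij_betw_imp_inj_on[OF u(2)] _ dual_gen_in_dual dual_gen_lincomb_in_dual,
          of l "\<lambda>_. 0" "{}"] by (simp add: T_def)
    then have "dual_gen l (\<Sum>l'\<in>UNIV. scaleC_op 1 (left_regular (free_gen l'))) = 0" by simp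
    then show False by (simp only: dual_gen_sum_left_regular zero_neq_one[symmetric])
  qed
  moreover have "d \<noteq> 0"
  proof -
    \<comment> \<open>The added 1 makes r T a contraction without a case distinction on T; testing
      the inverse on this 1 by 1 matrix and on \<lambda>(g_l) gives d \<ge> r > 0.\<close>
    define r where "r = 1 / (1 + norm T)"
    have nT: "1 + norm T > 0" using norm_ge_zero[of T] by linarith
    have r: "r > 0" "r * norm T \<le> 1" using nT by (simp_all add: r_def pos_divide_le_eq)
    define X where "X l' i j = (if l' = l then complex_of_real r else 0)" for l' and i j :: nat
    have X: "(\<Sum>l'\<in>UNIV. scaleC_op (X l' i j) (u (dual_gen l'))) = scaleC_op (of_real r) T" for i j
    proof -
      have "(\<Sum>l'\<in>UNIV. scaleC_op (X l' i j) (u (dual_gen l'))) =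
          (\<Sum>l'\<in>UNIV. if l' = l then scaleC_op (of_real r) (u (dual_gen l')) else 0)"
        by (rule sum.cong) (auto simp: X_def)
      then show ?thesis by (simp add: T_def)
    qed
    have "os_norm (concrete_opspace S) 1 (\<lambda>i j. \<Sum>l'\<in>UNIV. scaleC_op (X l' i j) (u (dual_gen l'))) \<le> ennreal 1"
      unfolding X
    proof (rule os_norm_concrete_leI)
      fix h :: "nat \<Rightarrow> nat ell2"
      have "r * norm (blinfun_apply T (h 0)) \<le> r * (norm T * norm (h 0))"
        using r(1) by (intro mult_left_mono norm_blinfun) simp
      also have "\<dots> \<le> 1 * norm (h 0)"
        using mult_right_mono[OF r(2) norm_ge_zero[of "h 0"]] by (simp add: mult_ac)
      finally have "(r * norm (blinfun_apply T (h 0)))\<^sup>2 \<le> (norm (h 0))\<^sup>2"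
        using r(1) by (intro power_mono) auto
      then show "(\<Sum>i<(1::nat). (norm (\<Sum>j<1. blinfun_apply (scaleC_op (of_real r) T) (h j)))\<^sup>2) \<le> 1\<^sup>2 * (\<Sum>j<1. (norm (h j))\<^sup>2)"
        using r(1) by (simp add: norm_scaleC)
    qed simp
    moreover have "os_norm (concrete_opspace gen_span) 1 (\<lambda>i j. left_regular (free_gen l)) \<le> ennreal 1"
      by (rule os_norm_concrete_leI) (simp_all add: norm_translate)
    moreover have lr: "left_regular (free_gen l) \<in> gen_span"
      unfolding gen_span_def by (rule cop.span_base) simp
    ultimately have le: "os_norm (matrix_opspace 1) 1
        (\<lambda>i j p q. if p < 1 \<and> q < 1 then \<Sum>l'\<in>UNIV. X l' p q * dual_gen l' (left_regular (free_gen l)) else 0) \<le> d"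
      unfolding d_def by (intro os_norm_matrix_le_cb_norm_inverse[OF u]) simp_all
    have val: "(\<Sum>l'\<in>UNIV. X l' p q * dual_gen l' (left_regular (free_gen l))) = of_real r" for p q
    proof -
      have "(\<Sum>l'\<in>UNIV. X l' p q * dual_gen l' (left_regular (free_gen l))) = (\<Sum>l'\<in>UNIV. if l' = l then of_real r else 0)"
        by (rule sum.cong) (auto simp: X_def matrix_coef_def lr coord_translate_ket)
      then show ?thesis by simp
    qed
    have "ennreal r \<le> os_norm (matrix_opspace 1) 1 (\<lambda>i j p q. if p < 1 \<and> q < 1 then of_real r else 0)"
      unfolding os_norm_matrix
      by (rule SUP_upper2[of "\<lambda>_ _. 1"]) (use r(1) in simp_all)
    also have "\<dots> \<le> d" using le unfolding val .
    finally have "ennreal r \<le> d" .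
    then show ?thesis using r(1) by auto
  qed
  ultimately have "ennreal (real n / (2 * sqrt (real n - 1))) \<le> a * d"
  \<comment> \<open>If one factor is infinite, the other is nonzero and the product is infinite;
    otherwise both are real numbers and the estimate above applies.\<close>
  proof (cases "a = top \<or> d = top")
    case True
    then show ?thesis
      using \<open>a \<noteq> 0\<close> \<open>d \<noteq> 0\<close> by (auto simp: ennreal_mult_top ennreal_top_mult)
  next
    case False
    then obtain C D where CD: "a = ennreal C" "C \<ge> 0" "d = ennreal D" "D \<ge> 0"
      by (metis ennreal_cases)
    have n2: "CARD('n) \<ge> 2" using assms by simp
    have "real CARD('n) \<le> 2 * sqrt (real CARD('n) - 1) * (C * D)"
      by (rule cb_norm_product_lower_bound[OF n2 S u])
         (use CD in \<open>simp_all add: a_def d_def\<close>)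
    then have "real n \<le> C * D * (2 * sqrt (real n - 1))"
      using assms(1) by (simp add: mult_ac)
    then have "real n / (2 * sqrt (real n - 1)) \<le> C * D"
      using assms(2) by (simp add: pos_divide_le_eq)
    then show ?thesis
      using CD by (simp add: ennreal_mult[symmetric] ennreal_leI)
  qed
  then show "ennreal (real n / (2 * sqrt (real n - 1)))
      \<le> cb_norm ?V (concrete_opspace S) u * cb_norm (concrete_opspace S) ?V (inv_into (os_carrier ?V) u)"
    by (simp add: a_def d_def)
qed

end
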